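(* Let $\lambda$ be a partition with $|\lambda|=N$, let $T\in\mathsf{SYT}(\lambda)$, let $[a,b]\subseteq[1,N]$ be an interval, and let $\mu$ be the shape of $\mathsf{jdt}(T_{[a,b]})$. Then the crystal skeleton $\mathsf{CS}(\mu)$ is a subgraph of $\mathsf{CS}(\lambda)$ up to relabelling of the edges. More precisely, when the edges of crystal skeletons are labeled by Dyck pattern intervals, the edge labels of $\mathsf{CS}(\mu)$ differ from those of the corresponding edges of $\mathsf{CS}(\lambda)$ by a shift of $-a+1$.
   Context: French notation. $T_{[a,b]}$ is the skew tableau obtained by restricting $T$ to the entries in $[a,b]$, and $\mathsf{jdt}$ denotes jeu de taquin rectification to a straight shape. $\mathsf{SYT}(\lambda)$: standard tableaux; $\mathsf{row}(T)$ reads rows left to right from top row to bottom row; $\mathsf{std}$ replaces the $a_j$ entries $j$, in reading order, by $a_1+\dots+a_{j-1}+1,\dots,a_1+\dots+a_j$. Crystal operator $f_i$: in the subword of letters $i,i+1$ of the reading word, bracket each $i+1$ with an unbracketed $i$ to its right (parenthesis matching); $f_i$ changes the rightmost unbracketed $i$ to $i+1$. For a permutation $\pi$ of $[N]$ and $I=[i,i+2m]\subseteq[N]$, $m\ge1$, $I$ is a Dyck pattern interval of $\pi$ if the RSK insertion tableau of the subword $\pi|_I$ of letters in $I$ has bottom row $i,\dots,i+m$ and top row $i+m+1,\dots,i+2m$; a Dyck pattern interval of $T$ is one of $\mathsf{row}(T)$. The crystal skeleton $\mathsf{CS}(\lambda)$ is the directed graph on $\mathsf{SYT}(\lambda)$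 with, for each Dyck pattern interval $I=[i,i+2m]$ of $T$, an edge $T\xrightarrow{I}\mathsf{std}(f_i(b))$, where $b$ is obtained from $T$ by replacing entries $i,\dots,i+m$ by $i$ and $i+m+1,\dots,i+2m$ by $i+1$. (Equivalently, $\mathsf{CS}(\lambda)$ is the crystal $B(\lambda)_n$, $n\ge N$, of semistandard tableaux with entries in $[n]$, with each quasi-crystal $\{b:\mathsf{std}(b)=T\}$ contracted to the vertex $T$.) *)

theory Defs
  imports Main
begin

(* French notation: a cell is (row, column), 0-indexed; row 0 is the bottom
   (longest) row, row r+1 lies directly above row r.  A (skew) filling is a
   function from cells to nat, with 0 meaning "empty cell". *)

type_synonym cell = "nat \<times> nat"
type_synonym filling = "cell \<Rightarrow> nat"

definition is_partition :: "nat list \<Rightarrow> bool" where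
  "is_partition la \<longleftrightarrow> sorted (rev la) \<and> 0 \<notin> set la"

definition cells :: "nat list \<Rightarrow> cell set" where
  "cells la = {(r, c). r < length la \<and> c < la ! r}"

definition SYT :: "nat list \<Rightarrow> filling set" where
  "SYT la = {T. bij_betw T (cells la) {1..sum_list la}
       \<and> (\<forall>x. x \<notin> cells la \<longrightarrow> T x = 0)
       \<and> (\<forall>r c. (r, Suc c) \<in> cells la \<longrightarrow> T (r, c) < T (r, Suc c))
       \<and> (\<forall>r c. (Suc r, c) \<in> cells la \<longrightarrow> T (r, c) < T (Suc r, c))}"

definition rcells :: "nat list \<Rightarrow> cell list" where
  "rcells la = concat (map (\<lambda>r. map (\<lambda>c. (r, c)) [0..<la ! r]) (rev [0..<length la]))"

definition row_word :: "nat list \<Rightarrow> filling \<Rightarrow> nat list" where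
  "row_word la T = map T (rcells la)"

definition fill :: "nat list \<Rightarrow> nat list \<Rightarrow> filling" where
  "fill la w = (\<lambda>x. case map_of (zip (rcells la) w) x of None \<Rightarrow> 0 | Some v \<Rightarrow> v)"

definition std_word :: "nat list \<Rightarrow> nat list" where
  "std_word w = map (\<lambda>k. Suc (card {j. j < length w \<and> (w ! j < w ! k \<or> (w ! j = w ! k \<and> j < k))}))
                    [0..<length w]"

definition std :: "nat list \<Rightarrow> filling \<Rightarrow> filling" where
  "std la b = fill la (std_word (row_word la b))"

(* Positions of unbracketed letters i: scanning left to right, each i+1 is
   bracketed with an unbracketed i to its right (parenthesis matching).
   k = current position, c = number of currently unmatched letters i+1. *)
fun unbracketed :: "nat \<Rightarrow> nat \<Rightarrow> nat \<Rightarrow> nat list \<Rightarrow> nat list" where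
  "unbracketed i k c [] = []"
| "unbracketed i k c (x # xs) =
     (if x = Suc i then unbracketed i (Suc k) (Suc c) xs
      else if x = i then
        (if 0 < c then unbracketed i (Suc k) (c - 1) xs else k # unbracketed i (Suc k) c xs)
      else unbracketed i (Suc k) c xs)"

definition f_word :: "nat \<Rightarrow> nat list \<Rightarrow> nat list option" where
  "f_word i w = (case unbracketed i 0 0 w of [] \<Rightarrow> None
                  | ps \<Rightarrow> Some (w[last ps := Suc i]))"

definition f_tab :: "nat list \<Rightarrow> nat \<Rightarrow> filling \<Rightarrow> filling option" where
  "f_tab la i b = map_option (fill la) (f_word i (row_word la b))"

(* RSK row insertion; a tableau is a list of rows, first row = bottom row. *)
fun row_insert :: "nat \<Rightarrow> nat list list \<Rightarrow> nat list list" where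
  "row_insert x [] = [[x]]"
| "row_insert x (r # rs) =
     (let j = length (takeWhile (\<lambda>y. y \<le> x) r) in
      if j = length r then (r @ [x]) # rs
      else (r[j := x]) # row_insert (r ! j) rs)"

definition rsk_P :: "nat list \<Rightarrow> nat list list" where
  "rsk_P w = foldl (\<lambda>P x. row_insert x P) [] w"

definition dyck_interval :: "nat list \<Rightarrow> nat \<Rightarrow> nat \<Rightarrow> bool" where
  "dyck_interval pi i m \<longleftrightarrow> 1 \<le> m \<and> 1 \<le> i \<and> i + 2 * m \<le> length pi \<and>
     rsk_P (filter (\<lambda>x. i \<le> x \<and> x \<le> i + 2 * m) pi)
       = [[i..<i + m + 1], [i + m + 1..<i + 2 * m + 1]]"

definition collapse :: "filling \<Rightarrow> nat \<Rightarrow> nat \<Rightarrow> filling" where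
  "collapse T i m = (\<lambda>x. if i \<le> T x \<and> T x \<le> i + m then i
                         else if i + m + 1 \<le> T x \<and> T x \<le> i + 2 * m then Suc i
                         else T x)"

definition cs_edge :: "nat list \<Rightarrow> filling \<Rightarrow> nat set \<Rightarrow> filling \<Rightarrow> bool" where
  "cs_edge la T I T' \<longleftrightarrow> T \<in> SYT la \<and>
     (\<exists>i m. I = {i..i + 2 * m} \<and> dyck_interval (row_word la T) i m \<and>
        (\<exists>c. f_tab la i (collapse T i m) = Some c \<and> T' = std la c))"

definition restrict_tab :: "filling \<Rightarrow> nat \<Rightarrow> nat \<Rightarrow> filling" where
  "restrict_tab T a b = (\<lambda>x. if a \<le> T x \<and> T x \<le> b then T x else 0)"

definition inner_cells :: "filling \<Rightarrow> cell set" where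
  "inner_cells S = {x. S x = 0 \<and> (\<exists>y. S y \<noteq> 0 \<and> fst x \<le> fst y \<and> snd x \<le> snd y)}"

definition inner_corner :: "filling \<Rightarrow> cell \<Rightarrow> bool" where
  "inner_corner S x \<longleftrightarrow> x \<in> inner_cells S \<and> (Suc (fst x), snd x) \<notin> inner_cells S
      \<and> (fst x, Suc (snd x)) \<notin> inner_cells S"

inductive hole_move :: "filling \<Rightarrow> cell \<Rightarrow> filling \<Rightarrow> bool" where
  stop: "S (r, Suc c) = 0 \<Longrightarrow> S (Suc r, c) = 0 \<Longrightarrow> hole_move S (r, c) S"
| right: "S (r, Suc c) \<noteq> 0 \<Longrightarrow> (S (Suc r, c) = 0 \<or> S (r, Suc c) < S (Suc r, c)) \<Longrightarrow>
     hole_move (S((r, c) := S (r, Suc c), (r, Suc c) := 0)) (r, Suc c) S' \<Longrightarrow>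
     hole_move S (r, c) S'"
| up: "S (Suc r, c) \<noteq> 0 \<Longrightarrow> (S (r, Suc c) = 0 \<or> S (Suc r, c) < S (r, Suc c)) \<Longrightarrow>
     hole_move (S((r, c) := S (Suc r, c), (Suc r, c) := 0)) (Suc r, c) S' \<Longrightarrow>
     hole_move S (r, c) S'"

definition jdt_slide :: "filling \<Rightarrow> filling \<Rightarrow> bool" where
  "jdt_slide S S' \<longleftrightarrow> (\<exists>x. inner_corner S x \<and> S x = 0 \<and> hole_move S x S')"

definition rectification :: "filling \<Rightarrow> filling \<Rightarrow> bool" where
  "rectification S R \<longleftrightarrow> jdt_slide\<^sup>*\<^sup>* S R \<and> inner_cells R = {}"

end

theory Submission
  imports Defs
begin

text \<open>Knuth moves act on the positions of a word and elementary dual equivalences on its values; these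
  two actions commute. Any two standard tableaux of the same straight shape are connected by dual
  equivalences, and a straight tableau is determined by the Knuth class of its reading word. A jeu de taquin
  slide is a chain of Knuth moves. Hence the dual equivalences leading from \<open>R\<close> to a tableau \<open>U\<close>, applied to the
  entries of \<open>T\<close> in \<open>[a, b]\<close>, give a tableau \<open>\<phi> U\<close> whose part in \<open>[a, b]\<close> rectifies to \<open>U\<close>.
  An edge of the crystal skeleton is itself a chain of dual equivalences: on the positions of the letters of
  the Dyck pattern interval it is a jeu de taquin slide. Up to its effect, the chain depends only on the Knuth
  class, so \<open>\<phi>\<close> maps edges to edges.\<close>

section \<open>Knuth equivalence\<close>

text \<open>The chain of dual equivalences that realises an edge is not canonical: the edge at
  \<open>U\<close> and the edge at \<open>\<phi> U\<close> each come with some chain, and these need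
  not be the same list. Chains are therefore compared only through their results: if a word is Knuth
  equivalent to the reading word of a straight tableau, then Knuth equivalent results of two chains
  on it are equal (\<open>dual_words_eqI\<close>). The same principle frees \<open>\<phi>\<close>
  from the chosen chain between \<open>R\<close> and \<open>U\<close>. An edge becomes a slide after
  passing to the inverse permutation: a Knuth move on the list of positions of consecutive values is
  a dual equivalence on the word. So one computation with two rows, \<open>keq_slide_row\<close>,
  serves the vertical steps of jeu de taquin, where the letters are entries, and the edges, where
  they are positions. All chains use windows of values inside [a, b]; hence they commute with
  restriction to [a, b] and fix the other entries of \<open>T\<close>. Entries of \<open>U\<close>
  start at 1 and those of \<open>R\<close> at a, which is the shift of the edge labels.\<close>

inductive kstep :: "nat list \<Rightarrow> nat list \<Rightarrow> bool" where
  xzy: "x < y \<Longrightarrow> y < z \<Longrightarrow> kstep (u @ [x, z, y] @ v) (u @ [z, x, y] @ v)"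
| zxy: "x < y \<Longrightarrow> y < z \<Longrightarrow> kstep (u @ [z, x, y] @ v) (u @ [x, z, y] @ v)"
| yxz: "x < y \<Longrightarrow> y < z \<Longrightarrow> kstep (u @ [y, x, z] @ v) (u @ [y, z, x] @ v)"
| yzx: "x < y \<Longrightarrow> y < z \<Longrightarrow> kstep (u @ [y, z, x] @ v) (u @ [y, x, z] @ v)"

abbreviation keq :: "nat list \<Rightarrow> nat list \<Rightarrow> bool" where
  "keq \<equiv> kstep\<^sup>*\<^sup>*"

lemma kstep_sym: "kstep v w \<Longrightarrow> kstep w v"
  by (induction rule: kstep.induct) (blast intro: kstep.intros)+

lemma keq_sym: "keq v w \<Longrightarrow> keq w v"
  by (induction rule: rtranclp_induct) (auto intro: converse_rtranclp_into_rtranclp kstep_sym)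

lemma kstep_mset: "kstep v w \<Longrightarrow> set w = set v \<and> distinct w = distinct v \<and> length w = length v"
  by (induction rule: kstep.induct) auto

lemma keq_mset: "keq v w \<Longrightarrow> set w = set v \<and> distinct w = distinct v \<and> length w = length v"
  by (induction rule: rtranclp_induct) (auto dest: kstep_mset)

lemma kstep_append: "kstep v w \<Longrightarrow> kstep (a @ v @ b) (a @ w @ b)"
proof (induction rule: kstep.induct)
  case (xzy x y z u v) then show ?case using kstep.xzy[of x y z "a @ u" "v @ b"] by simp
next
  case (zxy x y z u v) then show ?case using kstep.zxy[of x y z "a @ u" "v @ b"] by simp
next
  case (yxz x y z u v) then show ?case using kstep.yxz[of x y z "a @ u" "v @ b"] by simp
next
  case (yzx x y z u v) then show ?case using kstep.yzx[of x y z "a @ u" "v @ b"] by simp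
qed

lemma keq_append: "keq v w \<Longrightarrow> keq (a @ v @ b) (a @ w @ b)"
  by (induction rule: rtranclp_induct) (auto intro: rtranclp.rtrancl_into_rtrancl kstep_append)

lemma keq_app_left: "keq v w \<Longrightarrow> keq (a @ v) (a @ w)"
  using keq_append[of v w a "[]"] by simp

lemma keq_app_right: "keq v w \<Longrightarrow> keq (v @ b) (w @ b)"
  using keq_append[of v w "[]" b] by simp

lemma keq_Cons: "keq v w \<Longrightarrow> keq (a # v) (a # w)"
  using keq_append[of v w "[a]" "[]"] by simp

text \<open>A Knuth move exchanges \<open>x\<close> and \<open>z\<close> in the presence of a letter
  \<open>y\<close> between them in value. If \<open>x\<close> and \<open>z\<close> both lie in the
  interval, so does \<open>y\<close> and the move survives; otherwise the filtered words are
  equal.\<close>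

lemma kstep_filter:
  assumes "kstep v w"
  shows "keq (filter (\<lambda>x. l \<le> x \<and> x \<le> h) v) (filter (\<lambda>x. l \<le> x \<and> x \<le> h) w)"
  using assms
proof (induction rule: kstep.induct)
  case (xzy x y z u v)
  then show ?case
    using kstep.xzy[OF xzy, of "filter (\<lambda>x. l \<le> x \<and> x \<le> h) u" "filter (\<lambda>x. l \<le> x \<and> x \<le> h) v"] by auto
next
  case (zxy x y z u v)
  then show ?case
    using kstep.zxy[OF zxy, of "filter (\<lambda>x. l \<le> x \<and> x \<le> h) u" "filter (\<lambda>x. l \<le> x \<and> x \<le> h) v"] by auto
next
  case (yxz x y z u v)
  then show ?case
    using kstep.yxz[OF yxz, of "filter (\<lambda>x. l \<le> x \<and> x \<le> h) u" "filter (\<lambda>x. l \<le> x \<and> x \<le> h) v"] by auto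
next
  case (yzx x y z u v)
  then show ?case
    using kstep.yzx[OF yzx, of "filter (\<lambda>x. l \<le> x \<and> x \<le> h) u" "filter (\<lambda>x. l \<le> x \<and> x \<le> h) v"] by auto
qed

lemma keq_filter:
  "keq v w \<Longrightarrow> keq (filter (\<lambda>x. l \<le> x \<and> x \<le> h) v) (filter (\<lambda>x. l \<le> x \<and> x \<le> h) w)"
  by (induction rule: rtranclp_induct) (auto intro: rtranclp_trans kstep_filter)

text \<open>The small letter \<open>x\<close> travels left through an increasing run. It passes
  \<open>z\<close> with the left neighbour \<open>p\<close> of \<open>z\<close> as witness, since x
  < p < z; the leading \<open>y\<close> is the witness for the last exchange.\<close>

lemma keq_slide_right:
  assumes "sorted_wrt (<) (y # v)" "x < y"
  shows "keq (y # v @ [x]) (y # x # v)"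
  using assms
proof (induction v rule: rev_induct)
  case (snoc z v)
  have IH: "keq (y # v @ [x]) (y # x # v)"
    using snoc by (auto simp: sorted_wrt_append)
  define u p where "u = butlast (y # v)" and "p = last (y # v)"
  have yv: "y # v = u @ [p]" unfolding u_def p_def by simp
  have p: "p \<in> set (y # v)" unfolding p_def by (rule last_in_set) simp
  have xp: "x < p" "p < z" using p snoc.prems by (auto simp: sorted_wrt_append)
  have "kstep (u @ [p, z, x] @ []) (u @ [p, x, z] @ [])" by (rule kstep.yzx) (use xp in auto)
  then have "kstep ((y # v) @ [z, x]) ((y # v) @ [x, z])" unfolding yv by simp
  moreover have "keq (y # v @ [x, z]) (y # x # v @ [z])"
    using keq_app_right[OF IH, of "[z]"] by simp
  ultimately show ?case by (simp add: converse_rtranclp_into_rtranclp)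
qed simp

text \<open>Mirror image of the previous lemma: the large letter \<open>y\<close> travels left, and
  the right neighbour of the letter that it passes is the witness.\<close>

lemma keq_slide_left:
  assumes "sorted_wrt (<) u" "\<forall>a\<in>set u. a < x" "x < y"
  shows "keq (u @ [y, x]) (y # u @ [x])"
  using assms
proof (induction u)
  case (Cons a u)
  have IH: "keq (u @ [y, x]) (y # u @ [x])" using Cons by auto
  define p v where "p = hd (u @ [x])" and "v = tl (u @ [x])"
  have pv: "u @ [x] = p # v" unfolding p_def v_def by simp
  have "p \<in> set (u @ [x])" unfolding p_def by (cases u) auto
  then have ap: "a < p" "p < y" using Cons.prems by auto
  have "kstep ([] @ [a, y, p] @ v) ([] @ [y, a, p] @ v)" by (rule kstep.xzy) (use ap in auto)
  then have "kstep (a # y # u @ [x]) (y # a # u @ [x])" unfolding pv by simp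
  moreover have "keq (a # u @ [y, x]) (a # y # u @ [x])" using keq_Cons[OF IH] by simp
  ultimately show ?case by simp
qed simp

text \<open>Row insertion of \<open>x\<close> into an increasing row, where it bumps
  \<open>y\<close>: the bumped letter leaves at the front of the row.\<close>

lemma keq_insert:
  assumes "sorted_wrt (<) (u @ [y] @ v)" "\<forall>a\<in>set u. a < x" "x < y"
  shows "keq (u @ [y] @ v @ [x]) (y # u @ [x] @ v)"
proof -
  have "keq (u @ (y # v @ [x])) (u @ (y # x # v))"
    by (rule keq_app_left, rule keq_slide_right) (use assms in \<open>auto simp: sorted_wrt_append\<close>)
  moreover have "keq ((u @ [y, x]) @ v) ((y # u @ [x]) @ v)"
    by (rule keq_app_right, rule keq_slide_left) (use assms in \<open>auto simp: sorted_wrt_append\<close>)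
  ultimately show ?thesis by simp
qed

text \<open>\<open>concat (rev P)\<close> reads the top row first. The bumped letter comes out in
  front of its row, which is right behind the rows above it, where it is the next letter to
  insert.\<close>

lemma keq_row_insert:
  assumes "\<forall>r\<in>set P. sorted_wrt (<) r" "x \<notin> \<Union>(set ` set P)" "distinct (concat (rev P))"
  shows "keq (concat (rev P) @ [x]) (concat (rev (row_insert x P))) \<and>
     (\<forall>r\<in>set (row_insert x P). sorted_wrt (<) r)"
  using assms
proof (induction x P rule: row_insert.induct)
  case (2 x r rs)
  define u where "u = takeWhile (\<lambda>y. y \<le> x) r"
  define d where "d = dropWhile (\<lambda>y. y \<le> x) r"
  have r: "r = u @ d" unfolding u_def d_def by simp
  have ux: "\<forall>a\<in>set u. a < x"
  proof
    fix a assume "a \<in> set u"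
    then have "a \<le> x" "a \<in> set r" unfolding u_def by (auto dest: set_takeWhileD)
    with 2(3) show "a < x" by (metis UnionI imageI le_neq_implies_less list.set_intros(1))
  qed
  show ?case
  proof (cases d)
    case Nil
    then have "r = u" using r by simp
    then have "length (takeWhile (\<lambda>y. y \<le> x) r) = length r" using u_def by simp
    then have "row_insert x (r # rs) = (r @ [x]) # rs" by simp
    then show ?thesis using 2(2) ux \<open>r = u\<close> by (auto simp: sorted_wrt_append)
  next
    case (Cons y v)
    have yx: "x < y" using Cons unfolding d_def by (metis dropWhile_eq_Cons_conv not_less)
    have len: "length (takeWhile (\<lambda>y. y \<le> x) r) = length u" unfolding u_def by simp
    have ne: "length u \<noteq> length r" using r Cons by simp
    have rj: "r ! length u = y" using r Cons by simp
    have upd: "r[length u := x] = u @ [x] @ v" using r Cons by simp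
    have ins: "row_insert x (r # rs) = (u @ [x] @ v) # row_insert y rs"
      using ne rj upd by (simp add: len)
    have sr: "sorted_wrt (<) (u @ [y] @ v)" using 2(2) r Cons by simp
    have IH: "keq (concat (rev rs) @ [y]) (concat (rev (row_insert y rs))) \<and>
       (\<forall>r\<in>set (row_insert y rs). sorted_wrt (<) r)"
      using 2(1)[OF refl] ne len rj 2(2-4) r Cons by auto
    have "keq (concat (rev rs) @ (u @ [y] @ v @ [x])) (concat (rev rs) @ (y # u @ [x] @ v))"
      by (rule keq_app_left, rule keq_insert) (use sr ux yx in auto)
    moreover have "keq ((concat (rev rs) @ [y]) @ (u @ [x] @ v)) (concat (rev (row_insert y rs)) @ (u @ [x] @ v))"
      by (rule keq_app_right) (use IH in auto)
    ultimately have "keq (concat (rev (r # rs)) @ [x]) (concat (rev (row_insert x (r # rs))))"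
      using r Cons unfolding ins by simp
    moreover have "sorted_wrt (<) (u @ [x] @ v)" using sr ux yx by (auto simp: sorted_wrt_append)
    ultimately show ?thesis using IH unfolding ins by auto
  qed
qed simp

lemma keq_rsk_P_aux:
  "distinct w \<Longrightarrow> keq w (concat (rev (rsk_P w))) \<and> (\<forall>r\<in>set (rsk_P w). sorted_wrt (<) r)"
proof (induction w rule: rev_induct)
  case Nil then show ?case by (simp add: rsk_P_def)
next
  case (snoc x w)
  then have IH: "keq w (concat (rev (rsk_P w)))" "\<forall>r\<in>set (rsk_P w). sorted_wrt (<) r" by auto
  have P: "rsk_P (w @ [x]) = row_insert x (rsk_P w)" by (simp add: rsk_P_def)
  have s: "set (concat (rsk_P w)) = set w" "distinct (concat (rev (rsk_P w)))"
    using keq_mset[OF IH(1)] snoc.prems by auto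
  have "keq (concat (rev (rsk_P w)) @ [x]) (concat (rev (rsk_P (w @ [x])))) \<and>
     (\<forall>r\<in>set (rsk_P (w @ [x])). sorted_wrt (<) r)"
    unfolding P using keq_row_insert[of "rsk_P w" x] IH(2) s snoc.prems by auto
  with keq_app_right[OF IH(1), of "[x]"] show ?case by auto
qed

lemma keq_rsk_P: "distinct w \<Longrightarrow> keq w (concat (rev (rsk_P w)))"
  using keq_rsk_P_aux by blast

text \<open>Write the rows as d D and b B'. Inserting b into x d D bumps d and gives d x b D B'. The
  induction hypothesis for b turns this into d x D b B', and the induction hypothesis for x into d D
  x b B'.\<close>

lemma keq_slide_row_right:
  assumes "sorted_wrt (<) (x # D)" "sorted_wrt (<) (x # B)" "length D \<le> length B"
    "\<forall>k<length D. B ! k < D ! k"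
  shows "keq (x # D @ B) (D @ x # B)"
  using assms
proof (induction D arbitrary: x B)
  case (Cons d D)
  then obtain b B' where B: "B = b # B'" by (cases B) auto
  have bd: "b < d" using Cons.prems(4) B by auto
  have B'D: "B' ! k < D ! k" if "k < length D" for k
    using Cons.prems(4)[rule_format, of "Suc k"] that B by auto
  have "keq ([x] @ [d] @ D @ [b]) (d # [x] @ [b] @ D)"
    by (rule keq_insert) (use Cons.prems bd B in auto)
  then have "keq (([x] @ [d] @ D @ [b]) @ B') ((d # [x] @ [b] @ D) @ B')" by (rule keq_app_right)
  moreover have "keq (b # D @ B') (D @ b # B')"
    using Cons.prems B bd B'D by (intro Cons.IH) auto
  then have "keq ([d, x] @ (b # D @ B')) ([d, x] @ (D @ b # B'))" by (rule keq_app_left)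
  moreover have "keq (x # D @ B) (D @ x # B)"
  proof (rule Cons.IH)
    \<comment> \<open>With \<open>d\<close> gone, each letter of \<open>D\<close> faces an earlier
      letter of \<open>B\<close>, which is only smaller.\<close>
    have "B ! k < D ! k" if "k < length D" for k
    proof (cases k)
      case 0
      have "D ! 0 \<in> set D" using that by (intro nth_mem) auto
      then have "d < D ! 0" using Cons.prems(1) by auto
      then show ?thesis using 0 B bd by simp
    next
      case (Suc l)
      have "B' ! l < B' ! k" using Cons.prems(2,3) B that Suc by (auto simp: sorted_wrt_nth_less)
      then show ?thesis using Suc B B'D[OF that] by auto
    qed
    then show "\<forall>k<length D. B ! k < D ! k" by blast
  qed (use Cons.prems in auto)
  then have "keq ([d] @ (x # D @ B)) ([d] @ (D @ x # B))" by (rule keq_app_left)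
  ultimately show ?case using B by simp
qed simp

text \<open>The upper row \<open>C\<close> \<open>x\<close> \<open>D\<close> is read before the
  lower row \<open>A\<close> \<open>B\<close>, and \<open>x\<close> drops from the one to the other.
  \<open>A\<close> and \<open>C\<close> lie left of the column of \<open>x\<close>, with 0 for a
  missing cell. A column with entries a below c is peeled off by inserting a into the upper row,
  which brings c to the front; after the induction hypothesis this insertion is undone.\<close>

lemma keq_slide_row:
  assumes "list_all2 (\<lambda>a c. a \<noteq> 0 \<longrightarrow> a < c) A C"
    "sorted_wrt (<) (filter (\<lambda>x. x \<noteq> 0) C @ x # D)" "sorted_wrt (<) (filter (\<lambda>x. x \<noteq> 0) A @ x # B)"
    "length D \<le> length B" "\<forall>k<length D. B ! k < D ! k"
  shows "keq (filter (\<lambda>x. x \<noteq> 0) C @ x # D @ filter (\<lambda>x. x \<noteq> 0) A @ B)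
             (filter (\<lambda>x. x \<noteq> 0) C @ D @ filter (\<lambda>x. x \<noteq> 0) A @ x # B)"
  using assms(1-3)
proof (induction rule: list_all2_induct)
  case Nil then show ?case using keq_slide_row_right assms(4,5) by auto
next
  case (Cons a A c C)
  let ?A = "filter (\<lambda>x. x \<noteq> 0) A" and ?C = "filter (\<lambda>x. x \<noteq> 0) C"
  have IH: "keq (?C @ x # D @ ?A @ B) (?C @ D @ ?A @ x # B)"
    using Cons.prems by (intro Cons.IH) (auto split: if_splits)
  show ?case
  proof (cases "a = 0")
    case True
    then show ?thesis using IH keq_Cons[OF IH, of c] by auto
  next
    case False
    then have ac: "a < c" "c \<noteq> 0" using Cons(1) by auto
    have sC: "sorted_wrt (<) (c # ?C @ x # D)" using Cons.prems(1) ac by simp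
    then have sD: "sorted_wrt (<) (c # ?C @ D)" by (auto simp: sorted_wrt_append)
    have "keq ([] @ [c] @ (?C @ x # D) @ [a]) (c # [] @ [a] @ (?C @ x # D))"
      by (rule keq_insert) (use ac sC in simp_all)
    then have 1: "keq ((c # ?C @ x # D) @ [a]) (c # a # (?C @ x # D))" by simp
    have "keq ([] @ [c] @ (?C @ D) @ [a]) (c # [] @ [a] @ (?C @ D))"
      by (rule keq_insert) (use ac sD in simp_all)
    then have 2: "keq (c # a # (?C @ D)) ((c # ?C @ D) @ [a])" by (simp add: keq_sym)
    have "keq (((c # ?C @ x # D) @ [a]) @ ?A @ B) ((c # a # (?C @ x # D)) @ ?A @ B)"
      using 1 by (rule keq_app_right)
    moreover have "keq ([c, a] @ (?C @ x # D @ ?A @ B)) ([c, a] @ (?C @ D @ ?A @ x # B))"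
      using IH by (rule keq_app_left)
    moreover have "keq ((c # a # (?C @ D)) @ (?A @ x # B)) (((c # ?C @ D) @ [a]) @ (?A @ x # B))"
      using 2 by (rule keq_app_right)
    ultimately show ?thesis using False ac by simp
  qed
qed

section \<open>Dual equivalence of words\<close>

definition adj_swap :: "nat \<Rightarrow> nat \<Rightarrow> nat" where
  "adj_swap k x = (if x = k then Suc k else if x = Suc k then k else x)"

text \<open>Two consecutive values of the window \<open>j\<close>, \<open>j + 1\<close>,
  \<open>j + 2\<close> are exchanged when the third one stands between them: the Knuth rule with
  positions and values interchanged. The word \<open>f\<close> is the subword of the window
  values.\<close>

definition dual_select :: "nat \<Rightarrow> nat list \<Rightarrow> nat \<Rightarrow> nat" where
  "dual_select j f = (if f = [j + 1, j, j + 2] \<or> f = [j + 2, j, j + 1] then adj_swap (j + 1)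
     else if f = [j, j + 2, j + 1] \<or> f = [j + 1, j + 2, j] then adj_swap j else id)"

definition dual_perm :: "nat \<Rightarrow> nat list \<Rightarrow> nat \<Rightarrow> nat" where
  "dual_perm j w = dual_select j (filter (\<lambda>x. j \<le> x \<and> x \<le> j + 2) w)"

definition dual_word :: "nat \<Rightarrow> nat list \<Rightarrow> nat list" where
  "dual_word j w = map (dual_perm j w) w"

fun knuth3 :: "nat \<Rightarrow> nat \<Rightarrow> nat \<Rightarrow> nat list" where
  "knuth3 a b c = (if a < c \<and> c < b \<or> b < c \<and> c < a then [b, a, c]
     else if b < a \<and> a < c \<or> c < a \<and> a < b then [a, c, b] else [a, b, c])"

text \<open>Indexing Knuth moves by position makes them functions (the identity where no move applies), so that a
  coincidence between two images of one word is transported along a Knuth chain.\<close>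

fun knuth_at :: "nat \<Rightarrow> nat list \<Rightarrow> nat list" where
  "knuth_at 0 (a # b # c # v) = knuth3 a b c @ v"
| "knuth_at (Suc p) (x # w) = x # knuth_at p w"
| "knuth_at p w = w"

declare knuth3.simps [simp del]

lemma knuth_at_append: "knuth_at (length u) (u @ a # b # c # v) = u @ knuth3 a b c @ v"
  by (induction u) auto

lemma knuth_at_short: "length w < p + 3 \<Longrightarrow> knuth_at p w = w"
  by (induction p w rule: knuth_at.induct) auto

lemma knuth_at_long: "p + 3 \<le> length (w :: nat list) \<Longrightarrow>
  \<exists>u a b c v. w = u @ a # b # c # v \<and> length u = p"
proof (induction p w rule: knuth_at.induct)
  case (2 p x w)
  then obtain u a b c v where "w = u @ a # b # c # v" "length u = p" by auto
  then show ?case by (intro exI[of _ "x # u"]) auto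
qed auto

lemma kstep_knuth_at: "kstep v w \<Longrightarrow> \<exists>p. w = knuth_at p v"
proof (induction rule: kstep.induct)
  case (xzy x y z u v) then show ?case using knuth_at_append[of u x z y v] by (auto simp: knuth3.simps intro!: exI[of _ "length u"])
next
  case (zxy x y z u v) then show ?case using knuth_at_append[of u z x y v] by (auto simp: knuth3.simps intro!: exI[of _ "length u"])
next
  case (yxz x y z u v) then show ?case using knuth_at_append[of u y x z v] by (auto simp: knuth3.simps intro!: exI[of _ "length u"])
next
  case (yzx x y z u v) then show ?case using knuth_at_append[of u y z x v] by (auto simp: knuth3.simps intro!: exI[of _ "length u"])
qed

lemma keq_knuth_at: "keq v w \<Longrightarrow> \<exists>ps. w = fold knuth_at ps v"
proof (induction rule: rtranclp_induct)
  case base then show ?case by (auto intro: exI[of _ "[]"])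
next
  case (step y z)
  then obtain ps p where "y = fold knuth_at ps v" "z = knuth_at p y" using kstep_knuth_at by blast
  then show ?case by (intro exI[of _ "ps @ [p]"]) simp
qed

lemma knuth3_keq: "keq (knuth3 a b c) [a, b, c]"
  using kstep.intros(1)[of _ _ _ "[]" "[]"] kstep.intros(2)[of _ _ _ "[]" "[]"]
    kstep.intros(3)[of _ _ _ "[]" "[]"] kstep.intros(4)[of _ _ _ "[]" "[]"]
  by (auto simp: knuth3.simps)

lemma knuth_at_keq: "keq (knuth_at p w) w"
  by (induction p w rule: knuth_at.induct) (auto intro: keq_Cons keq_app_right[OF knuth3_keq, simplified])

lemma distinct_knuth_at: "distinct (knuth_at p w) = distinct w"
  using keq_mset[OF knuth_at_keq] by auto

section \<open>Commutation of dual equivalences with Knuth moves\<close>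

lemma inj_adj_swap: "inj (adj_swap k)"
  by (auto simp: inj_def adj_swap_def split: if_splits)

lemma inj_dual_select: "inj (dual_select j f)"
  by (auto simp: dual_select_def inj_adj_swap)

lemma inj_dual_perm: "inj (dual_perm j w)"
  by (simp add: dual_perm_def inj_dual_select)

lemma distinct_dual_word: "distinct (dual_word j w) = distinct w"
  by (metis dual_word_def distinct_map inj_dual_perm inj_on_subset subset_UNIV)

lemma adj_swap_less_iff:
  "x \<noteq> y \<Longrightarrow> \<not> (x = k \<and> y = Suc k) \<Longrightarrow> \<not> (x = Suc k \<and> y = k) \<Longrightarrow> adj_swap k x < adj_swap k y \<longleftrightarrow> x < y"
  by (auto simp: adj_swap_def)

lemma knuth3_map:
  assumes "\<And>x y. x \<in> {a, b, c} \<Longrightarrow> y \<in> {a, b, c} \<Longrightarrow> x \<noteq> y \<Longrightarrow> \<sigma> x < \<sigma> y \<longleftrightarrow> x < y"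
    "a \<noteq> b" "b \<noteq> c" "a \<noteq> c"
  shows "map \<sigma> (knuth3 a b c) = knuth3 (\<sigma> a) (\<sigma> b) (\<sigma> c)"
  using assms(2-4) by (simp add: knuth3.simps assms(1))

lemma dual_select_cases:
  obtains "dual_select j f = id"
  | k e where "dual_select j f = adj_swap k" "f = [k, e, Suc k] \<or> f = [Suc k, e, k]"
proof -
  have "dual_select j f = id \<or> (\<exists>k e. dual_select j f = adj_swap k \<and> (f = [k, e, Suc k] \<or> f = [Suc k, e, k]))"
    by (cases "f = [j + 1, j, j + 2] \<or> f = [j + 2, j, j + 1]";
        cases "f = [j, j + 2, j + 1] \<or> f = [j + 1, j + 2, j]") (auto simp: dual_select_def)
  then show thesis using that by blast
qed

lemma adjacent_sublist:
  assumes "[k, e, l] = U @ G @ V" "k \<in> set G" "l \<in> set G" "length G \<le> 2" "k \<noteq> l" "e \<noteq> k" "e \<noteq> l"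
  shows False
  using assms by (auto simp: Cons_eq_append_conv)

text \<open>\<open>G\<close> collects those letters at the place of a Knuth move that belong to the
  window of values. The exchanged values are separated by the third letter of the window, so a
  contiguous part with at most two letters cannot contain both, and the order of the letters at that
  place is kept.\<close>

lemma dual_select_order:
  assumes "distinct (U @ G @ V)" "length G \<le> 2" "x \<noteq> y"
    and "\<And>z. z \<in> {x, y} \<Longrightarrow> j \<le> z \<Longrightarrow> z \<le> j + 2 \<Longrightarrow> z \<in> set G"
    and "\<And>z. z \<in> set (U @ G @ V) \<Longrightarrow> j \<le> z \<and> z \<le> j + 2"
  shows "dual_select j (U @ G @ V) x < dual_select j (U @ G @ V) y \<longleftrightarrow> x < y"
proof (cases rule: dual_select_cases[of j "U @ G @ V"])
  case 1 then show ?thesis by simp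
next
  case (2 k e)
  have d: "e \<noteq> k" "e \<noteq> Suc k" using assms(1) 2(2) by fastforce+
  have J: "j \<le> k \<and> Suc k \<le> j + 2" using assms(5)[of k] assms(5)[of "Suc k"] 2(2) by fastforce
  have "\<not> (k \<in> set G \<and> Suc k \<in> set G)"
    using 2(2) adjacent_sublist[of k e "Suc k" U G V] adjacent_sublist[of "Suc k" e k U G V] assms(2) d
    by (metis n_not_Suc_n)
  then have "\<not> (x = k \<and> y = Suc k)" "\<not> (x = Suc k \<and> y = k)" using assms(4) J by auto
  then show ?thesis unfolding 2(1) using adj_swap_less_iff assms(3) by blast
qed

lemma dual_select_length: "length f \<noteq> 3 \<Longrightarrow> dual_select j f = id"
  by (auto simp: dual_select_def)

text \<open>The only case in which the two actions interfere: the Knuth move may change the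
  transposition selected by the dual equivalence, yet the two composites agree on all six
  arrangements.\<close>

lemma dual_select_knuth3_window:
  assumes "a \<in> {j, j + 1, j + 2}" "b \<in> {j, j + 1, j + 2}" "c \<in> {j, j + 1, j + 2}"
    "a \<noteq> b" "b \<noteq> c" "a \<noteq> c"
  shows "map (dual_select j (knuth3 a b c)) (knuth3 a b c) =
    knuth3 (dual_select j [a, b, c] a) (dual_select j [a, b, c] b) (dual_select j [a, b, c] c)"
proof -
  consider "a = j" "b = j + 1" "c = j + 2" | "a = j" "b = j + 2" "c = j + 1"
    | "a = j + 1" "b = j" "c = j + 2" | "a = j + 1" "b = j + 2" "c = j"
    | "a = j + 2" "b = j" "c = j + 1" | "a = j + 2" "b = j + 1" "c = j"
    using assms by fastforce
  then show ?thesis by cases (simp_all add: knuth3.simps dual_select_def adj_swap_def)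
qed

text \<open>\<open>U\<close> and \<open>V\<close> are the window values outside the place of the
  Knuth move. Unless the three letters there are exactly the window, the dual equivalence keeps
  their order, so that the Knuth rule sees the same pattern before and after, and the selected
  permutation does not change.\<close>

lemma dual_select_knuth3:
  assumes "distinct (U @ filter J [a, b, c] @ V)" "J = (\<lambda>x. j \<le> x \<and> x \<le> j + 2)"
    "a \<noteq> b" "b \<noteq> c" "a \<noteq> c" "\<And>z. z \<in> set U \<union> set V \<Longrightarrow> J z"
  shows "map (dual_select j (U @ filter J (knuth3 a b c) @ V)) (knuth3 a b c) =
     (let \<sigma> = dual_select j (U @ filter J [a, b, c] @ V) in knuth3 (\<sigma> a) (\<sigma> b) (\<sigma> c))" (is ?eq)
    "\<not> (J a \<and> J b \<and> J c \<and> U @ V = []) \<Longrightarrow>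
      dual_select j (U @ filter J (knuth3 a b c) @ V) = dual_select j (U @ filter J [a, b, c] @ V)"
proof -
  have "?eq \<and> (\<not> (J a \<and> J b \<and> J c \<and> U @ V = []) \<longrightarrow>
      dual_select j (U @ filter J (knuth3 a b c) @ V) = dual_select j (U @ filter J [a, b, c] @ V))"
  proof (cases "J a \<and> J b \<and> J c")
    case True
    then have f: "filter J [a, b, c] = [a, b, c]" "filter J (knuth3 a b c) = knuth3 a b c"
      by (auto simp: knuth3.simps)
    have l: "length (knuth3 a b c) = 3" by (simp add: knuth3.simps)
    show ?thesis
    proof (cases "U @ V = []")
      case False
      then have "dual_select j (U @ [a, b, c] @ V) = id" "dual_select j (U @ knuth3 a b c @ V) = id"
        using l by (auto intro!: dual_select_length)
      then show ?thesis unfolding f by (simp add: Let_def)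
    next
      case U: True
      have "a \<in> {j, j + 1, j + 2}" "b \<in> {j, j + 1, j + 2}" "c \<in> {j, j + 1, j + 2}"
        using True assms(2) by auto
      then show ?thesis unfolding f using dual_select_knuth3_window[OF _ _ _ assms(3-5)] U True by (simp add: Let_def)
    qed
  next
    case False
    then have e: "filter J (knuth3 a b c) = filter J [a, b, c]"
      using assms(2-5) by (auto simp: knuth3.simps)
    define G where "G = filter J [a, b, c]"
    have G: "length G \<le> 2" using False unfolding G_def by auto
    have "dual_select j (U @ G @ V) x < dual_select j (U @ G @ V) y \<longleftrightarrow> x < y"
      if xy: "x \<in> {a, b, c}" "y \<in> {a, b, c}" "x \<noteq> y" for x y
    proof (rule dual_select_order[OF _ G xy(3)])
      show "distinct (U @ G @ V)" using assms(1) G_def by simp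
      show "z \<in> set G" if "z \<in> {x, y}" "j \<le> z" "z \<le> j + 2" for z
        using that xy(1,2) unfolding G_def assms(2) set_filter by auto
      show "j \<le> z \<and> z \<le> j + 2" if "z \<in> set (U @ G @ V)" for z
        using that assms(2,6) unfolding G_def set_append set_filter by blast
    qed
    then have "map (dual_select j (U @ G @ V)) (knuth3 a b c) =
      knuth3 (dual_select j (U @ G @ V) a) (dual_select j (U @ G @ V) b) (dual_select j (U @ G @ V) c)"
      using assms(3-5) by (intro knuth3_map)
    then show ?thesis by (simp add: e Let_def G_def del: filter.simps)
  qed
  then show ?eq "\<not> (J a \<and> J b \<and> J c \<and> U @ V = []) \<Longrightarrow>
      dual_select j (U @ filter J (knuth3 a b c) @ V) = dual_select j (U @ filter J [a, b, c] @ V)" by blast+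
qed

lemma dual_select_id: "x < j \<or> j + 2 < x \<Longrightarrow> dual_select j f x = x"
  by (auto simp: dual_select_def adj_swap_def)

lemma dual_word_knuth_at_comm:
  assumes "distinct w"
  shows "dual_word j (knuth_at p w) = knuth_at p (dual_word j w)"
proof (cases "p + 3 \<le> length w")
  case False then show ?thesis by (simp add: knuth_at_short dual_word_def)
next
  case True
  then obtain u a b c v where w: "w = u @ a # b # c # v" and p: "length u = p" using knuth_at_long by blast
  define J where "J = (\<lambda>x. j \<le> x \<and> x \<le> j + 2)"
  define U V where "U = filter J u" and "V = filter J v"
  define s s' where "s = dual_select j (U @ filter J [a, b, c] @ V)" and "s' = dual_select j (U @ filter J (knuth3 a b c) @ V)"
  have k: "knuth_at p w = u @ knuth3 a b c @ v" using knuth_at_append[of u a b c v] w p by simp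
  have "filter J w = U @ filter J [a, b, c] @ V" by (simp add: U_def V_def w)
  then have s: "dual_perm j w = s" by (simp add: dual_perm_def s_def J_def)
  have s': "dual_perm j (knuth_at p w) = s'" by (simp add: dual_perm_def s'_def J_def U_def V_def k)
  have prem: "distinct (U @ filter J [a, b, c] @ V)" "a \<noteq> b" "b \<noteq> c" "a \<noteq> c"
    "\<And>z. z \<in> set U \<union> set V \<Longrightarrow> J z"
    using assms unfolding w U_def V_def by auto
  note D = dual_select_knuth3[OF prem(1) J_def prem(2-5)]
  \<comment> \<open>In the critical case the selected permutation may change, but then no letter of
    \<open>u\<close> or \<open>v\<close> lies in the window of values.\<close>
  have uv: "map s' u = map s u \<and> map s' v = map s v"
  proof (cases "J a \<and> J b \<and> J c \<and> U @ V = []")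
    case True
    then have "\<not> J x" if "x \<in> set u \<union> set v" for x using that by (auto simp: U_def V_def filter_empty_conv)
    then show ?thesis unfolding s_def s'_def J_def by (auto simp: dual_select_id not_le)
  next
    case False
    then show ?thesis using D(2) s_def s'_def by simp
  qed
  have "dual_word j (knuth_at p w) = map s u @ knuth3 (s a) (s b) (s c) @ map s v"
    unfolding dual_word_def s' using uv D(1) by (simp add: k s_def s'_def Let_def)
  moreover have "knuth_at p (dual_word j w) = map s u @ knuth3 (s a) (s b) (s c) @ map s v"
    using knuth_at_append[of "map s u"] p unfolding dual_word_def s by (simp add: w)
  ultimately show ?thesis by simp
qed

abbreviation dual_words :: "nat list \<Rightarrow> nat list \<Rightarrow> nat list" where
  "dual_words js \<equiv> fold dual_word js"

lemma distinct_dual_words: "distinct (dual_words js w) = distinct w"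
  by (induction js arbitrary: w) (auto simp: distinct_dual_word)

lemma dual_words_knuth_at_comm: "distinct w \<Longrightarrow> dual_words js (knuth_at p w) = knuth_at p (dual_words js w)"
  by (induction js arbitrary: w) (auto simp: dual_word_knuth_at_comm distinct_dual_word)

lemma dual_words_knuths_comm: "distinct w \<Longrightarrow> dual_words js (fold knuth_at ps w) = fold knuth_at ps (dual_words js w)"
  by (induction ps arbitrary: w) (auto simp: dual_words_knuth_at_comm distinct_knuth_at)

lemma fold_knuth_at_keq: "keq (fold knuth_at ps w) w"
  by (induction ps arbitrary: w) (auto intro: rtranclp_trans knuth_at_keq)

lemma keq_dual_words:
  assumes "keq v w" "distinct v"
  shows "keq (dual_words js v) (dual_words js w)"
proof -
  obtain ps where "w = fold knuth_at ps v" using keq_knuth_at[OF assms(1)] by blast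
  then show ?thesis using dual_words_knuths_comm[OF assms(2), of js ps] fold_knuth_at_keq keq_sym by metis
qed

lemma dual_words_eq_transfer:
  assumes "keq v w" "distinct v" "dual_words js v = dual_words js' v"
  shows "dual_words js w = dual_words js' w"
proof -
  obtain ps where "w = fold knuth_at ps v" using keq_knuth_at[OF assms(1)] by blast
  then show ?thesis using dual_words_knuths_comm[OF assms(2)] assms(3) by simp
qed

section \<open>Standard tableaux and their reading words\<close>

text \<open>One square for all shapes, with the zeros dropped from the reading word, so that
  straight, skew and holed fillings are read in the same order of cells.\<close>

definition grid :: "nat \<Rightarrow> cell list" where
  "grid M = concat (map (\<lambda>r. map (Pair r) [0..<M]) (rev [0..<M]))"

definition reading :: "nat \<Rightarrow> filling \<Rightarrow> nat list" where
  "reading M T = filter (\<lambda>v. v \<noteq> 0) (map T (grid M))"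

definition before :: "cell \<Rightarrow> cell \<Rightarrow> bool" where
  "before x y \<longleftrightarrow> fst y < fst x \<or> fst x = fst y \<and> snd x < snd y"

definition cell_le :: "cell \<Rightarrow> cell \<Rightarrow> bool" where
  "cell_le x y \<longleftrightarrow> fst x \<le> fst y \<and> snd x \<le> snd y"

definition downset :: "cell set \<Rightarrow> bool" where
  "downset D \<longleftrightarrow> (\<forall>y\<in>D. \<forall>x. cell_le x y \<longrightarrow> x \<in> D)"

text \<open>The offset \<open>s\<close> admits the rectification \<open>R\<close>, whose entries are
  a, ..., b, on the same footing as tableaux with entries from 1.\<close>

definition std_tab :: "nat \<Rightarrow> cell set \<Rightarrow> filling \<Rightarrow> bool" where
  "std_tab s D V \<longleftrightarrow> finite D \<and> downset D \<and> bij_betw V D {s + 1..s + card D} \<and> (\<forall>x. x \<notin> D \<longrightarrow> V x = 0)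
     \<and> (\<forall>x\<in>D. \<forall>y\<in>D. cell_le x y \<longrightarrow> x \<noteq> y \<longrightarrow> V x < V y)"

definition box :: "nat \<Rightarrow> cell set" where
  "box M = {..<M} \<times> {..<M}"

definition dual_tab :: "nat \<Rightarrow> nat \<Rightarrow> filling \<Rightarrow> filling" where
  "dual_tab M j T = (\<lambda>x. dual_perm j (reading M T) (T x))"

abbreviation dual_tabs :: "nat \<Rightarrow> nat list \<Rightarrow> filling \<Rightarrow> filling" where
  "dual_tabs M \<equiv> fold (dual_tab M)"

section \<open>The reading order of cells and reading words of tableaux\<close>

lemma sorted_grid_rows: "sorted_wrt (>) rs \<Longrightarrow> sorted_wrt before (concat (map (\<lambda>r. map (Pair r) [0..<M]) rs))"
proof (induction rs)
  case (Cons r rs)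
  then show ?case by (auto simp: sorted_wrt_append sorted_wrt_map before_def)
qed simp

lemma sorted_grid: "sorted_wrt before (grid M)"
  unfolding grid_def by (rule sorted_grid_rows) (simp add: sorted_wrt_rev)

lemma set_grid: "set (grid M) = box M"
  by (auto simp: grid_def box_def)

lemma before_irrefl [simp]: "\<not> before x x"
  by (simp add: before_def)

lemma before_trans: "before x y \<Longrightarrow> before y z \<Longrightarrow> before x z"
  by (auto simp: before_def)

lemma before_asym: "before x y \<Longrightarrow> \<not> before y x"
  by (auto simp: before_def)

lemma before_total: "x \<noteq> y \<Longrightarrow> before x y \<or> before y x"
  by (auto simp: before_def prod_eq_iff)

lemma sorted_before_unique:
  "sorted_wrt before xs \<Longrightarrow> sorted_wrt before ys \<Longrightarrow> set xs = set ys \<Longrightarrow> xs = ys"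
proof (induction xs arbitrary: ys)
  case (Cons x xs)
  then obtain y ys' where ys: "ys = y # ys'" by (cases ys) auto
  have xy: "x = y"
    using Cons.prems ys before_asym by (metis list.set_intros(1) set_ConsD sorted_wrt.simps(2))
  have "set xs = set ys'"
    using Cons.prems ys xy before_irrefl
    by (metis insert_ident list.simps(15) sorted_wrt.simps(2))
  then show ?case using Cons ys xy by auto
qed simp

lemma sorted_before_distinct: "sorted_wrt before xs \<Longrightarrow> distinct xs"
  by (induction xs) auto

lemma filter_reading: "\<not> P 0 \<Longrightarrow> filter P (reading M T) = map T (filter (\<lambda>x. P (T x)) (grid M))"
proof -
  assume "\<not> P 0"
  then have e: "(\<lambda>x. T x \<noteq> 0 \<and> P (T x)) = (\<lambda>x. P (T x))" by (intro ext) metis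
  show ?thesis unfolding reading_def filter_filter filter_map o_def e ..
qed

lemma filter_reading_eq:
  assumes "\<not> P 0" "sorted_wrt before cs" "set cs = {x \<in> box M. P (T x)}"
  shows "filter P (reading M T) = map T cs"
proof -
  have "filter (\<lambda>x. P (T x)) (grid M) = cs"
    by (rule sorted_before_unique) (use assms in \<open>auto simp: set_grid sorted_wrt_filter sorted_grid\<close>)
  then show ?thesis using assms(1) by (simp add: filter_reading)
qed

lemma reading_eq_filter: "reading M T = map T (filter (\<lambda>x. T x \<noteq> 0) (grid M))"
  by (simp add: reading_def filter_map o_def)

lemma set_reading: "set (reading M T) = T ` {x \<in> box M. T x \<noteq> 0}"
  by (auto simp: reading_eq_filter set_grid)

lemma stabD:
  assumes "std_tab s D V"
  shows "finite D" "downset D" "inj_on V D" "V ` D = {s + 1..s + card D}" "\<And>x. x \<notin> D \<Longrightarrow> V x = 0"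
    "\<And>x y. x \<in> D \<Longrightarrow> y \<in> D \<Longrightarrow> cell_le x y \<Longrightarrow> x \<noteq> y \<Longrightarrow> V x < V y"
  using assms unfolding std_tab_def bij_betw_def by auto

lemma std_tab_nonzero: "std_tab s D V \<Longrightarrow> V x \<noteq> 0 \<longleftrightarrow> x \<in> D"
proof
  assume s: "std_tab s D V" and x: "x \<in> D"
  have "V x \<in> {s + 1..s + card D}" using stabD(4)[OF s] x by blast
  then show "V x \<noteq> 0" by auto
qed (metis stabD(5))

lemma std_tab_range: "std_tab s D V \<Longrightarrow> x \<in> D \<Longrightarrow> s < V x \<and> V x \<le> s + card D"
  using stabD(4)[of s D V] by (metis Suc_eq_plus1 Suc_le_eq atLeastAtMost_iff imageI)

lemma std_tab_set_reading: "std_tab s D V \<Longrightarrow> D \<subseteq> box M \<Longrightarrow> set (reading M V) = {s + 1..s + card D}"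
proof -
  assume s: "std_tab s D V" and D: "D \<subseteq> box M"
  have "{x \<in> box M. V x \<noteq> 0} = D" using std_tab_nonzero[OF s] D by auto
  then show ?thesis using set_reading[of M V] stabD(4)[OF s] by simp
qed

lemma std_tab_distinct_reading: "std_tab s D V \<Longrightarrow> distinct (reading M V)"
proof -
  assume s: "std_tab s D V"
  have "inj_on V (set (filter (\<lambda>x. V x \<noteq> 0) (grid M)))"
    by (rule inj_on_subset[OF stabD(3)[OF s]]) (use std_tab_nonzero[OF s] in auto)
  then show ?thesis unfolding reading_eq_filter
    by (simp add: distinct_map sorted_before_distinct sorted_grid)
qed

text \<open>\<open>e\<close> is the third value of the window, the one that stands between
  \<open>k\<close> and \<open>Suc k\<close> in the word: it is next above or next below the
  exchanged pair.\<close>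

lemma dual_perm_cases:
  obtains "dual_perm j w = id"
  | k e where "dual_perm j w = adj_swap k" "k \<in> set w" "Suc k \<in> set w" "e = k + 2 \<or> k = e + 1"
     "filter (\<lambda>x. j \<le> x \<and> x \<le> j + 2) w \<in> {[k, e, Suc k], [Suc k, e, k]}" "j \<le> k" "k < j + 2"
proof -
  let ?f = "filter (\<lambda>x. j \<le> x \<and> x \<le> j + 2) w"
  have s: "set ?f \<subseteq> set w" by auto
  consider "?f = [j + 1, j, j + 2] \<or> ?f = [j + 2, j, j + 1]" | "?f = [j, j + 2, j + 1] \<or> ?f = [j + 1, j + 2, j]"
    | "dual_select j ?f = id"
    by (cases "?f = [j + 1, j, j + 2] \<or> ?f = [j + 2, j, j + 1]";
        cases "?f = [j, j + 2, j + 1] \<or> ?f = [j + 1, j + 2, j]") (auto simp: dual_select_def)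
  then show thesis
  proof cases
    case 1
    then have "dual_perm j w = adj_swap (j + 1)" by (auto simp: dual_perm_def dual_select_def)
    moreover have "{j + 1, j + 2} \<subseteq> set ?f" using 1 by (elim disjE) (simp_all del: set_filter)
    ultimately show thesis using that(2)[of "j + 1" j] 1 s by auto
  next
    case 2
    then have "dual_perm j w = adj_swap j" by (auto simp: dual_perm_def dual_select_def)
    moreover have "{j, j + 1} \<subseteq> set ?f" using 2 by (elim disjE) (simp_all del: set_filter)
    ultimately show thesis using that(2)[of j "j + 2"] 2 s by auto
  next
    case 3 then show thesis using that(1) by (simp add: dual_perm_def)
  qed
qed

section \<open>Dual equivalences on tableaux\<close>

lemma dual_perm_zero: "dual_perm j (reading M T) x = 0 \<longleftrightarrow> x = 0"
proof (cases rule: dual_perm_cases[of j "reading M T"])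
  case (2 k e)
  then have "k \<noteq> 0" using set_reading[of M T] by auto
  then show ?thesis using 2(1) by (auto simp: adj_swap_def)
qed simp

lemma dual_tab_nonzero: "dual_tab M j T x = 0 \<longleftrightarrow> T x = 0"
  by (simp add: dual_tab_def dual_perm_zero)

lemma reading_dual_tab: "reading M (dual_tab M j T) = dual_word j (reading M T)"
  unfolding dual_word_def reading_eq_filter[of M "dual_tab M j T"] dual_tab_nonzero
  by (simp add: dual_tab_def reading_eq_filter[of M T])

lemma reading_dual_tabs: "reading M (dual_tabs M js T) = dual_words js (reading M T)"
  by (induction js arbitrary: T) (auto simp: reading_dual_tab)

lemma filter_reading_three:
  assumes "filter P (reading M T) = [p, q, r]" "\<not> P 0"
  obtains x y z where "T x = p" "T y = q" "T z = r" "before x y" "before y z" "x \<in> box M" "y \<in> box M" "z \<in> box M"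
proof -
  define cs where "cs = filter (\<lambda>x. P (T x)) (grid M)"
  have m: "map T cs = [p, q, r]" using filter_reading[where P = P and M = M and T = T, OF assms(2)] assms(1) cs_def by simp
  then obtain x y z where cs: "cs = [x, y, z]" by (auto simp: map_eq_Cons_conv)
  have "sorted_wrt before cs" "set cs \<subseteq> box M" unfolding cs_def by (auto simp: sorted_wrt_filter sorted_grid set_grid)
  then show thesis using that[of x y z] m cs by simp
qed

lemma bij_adj_swap: "k \<in> A \<Longrightarrow> Suc k \<in> A \<Longrightarrow> bij_betw (adj_swap k) A A"
  by (rule bij_betw_byWitness[where f' = "adj_swap k"]) (auto simp: adj_swap_def)

text \<open>The exchange can only fail if \<open>y\<close> lies weakly above and to the right of
  \<open>x\<close>. As their values are consecutive, no cell lies between them, so \<open>y\<close>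
  is the right or the upper neighbour of \<open>x\<close>; the cell \<open>z\<close>, between them
  in reading order and next to them in value, excludes both.\<close>

lemma std_tab_swap:
  assumes s: "std_tab s D V" and x: "x \<in> D" "V x = k" and y: "y \<in> D" "V y = Suc k"
    and z: "z \<in> D" "V z = k + 2 \<or> k = V z + 1"
    and b: "before x z \<and> before z y \<or> before y z \<and> before z x"
  shows "std_tab s D (\<lambda>c. adj_swap k (V c))"
proof -
  note S = stabD[OF s]
  have up: "c \<in> D" if "cell_le c d" "d \<in> D" for c d using that S(2) unfolding downset_def by blast
  have "\<not> cell_le x y"
  proof
    assume le: "cell_le x y"
    consider "fst x = fst y" | "fst x < fst y" using le by (auto simp: cell_le_def) linarith
    then show False
    proof cases
      case 1
      moreover have "snd x \<le> snd y" using le by (simp add: cell_le_def)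
      ultimately have "fst z = fst x" "snd x < snd z" "snd z < snd y"
        using b unfolding before_def by linarith+
      then have "cell_le x z" "cell_le z y" "x \<noteq> z" "z \<noteq> y" using 1 by (auto simp: cell_le_def)
      then show False using S(6)[of x z] S(6)[of z y] x y z by auto
    next
      case 2
      then have b: "before y z" "before z x" using b by (auto simp: before_def)
      have mid: False if "cell_le x c" "cell_le c y" "x \<noteq> c" "c \<noteq> y" for c
        using S(6)[of x c] S(6)[of c y] up[of c y] that x y by auto
      define c where "c = (Suc (fst x), snd x)"
      have "c = y" using mid[of c] 2 le by (auto simp: c_def cell_le_def prod_eq_iff)
      then have fy: "fst y = Suc (fst x)" "snd y = snd x" by (auto simp: c_def)
      consider "fst z = fst y" "snd y < snd z" | "fst z = fst x" "snd z < snd x"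
        using b fy by (auto simp: before_def) 
      then show False
      proof cases
        case 1
        \<comment> \<open>The cell below \<open>z\<close> in the row of \<open>x\<close> has a value
          strictly between those of \<open>x\<close> and \<open>z\<close>. This leaves only the
          value of \<open>y\<close>, which sits elsewhere.\<close>
        define d where "d = (fst x, snd z)"
        have d: "d \<in> D" using up[of d z] z(1) 1 fy by (auto simp: d_def cell_le_def)
        have "V x < V d" using S(6)[of x d] x d 1 fy by (auto simp: d_def cell_le_def prod_eq_iff)
        moreover have "V d < V z" using S(6)[of d z] z d 1 fy by (auto simp: d_def cell_le_def prod_eq_iff)
        ultimately have "V d = V y" using x y z by auto
        then show False using inj_onD[OF S(3) _ d y(1)] fy by (auto simp: d_def)
      next
        case 2
        \<comment> \<open>Now \<open>d\<close> is the cell above \<open>z\<close> in the row of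
          \<open>y\<close>, and the only value left for it is that of \<open>x\<close>.\<close>
        define d where "d = (fst y, snd z)"
        have d: "d \<in> D" using up[of d y] y(1) 2 fy by (auto simp: d_def cell_le_def)
        have "V z < V d" using S(6)[of z d] z d 2 fy by (auto simp: d_def cell_le_def prod_eq_iff)
        moreover have "V d < V y" using S(6)[of d y] y d 2 fy by (auto simp: d_def cell_le_def prod_eq_iff)
        ultimately have "V d = V x" using x y z by auto
        then have "d = x" using inj_onD[OF S(3) _ d x(1)] by simp
        then have "fst d = fst x" by simp
        then show False using fy by (simp add: d_def)
      qed
    qed
  qed
  then have ord: "adj_swap k (V c) < adj_swap k (V d)" if "c \<in> D" "d \<in> D" "cell_le c d" "c \<noteq> d" for c d
  proof -
    have "V c < V d" using S(6) that by blast
    moreover have "\<not> (V c = k \<and> V d = Suc k)"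
      using \<open>\<not> cell_le x y\<close> inj_onD[OF S(3)] x y that by metis
    ultimately show ?thesis by (auto simp: adj_swap_def)
  qed
  have kin: "k \<in> {s + 1..s + card D}" "Suc k \<in> {s + 1..s + card D}"
    using S(4) x y by (metis imageI)+
  have "bij_betw (adj_swap k \<circ> V) D {s + 1..s + card D}"
    using bij_betw_trans[OF _ bij_adj_swap[OF kin]] s unfolding std_tab_def by blast
  moreover have "k \<noteq> 0" using kin by auto
  ultimately show ?thesis using S ord unfolding std_tab_def by (auto simp: o_def adj_swap_def)
qed

lemma std_tab_dual_tab:
  assumes s: "std_tab s D V" and D: "D \<subseteq> box M"
  shows "std_tab s D (dual_tab M j V)"
proof (cases rule: dual_perm_cases[of j "reading M V"])
  case 1 then show ?thesis using s by (simp add: dual_tab_def)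
next
  case (2 k e)
  define F where "F = filter (\<lambda>x. j \<le> x \<and> x \<le> j + 2) (reading M V)"
  have F: "F = [k, e, Suc k] \<or> F = [Suc k, e, k]" using 2(5) F_def by simp
  then have "set F = {k, e, Suc k}" by (elim disjE) auto
  moreover have "set F \<subseteq> {x. x \<noteq> 0 \<and> j \<le> x \<and> x \<le> j + 2}"
    unfolding F_def reading_def by auto
  ultimately have sub: "{k, e, Suc k} \<subseteq> {x. x \<noteq> 0 \<and> j \<le> x \<and> x \<le> j + 2}" by simp
  then have nz: "k \<noteq> 0" "Suc k \<noteq> 0" "e \<noteq> 0" by auto
  \<comment> \<open>A window starting at 0 has just two positive values, while three are needed; so
    the marker 0 of empty cells is not in the window.\<close>
  have "j \<noteq> 0"
  proof
    assume "j = 0"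
    then show False using sub 2(4,7) by auto
  qed
  then have j0: "\<not> (j \<le> 0 \<and> (0::nat) \<le> j + 2)" by simp
  have "\<exists>x y z. V x = k \<and> V y = Suc k \<and> V z = e \<and> (before x z \<and> before z y \<or> before y z \<and> before z x)"
    using F
  proof
    assume "F = [k, e, Suc k]"
    from filter_reading_three[OF this[unfolded F_def] j0] show ?thesis by metis
  next
    assume "F = [Suc k, e, k]"
    from filter_reading_three[OF this[unfolded F_def] j0] show ?thesis by metis
  qed
  then obtain x y z where c: "V x = k" "V y = Suc k" "V z = e" "before x z \<and> before z y \<or> before y z \<and> before z x"
    by blast
  then have "x \<in> D" "y \<in> D" "z \<in> D" using nz std_tab_nonzero[OF s] by metis+
  then have "std_tab s D (\<lambda>c. adj_swap k (V c))" using std_tab_swap[OF s _ c(1) _ c(2) _ _ c(4)] c 2(4) by auto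
  then show ?thesis by (simp add: dual_tab_def 2(1))
qed

lemma std_tab_dual_tabs: "std_tab s D V \<Longrightarrow> D \<subseteq> box M \<Longrightarrow> std_tab s D (dual_tabs M js V)"
  by (induction js arbitrary: V) (auto simp: std_tab_dual_tab)

section \<open>Connectivity under dual equivalence and uniqueness in a Knuth class\<close>

lemma downsetD: "downset D \<Longrightarrow> y \<in> D \<Longrightarrow> cell_le x y \<Longrightarrow> x \<in> D"
  unfolding downset_def by blast

text \<open>\<open>A\<close> and \<open>B\<close> are addable corners with \<open>A\<close> higher,
  hence further left. The topmost cell of \<open>D\<close> in the column just left of
  \<open>B\<close> is a removable corner: a cell of \<open>D\<close> to its right in a later column
  would force \<open>B\<close> into \<open>D\<close>. It lies below \<open>A\<close>, and not below
  \<open>B\<close>.\<close>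

lemma corner_between_aux:
  assumes "finite D" "downset D" "downset (insert A D)" "downset (insert B D)" "A \<notin> D" "B \<notin> D" "fst B < fst A"
  shows "\<exists>z\<in>D. downset (D - {z}) \<and> before A z \<and> before z B"
proof -
  have "snd A < snd B"
  proof (rule ccontr)
    assume "\<not> snd A < snd B"
    then have "cell_le B A" using assms(7) by (auto simp: cell_le_def)
    then have "B \<in> insert A D" using downsetD[OF assms(3), of A B] by auto
    then show False using assms(6,7) by auto
  qed
  then obtain c where c: "snd B = Suc c" by (cases "snd B") auto
  define C where "C = {r. (r, c) \<in> D}"
  have "C \<subseteq> fst ` D" unfolding C_def by force
  then have fin: "finite C" using assms(1) finite_subset by blast
  have "(fst B, c) \<in> insert B D"
    using downsetD[OF assms(4), of B "(fst B, c)"] c by (auto simp: cell_le_def)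
  then have BC: "fst B \<in> C" unfolding C_def using c by (metis insertE mem_Collect_eq n_not_Suc_n snd_conv)
  define r where "r = Max C"
  have r: "r \<in> C" "\<And>k. k \<in> C \<Longrightarrow> k \<le> r" using fin BC unfolding r_def by (auto intro: Max_in)
  define z where "z = (r, c)"
  have zD: "z \<in> D" using r(1) unfolding z_def C_def by simp
  have Ar: "r < fst A"
  proof (rule ccontr)
    assume "\<not> r < fst A"
    then have "cell_le A z" using \<open>snd A < snd B\<close> c by (auto simp: z_def cell_le_def)
    then show False using downsetD[OF assms(2) zD] assms(5) by auto
  qed
  have "downset (D - {z})"
    unfolding downset_def
  proof (intro ballI allI impI)
    fix y x assume y: "y \<in> D - {z}" and le: "cell_le x y"
    have "x \<noteq> z"
    proof
      assume "x = z"
      then have yz: "r \<le> fst y" "c \<le> snd y" using le by (auto simp: z_def cell_le_def)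
      show False
      proof (cases "snd y = c")
        case True
        then have "fst y \<in> C" using y unfolding C_def by auto
        then have "fst y = r" using r(2) yz by force
        then have "y = z" using True by (auto simp: z_def prod_eq_iff)
        then show False using y by auto
      next
        case False
        then have "cell_le B y" using yz c r(2)[OF BC] by (auto simp: cell_le_def)
        then show False using downsetD[OF assms(2), of y B] y assms(6) by auto
      qed
    qed
    then show "x \<in> D - {z}" using downsetD[OF assms(2), of y x] y le by auto
  qed
  moreover have "before A z" using Ar by (auto simp: before_def z_def)
  moreover have "before z B" using r(2)[OF BC] c by (auto simp: before_def z_def)
  ultimately show ?thesis using zD by blast
qed

lemma corner_between:
  assumes "finite D" "downset D" "downset (insert A D)" "downset (insert B D)" "A \<notin> D" "B \<notin> D" "A \<noteq> B"
  shows "\<exists>z\<in>D. downset (D - {z}) \<and> (before A z \<and> before z B \<or> before B z \<and> before z A)"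
proof -
  have "fst A \<noteq> fst B"
  proof
    assume f: "fst A = fst B"
    then have "cell_le A B \<or> cell_le B A" by (auto simp: cell_le_def)
    then show False using downsetD[OF assms(3), of A B] downsetD[OF assms(4), of B A] assms by auto
  qed
  then show ?thesis
    using corner_between_aux[of D A B] corner_between_aux[of D B A] assms by (metis nat_neq_iff)
qed

section \<open>Adding and removing the largest entry\<close>

lemma std_tab_extend:
  assumes s: "std_tab s D V" and x: "x \<notin> D" and d: "downset (insert x D)"
  shows "std_tab s (insert x D) (V(x := s + card D + 1))"
proof -
  note S = stabD[OF s]
  have "bij_betw (V(x := s + card D + 1)) D {s + 1..s + card D}"
    using s x unfolding std_tab_def by (metis (no_types, lifting) bij_betw_cong fun_upd_other)
  then have "bij_betw (V(x := s + card D + 1)) (insert x D) (insert (s + card D + 1) {s + 1..s + card D})"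
    using notIn_Un_bij_betw[of x D "V(x := s + card D + 1)" "{s + 1..s + card D}"] x by simp
  moreover have "insert (s + card D + 1) {s + 1..s + card D} = {s + 1..s + card (insert x D)}"
    using S(1) x by auto
  moreover have "(V(x := s + card D + 1)) c < (V(x := s + card D + 1)) y"
    if "c \<in> insert x D" "y \<in> insert x D" "cell_le c y" "c \<noteq> y" for c y
  proof (cases "c = x")
    case True
    then have "x \<in> D" using that downsetD[OF S(2)] by auto
    then show ?thesis using x by auto
  next
    case False
    then have c: "c \<in> D" "(V(x := s + card D + 1)) c = V c" using that by auto
    show ?thesis
    proof (cases "y = x")
      case True
      then show ?thesis using c std_tab_range[OF s c(1)] by simp
    next
      case False
      then show ?thesis using c that S(6) by simp
    qed
  qed
  ultimately show ?thesis using S(1,5) d unfolding std_tab_def by auto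
qed

lemma std_tab_restrict:
  assumes s: "std_tab s D V" and x: "x \<in> D" "V x = s + card D"
  shows "std_tab s (D - {x}) (V(x := 0))"
proof -
  note S = stabD[OF s]
  have lt: "V y < s + card D" if "y \<in> D" "y \<noteq> x" for y
    using std_tab_range[OF s that(1)] inj_onD[OF S(3) _ that(1) x(1)] that(2) x(2) by force
  have dn: "downset (D - {x})" unfolding downset_def
  proof (intro ballI allI impI)
    fix y c assume y: "y \<in> D - {x}" and le: "cell_le c y"
    have "c \<noteq> x" using S(6)[OF x(1), of y] lt[of y] x(2) y le by force
    then show "c \<in> D - {x}" using downsetD[OF S(2)] y le by blast
  qed
  have b: "bij_betw V (D - {x}) ({s + 1..s + card D} - {s + card D})"
    using s x card_gt_0_iff[of D] S(1) bij_betw_DiffI[of V D "{s + 1..s + card D}" "{x}" "{s + card D}"] unfolding std_tab_def by auto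
  have "card (D - {x}) = card D - 1" using x(1) S(1) by simp
  then have "{s + 1..s + card D} - {s + card D} = {s + 1..s + card (D - {x})}" by auto
  moreover have "bij_betw (V(x := 0)) (D - {x}) ({s + 1..s + card D} - {s + card D})"
    using b by (rule bij_betw_cong[THEN iffD1, rotated]) auto
  ultimately show ?thesis using S dn unfolding std_tab_def by auto
qed

lemma std_tab_exists:
  assumes "finite D" "downset D"
  shows "\<exists>V. std_tab s D V"
  using assms
proof (induction "card D" arbitrary: D)
  case 0
  then show ?case by (intro exI[of _ "\<lambda>_. 0"]) (simp add: std_tab_def bij_betw_def)
next
  case (Suc n)
  then have ne: "D \<noteq> {}" by auto
  \<comment> \<open>A cell with maximal coordinate sum has no other cell of \<open>D\<close> above
    or to the right of it, so it can be removed and given the largest entry.\<close>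
  define f :: "cell \<Rightarrow> nat" where "f = (\<lambda>x. fst x + snd x)"
  have "Max (f ` D) \<in> f ` D" using Suc(3) ne by (intro Max_in) auto
  then obtain z where "z \<in> D" "f z = Max (f ` D)" by auto
  then have z: "z \<in> D" "\<And>y. y \<in> D \<Longrightarrow> fst y + snd y \<le> fst z + snd z"
    using Max_ge[of "f ` D"] Suc(3) by (auto simp: f_def)
  have dn: "downset (D - {z})" unfolding downset_def
  proof (intro ballI allI impI)
    fix y x assume y: "y \<in> D - {z}" and le: "cell_le x y"
    have "x \<noteq> z" using z(2)[of y] y le by (auto simp: cell_le_def prod_eq_iff)
    then show "x \<in> D - {z}" using downsetD[OF Suc(4)] y le by blast
  qed
  have "n = card (D - {z})" using Suc(2,3) z(1) by simp
  then obtain V where "std_tab s (D - {z}) V" using Suc(1) Suc(3) dn by (metis finite_Diff)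
  then show ?case using std_tab_extend[of s "D - {z}" V z] z(1) Suc(4) by (auto simp: insert_absorb)
qed

lemma std_tab_exists_at:
  assumes "finite D" "downset D" "z \<in> D" "downset (D - {z})"
  shows "\<exists>V. std_tab s D V \<and> V z = s + card D"
proof -
  obtain V where V: "std_tab s (D - {z}) V" using std_tab_exists[of "D - {z}" s] assms by auto
  have c: "card D = card (D - {z}) + 1" using card_Suc_Diff1[OF assms(1,3)] by simp
  have "std_tab s D (V(z := s + card D))"
    using std_tab_extend[OF V, of z] insert_Diff[OF assms(3)] assms(2) c by simp
  then show ?thesis by (intro exI[of _ "V(z := s + card D)"]) simp
qed

text \<open>The cell \<open>x\<close> is outside the window before the extension because
  \<open>0 < j\<close>, and after it because \<open>j + 2 < e\<close>; the subword that selects the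
  permutation stays the same.\<close>

lemma dual_tab_extend:
  assumes "V x = 0" "0 < j" "j + 2 < e"
  shows "dual_tab M j (V(x := e)) = (dual_tab M j V)(x := e)"
proof -
  let ?P = "\<lambda>v. j \<le> v \<and> v \<le> j + 2"
  have "filter (\<lambda>c. ?P ((V(x := e)) c)) (grid M) = filter (\<lambda>c. ?P (V c)) (grid M)"
    using assms by (intro filter_cong) auto
  moreover have "map (V(x := e)) (filter (\<lambda>c. ?P (V c)) (grid M)) = map V (filter (\<lambda>c. ?P (V c)) (grid M))"
    using assms by (intro map_cong) auto
  ultimately have "filter ?P (reading M (V(x := e))) = filter ?P (reading M V)"
    using assms(2) by (simp add: filter_reading)
  then have "dual_perm j (reading M (V(x := e))) = dual_perm j (reading M V)" by (simp add: dual_perm_def)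
  moreover have "dual_perm j (reading M V) e = e" using assms by (simp add: dual_perm_def dual_select_id)
  ultimately show ?thesis by (auto simp: dual_tab_def)
qed

lemma dual_tabs_extend:
  "V x = 0 \<Longrightarrow> \<forall>j\<in>set js. 0 < j \<and> j + 2 < e \<Longrightarrow> dual_tabs M js (V(x := e)) = (dual_tabs M js V)(x := e)"
proof (induction js arbitrary: V)
  case (Cons j js)
  have "dual_tab M j V x = 0" using Cons.prems dual_tab_nonzero by blast
  then have "dual_tabs M js ((dual_tab M j V)(x := e)) = (dual_tabs M js (dual_tab M j V))(x := e)"
    using Cons.prems by (intro Cons.IH) auto
  moreover have "dual_tab M j (V(x := e)) = (dual_tab M j V)(x := e)"
    using Cons.prems by (intro dual_tab_extend) auto
  ultimately show ?case unfolding fold.simps o_apply by simp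
qed simp

text \<open>Induction on the number of cells. If the largest entry has the same cell in both
  tableaux, it is set aside. Otherwise the two cells \<open>A\<close> and \<open>B\<close> have a
  corner \<open>z\<close> of the rest between them in reading order, and one dual equivalence links
  a tableau with the largest entry in \<open>A\<close> to one with it in \<open>B\<close>. The
  bounds on \<open>js\<close> keep all windows inside the set of entries.\<close>

lemma std_tab_connected:
  assumes "std_tab s D U" "std_tab s D V" "D \<subseteq> box M"
  shows "\<exists>js. (\<forall>j\<in>set js. s < j \<and> j + 2 \<le> s + card D) \<and> V = dual_tabs M js U"
  using assms
proof (induction "card D" arbitrary: D U V)
  case 0
  then have "D = {}" using stabD(1) by fastforce
  then have "U = V" using stabD(5)[OF 0(2)] stabD(5)[OF 0(3)] by auto
  then show ?case by (intro exI[of _ "[]"]) auto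
next
  case (Suc n)
  define e where "e = s + card D"
  have fin: "finite D" and dn: "downset D" using stabD[OF Suc(3)] by auto
  have same: "\<exists>js. (\<forall>j\<in>set js. s < j \<and> j + 2 \<le> s + card D) \<and> V' = dual_tabs M js U'"
    if U': "std_tab s D U'" "U' x = e" and V': "std_tab s D V'" "V' x = e" and x: "x \<in> D" for U' V' x
  proof -
    have c: "n = card (D - {x})" using Suc(2) fin x by simp
    obtain js where js: "\<forall>j\<in>set js. s < j \<and> j + 2 \<le> s + card (D - {x})"
       "V'(x := 0) = dual_tabs M js (U'(x := 0))"
      using Suc(1)[OF c std_tab_restrict[OF U'(1) x] std_tab_restrict[OF V'(1) x]] U'(2) V'(2) e_def Suc(5) by auto
    have "dual_tabs M js ((U'(x := 0))(x := e)) = (dual_tabs M js (U'(x := 0)))(x := e)"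
      using js(1) c Suc(2) by (intro dual_tabs_extend) (auto simp: e_def)
    then have "dual_tabs M js U' = V'" using U'(2) V'(2) js(2)[symmetric] by auto
    then show ?thesis using js(1) c Suc(2) by (intro exI[of _ js]) auto
  qed
  have "e \<in> U ` D" "e \<in> V ` D" using stabD(4)[OF Suc(3)] stabD(4)[OF Suc(4)] Suc(2) by (auto simp: e_def)
  then obtain A B where A: "A \<in> D" "U A = e" and B: "B \<in> D" "V B = e" by auto
  show ?case
  proof (cases "A = B")
    case True
    then show ?thesis using same[OF Suc(3) A(2) Suc(4)] A B by auto
  next
    case False
    define D0 where "D0 = D - {A, B}"
    have dA: "downset (D - {A})" using stabD(2)[OF std_tab_restrict[OF Suc(3) A(1)]] A(2) e_def by simp
    have dB: "downset (D - {B})" using stabD(2)[OF std_tab_restrict[OF Suc(4) B(1)]] B(2) e_def by simp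
    have iA: "insert A D0 = D - {B}" and iB: "insert B D0 = D - {A}" and iAB: "insert A (insert B D0) = D"
      "insert B (insert A D0) = D"
      unfolding D0_def using A B False by auto
    have fin0: "finite D0" and n0: "A \<notin> D0" "B \<notin> D0" unfolding D0_def using fin by auto
    have "D0 = (D - {A}) \<inter> (D - {B})" unfolding D0_def by auto
    then have d0: "downset D0" using dA dB unfolding downset_def by blast
    obtain z where z: "z \<in> D0" "downset (D0 - {z})" "before A z \<and> before z B \<or> before B z \<and> before z A"
      using corner_between[OF fin0 d0 _ _ n0 False] iA iB dA dB by auto
    define j where "j = s + card D0"
    obtain V0 where V0: "std_tab s D0 V0" "V0 z = j" using std_tab_exists_at[OF fin0 d0 z(1,2)] j_def by auto
    have cD: "card D = card D0 + 2" using iAB(1) n0 False fin0 by (metis card_insert_disjoint finite_insert insertE add_2_eq_Suc')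
    have j0: "s < j" using z(1) fin0 j_def by (auto simp: card_gt_0_iff)
    \<comment> \<open>The three largest entries are \<open>j\<close>, \<open>j + 1\<close>,
      \<open>j + 2\<close>. With \<open>j\<close> in \<open>z\<close>, the other two are separated
      in the reading word, so the dual equivalence at \<open>j\<close> exchanges them and takes
      \<open>W1\<close> to \<open>W2\<close>.\<close>
    define W1 W2 where "W1 = V0(B := j + 1, A := j + 2)" and "W2 = V0(A := j + 1, B := j + 2)"
    have sB: "std_tab s (insert B D0) (V0(B := j + 1))" and sA: "std_tab s (insert A D0) (V0(A := j + 1))"
      using std_tab_extend[OF V0(1) n0(2)] std_tab_extend[OF V0(1) n0(1)] iA iB dA dB by (simp_all add: j_def)
    have cB: "s + card (insert B D0) + 1 = j + 2" and cA: "s + card (insert A D0) + 1 = j + 2"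
      using n0 fin0 j_def by auto
    have W1: "std_tab s D W1"
      using std_tab_extend[OF sB, of A] dn iAB(1) n0(1) False unfolding W1_def cB by simp
    have W2: "std_tab s D W2"
      using std_tab_extend[OF sA, of B] dn iAB(2) n0(2) False unfolding W2_def cA by simp
    have "{x \<in> box M. j \<le> W1 x \<and> W1 x \<le> j + 2} = {A, z, B}"
    proof (rule set_eqI)
      fix x
      have bx: "A \<in> box M" "B \<in> box M" "D0 \<subseteq> box M" using A B Suc(5) D0_def by auto
      show "x \<in> {x \<in> box M. j \<le> W1 x \<and> W1 x \<le> j + 2} \<longleftrightarrow> x \<in> {A, z, B}"
      proof (cases "x \<in> D0")
        case True
        then have "W1 x = V0 x" "x \<noteq> A" "x \<noteq> B" using n0 unfolding W1_def by auto
        moreover have "V0 x \<le> j" using std_tab_range[OF V0(1) True] j_def by simp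
        moreover have "V0 x = j \<longleftrightarrow> x = z" using inj_onD[OF stabD(3)[OF V0(1)] _ True z(1)] V0(2) by auto
        ultimately show ?thesis using True bx by auto
      next
        case False
        then have "V0 x = 0" "x \<noteq> z" using stabD(5)[OF V0(1)] z(1) by auto
        then show ?thesis using bx j0 \<open>A \<noteq> B\<close> unfolding W1_def by auto
      qed
    qed
    then have st: "set [A, z, B] = {x \<in> box M. j \<le> W1 x \<and> W1 x \<le> j + 2}" "set [B, z, A] = {x \<in> box M. j \<le> W1 x \<and> W1 x \<le> j + 2}"
      by auto
    have v: "W1 A = j + 2" "W1 B = j + 1" "W1 z = j" using False n0 z(1) V0(2) unfolding W1_def by auto
    have "dual_perm j (reading M W1) = adj_swap (j + 1)"
      using z(3)
    proof
      assume b: "before A z \<and> before z B"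
      then have "sorted_wrt before [A, z, B]" using before_trans[of A z B] by simp
      from filter_reading_eq[OF _ this st(1)] show ?thesis using j0 v by (simp add: dual_perm_def dual_select_def)
    next
      assume b: "before B z \<and> before z A"
      then have "sorted_wrt before [B, z, A]" using before_trans[of B z A] by simp
      from filter_reading_eq[OF _ this st(2)] show ?thesis using j0 v by (simp add: dual_perm_def dual_select_def)
    qed
    then have dtW: "dual_tab M j W1 = (\<lambda>x. adj_swap (j + 1) (W1 x))" unfolding dual_tab_def by simp
    have "dual_tab M j W1 = W2"
    proof
      fix x
      have "V0 x \<le> j" using std_tab_range[OF V0(1), of x] stabD(5)[OF V0(1), of x] unfolding j_def by (cases "x \<in> D0") auto
      then show "dual_tab M j W1 x = W2 x"
        using \<open>A \<noteq> B\<close> unfolding dtW by (auto simp: W1_def W2_def adj_swap_def)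
    qed
    moreover obtain js1 where "\<forall>j\<in>set js1. s < j \<and> j + 2 \<le> s + card D" "W1 = dual_tabs M js1 U"
      using same[OF Suc(3) A(2) W1 _ A(1)] v(1) cD by (auto simp: e_def j_def)
    moreover obtain js2 where "\<forall>j\<in>set js2. s < j \<and> j + 2 \<le> s + card D" "V = dual_tabs M js2 W2"
      using same[OF W2 _ Suc(4) B(2) B(1)] cD W2_def by (auto simp: e_def j_def)
    ultimately show ?thesis using j0 cD by (intro exI[of _ "js1 @ [j] @ js2"]) (auto simp: j_def)
  qed
qed

lemma kstep_length: "kstep v w \<Longrightarrow> 3 \<le> length v"
  by (induction rule: kstep.induct) auto

lemma keq_short: "keq v w \<Longrightarrow> length v \<le> 2 \<Longrightarrow> v = w"
  by (induction rule: rtranclp_induct) (auto dest: kstep_length)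

lemma reading_delete:
  assumes "std_tab s D U" "D \<subseteq> box M" "A \<in> D" "U A = s + card D"
  shows "reading M (U(A := 0)) = filter (\<lambda>x. s + 1 \<le> x \<and> x \<le> s + card D - 1) (reading M U)"
proof -
  have r: "(U c \<noteq> 0 \<and> c \<noteq> A) = (s + 1 \<le> U c \<and> U c \<le> s + card D - 1)" for c
    using std_tab_range[OF assms(1), of c] stabD(5)[OF assms(1), of c] inj_onD[OF stabD(3)[OF assms(1)], of c A] assms(3,4)
    by (cases "c \<in> D"; cases "c = A") force+
  have e: "((U(A := 0)) c \<noteq> 0) = (s + 1 \<le> U c \<and> U c \<le> s + card D - 1)" for c
    using r[of c] by auto
  have "map (U(A := 0)) (filter (\<lambda>c. s + 1 \<le> U c \<and> U c \<le> s + card D - 1) (grid M)) =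
     map U (filter (\<lambda>c. s + 1 \<le> U c \<and> U c \<le> s + card D - 1) (grid M))"
    using r by (intro map_cong) auto
  then show ?thesis unfolding reading_eq_filter[of M "U(A := 0)"] e by (simp add: filter_reading)
qed

text \<open>By induction two Knuth equivalent straight tableaux differ at most in the cell of the largest entry. If those
  cells differ, dual equivalences move the second largest entry to a corner between them; then the order of
  the last two entries in the reading word, a Knuth invariant, distinguishes the tableaux.\<close>

lemma straight_unique:
  assumes "std_tab s D U" "std_tab s D' U'" "D \<subseteq> box M" "D' \<subseteq> box M" "keq (reading M U) (reading M U')"
  shows "U = U'"
  using assms
proof (induction "card D" arbitrary: D D' U U')
  case (0 D D' U U')
  have "set (reading M U) = set (reading M U')" using keq_mset[OF 0(6)] by simp
  then have "card D = card D'" using 0 by (simp add: std_tab_set_reading) 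
  then have "D = {}" "D' = {}" using 0 stabD(1) by fastforce+
  then show ?case using stabD(5)[OF 0(2)] stabD(5)[OF 0(3)] by auto
next
  case (Suc n D D' U U')
  have "set (reading M U) = set (reading M U')" using keq_mset[OF Suc(7)] by simp
  then have "{s + 1..s + card D} = {s + 1..s + card D'}" using Suc by (simp add: std_tab_set_reading)
  then have cD: "card D' = card D" using arg_cong[where f = card] by fastforce
  define e where "e = s + card D"
  have "e \<in> U ` D" "e \<in> U' ` D'" using stabD(4)[OF Suc(3)] stabD(4)[OF Suc(4)] Suc(2) cD by (auto simp: e_def)
  then obtain A B where A: "A \<in> D" "U A = e" and B: "B \<in> D'" "U' B = e" by auto
  define V where "V = U(A := 0)"
  have "keq (reading M V) (reading M (U'(B := 0)))"
    using keq_filter[OF Suc(7), of "s + 1" "s + card D - 1"] reading_delete[OF Suc(3,5) A(1)] reading_delete[OF Suc(4,6) B(1)] A(2) B(2) cD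
    by (simp add: V_def e_def)
  moreover have sV: "std_tab s (D - {A}) V" unfolding V_def by (rule std_tab_restrict[OF Suc(3) A(1)]) (simp add: A(2) e_def)
  moreover have sV': "std_tab s (D' - {B}) (U'(B := 0))" by (rule std_tab_restrict[OF Suc(4) B(1)]) (simp add: B(2) e_def cD)
  moreover have cn: "n = card (D - {A})" using Suc(2) A(1) stabD(1)[OF Suc(3)] by simp
  ultimately have VV: "V = U'(B := 0)" using Suc(1)[OF cn sV sV'] Suc(5,6) by auto
  then have UV: "U = V(A := e)" "U' = V(B := e)" using A(2) B(2) by (auto simp: V_def fun_upd_idem_iff)
       (metis fun_upd_triv fun_upd_upd)
  define D0 where "D0 = D - {A}"
  have D0: "D0 = D' - {B}" using std_tab_nonzero[OF sV] std_tab_nonzero[OF sV'] VV unfolding D0_def by blast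
  show ?case
  proof (cases "A = B")
    case True then show ?thesis using UV by simp
  next
    case False
    have "insert A D0 = D" "insert B D0 = D'" using A(1) B(1) D0 D0_def by auto
    then obtain z where z: "z \<in> D0" "downset (D0 - {z})" "before A z \<and> before z B \<or> before B z \<and> before z A"
      using corner_between[OF _ _ _ _ _ _ False, of D0] stabD(1,2)[OF sV] stabD(2)[OF Suc(3)] stabD(2)[OF Suc(4)]
      using D0 D0_def by (metis Diff_iff singletonI)
    obtain V' where V': "std_tab s D0 V'" "V' z = s + card D0"
      using std_tab_exists_at[OF _ _ z(1,2)] stabD(1,2)[OF sV] D0_def by blast
    have e: "e = s + card D0 + 1" using cn Suc(2) by (simp add: e_def D0_def)
    have sub: "D0 \<subseteq> box M" using Suc(5) D0_def by auto
    obtain js where js: "\<forall>j\<in>set js. s < j \<and> j + 2 \<le> s + card D0" "V' = dual_tabs M js V"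
      using std_tab_connected[OF sV[folded D0_def] V'(1) sub] by blast
    have VA: "V A = 0" unfolding V_def by simp
    have VB: "V B = 0" unfolding VV by simp
    have jj: "\<forall>j\<in>set js. 0 < j \<and> j + 2 < e" using js(1) e by auto
    \<comment> \<open>One list serves both tableaux: its windows lie below \<open>e\<close>, and
      below \<open>e\<close> both tableaux are equal to \<open>V\<close>.\<close>
    have d: "dual_tabs M js U = V'(A := e)" "dual_tabs M js U' = V'(B := e)"
      unfolding UV js(2) by (rule dual_tabs_extend[where V = V, OF VA jj], rule dual_tabs_extend[where V = V, OF VB jj])
    have "distinct (reading M U)" using std_tab_distinct_reading[OF Suc(3)] .
    then have k: "keq (reading M (V'(A := e))) (reading M (V'(B := e)))"
      using keq_dual_words[OF Suc(7), of js] by (simp add: reading_dual_tabs[symmetric] d)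
    have f: "filter (\<lambda>x. e - 1 \<le> x \<and> x \<le> e) (reading M (V'(C := e))) = (if before C z then [e, e - 1] else [e - 1, e])"
      if C: "C \<in> {A, B}" for C
    proof -
      have Cb: "C \<in> box M" "C \<notin> D0" using C A(1) B(1) Suc(5,6) D0 D0_def by auto
      have Cz: "C \<noteq> z" using Cb z(1) by auto
      have j0: "0 < card D0" using z(1) stabD(1)[OF V'(1)] by (auto simp: card_gt_0_iff)
      have st: "{x \<in> box M. e - 1 \<le> (V'(C := e)) x \<and> (V'(C := e)) x \<le> e} = {C, z}"
      proof (rule set_eqI)
        fix x
        show "x \<in> {x \<in> box M. e - 1 \<le> (V'(C := e)) x \<and> (V'(C := e)) x \<le> e} \<longleftrightarrow> x \<in> {C, z}"
        proof (cases "x \<in> D0")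
          case True
          moreover have "V' x \<le> e - 1" using std_tab_range[OF V'(1) True] e by simp
          moreover have "V' x = e - 1 \<longleftrightarrow> x = z"
            using inj_onD[OF stabD(3)[OF V'(1)] _ True z(1)] V'(2) e by auto
          ultimately show ?thesis using sub Cb by auto
        next
          case False
          then have "V' x = 0" "x \<noteq> z" using stabD(5)[OF V'(1)] z(1) by auto
          then show ?thesis using Cb e j0 by auto
        qed
      qed
      show ?thesis
      proof (cases "before C z")
        case True
        then have "sorted_wrt before [C, z]" by auto
        from filter_reading_eq[OF _ this, where P = "\<lambda>x. e - 1 \<le> x \<and> x \<le> e" and M = M and T = "V'(C := e)"]
        show ?thesis using st True Cz V'(2) e j0 by simp
      next
        case False
        then have "sorted_wrt before [z, C]" using before_total[OF Cz] by simp
        from filter_reading_eq[OF _ this, where P = "\<lambda>x. e - 1 \<le> x \<and> x \<le> e" and M = M and T = "V'(C := e)"]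
        show ?thesis using st False Cz V'(2) e j0 by (simp add: insert_commute)
      qed
    qed
    have "filter (\<lambda>x. e - 1 \<le> x \<and> x \<le> e) (reading M (V'(A := e))) = filter (\<lambda>x. e - 1 \<le> x \<and> x \<le> e) (reading M (V'(B := e)))"
    proof (rule keq_short[OF keq_filter[OF k]])
      show "length (filter (\<lambda>x. e - 1 \<le> x \<and> x \<le> e) (reading M (V'(A := e)))) \<le> 2"
        using f[of A] by (simp split: if_splits)
    qed
    then show ?thesis using f[of A] f[of B] z(3) before_asym e by (auto split: if_splits)
  qed
qed

text \<open>On the straight tableau \<open>V\<close> the two chains give Knuth equivalent, hence
  equal, tableaux. The coincidence on its reading word is then transported to every word of the
  Knuth class. This is how chains are compared that are different as lists.\<close>

lemma dual_words_eqI: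
  assumes "std_tab s D V" "D \<subseteq> box M" "keq (reading M V) w" "keq (dual_words js w) (dual_words js' w)"
  shows "dual_words js w = dual_words js' w"
proof -
  have d: "distinct (reading M V)" using std_tab_distinct_reading[OF assms(1)] .
  have "keq (reading M (dual_tabs M js V)) (reading M (dual_tabs M js' V))"
    using keq_dual_words[OF assms(3) d, of js] keq_dual_words[OF assms(3) d, of js'] assms(4) keq_sym
    unfolding reading_dual_tabs by (meson rtranclp_trans)
  then have "dual_tabs M js V = dual_tabs M js' V"
    using straight_unique std_tab_dual_tabs[OF assms(1,2)] assms(2) by blast
  then have "dual_words js (reading M V) = dual_words js' (reading M V)" by (metis reading_dual_tabs)
  then show ?thesis using dual_words_eq_transfer[OF assms(3) d] by blast
qed

section \<open>Jeu de taquin slides\<close>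

declare split_paired_All [simp del] split_paired_Ex [simp del]

lemma cell_le_trans: "cell_le x y \<Longrightarrow> cell_le y z \<Longrightarrow> cell_le x z"
  by (auto simp: cell_le_def)

lemma cell_le_antisym: "cell_le x y \<Longrightarrow> cell_le y x \<Longrightarrow> x = y"
  by (auto simp: cell_le_def prod_eq_iff)

definition increasing :: "filling \<Rightarrow> bool" where
  "increasing S \<longleftrightarrow> (\<forall>x y. S x \<noteq> 0 \<longrightarrow> S y \<noteq> 0 \<longrightarrow> cell_le x y \<longrightarrow> x \<noteq> y \<longrightarrow> S x < S y)"

text \<open>Convexity is what makes the support a skew shape; \<open>H\<close> is the hole during a
  slide and empty before and after it.\<close>

definition convex_off :: "cell set \<Rightarrow> filling \<Rightarrow> bool" where
  "convex_off H S \<longleftrightarrow> (\<forall>x y z. S x \<noteq> 0 \<longrightarrow> S y \<noteq> 0 \<longrightarrow> cell_le x z \<longrightarrow> cell_le z y \<longrightarrow> z \<notin> H \<longrightarrow> S z \<noteq> 0)"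

definition clear_above :: "filling \<Rightarrow> cell \<Rightarrow> bool" where
  "clear_above S n \<longleftrightarrow> (S n = 0 \<longrightarrow> (\<forall>y. cell_le n y \<longrightarrow> S y = 0))"

text \<open>The invariant of a slide. The two \<open>clear_above\<close> conditions say that past an
  empty neighbour of the hole there is nothing at all, so a hole that can no longer move is outside
  the shape.\<close>

definition holed :: "filling \<Rightarrow> cell \<Rightarrow> bool" where
  "holed S h \<longleftrightarrow> S h = 0 \<and> increasing S \<and> convex_off {h} S \<and>
     clear_above S (fst h, Suc (snd h)) \<and> clear_above S (Suc (fst h), snd h)"

lemma convex_offD: "convex_off H S \<Longrightarrow> S x \<noteq> 0 \<Longrightarrow> S y \<noteq> 0 \<Longrightarrow> cell_le x z \<Longrightarrow> cell_le z y \<Longrightarrow> z \<notin> H \<Longrightarrow> S z \<noteq> 0"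
  unfolding convex_off_def by blast

lemma increasingD: "increasing S \<Longrightarrow> S x \<noteq> 0 \<Longrightarrow> S y \<noteq> 0 \<Longrightarrow> cell_le x y \<Longrightarrow> x \<noteq> y \<Longrightarrow> S x < S y"
  unfolding increasing_def by blast

text \<open>\<open>n\<close> is the neighbour moving into the hole \<open>h\<close> and \<open>k\<close> the other one, which treats both directions at once.\<close>

lemma holed_step:
  assumes h: "S h = 0" "increasing S" "convex_off {h} S" "clear_above S k"
    and n: "S n \<noteq> 0" "S k = 0 \<or> S n < S k" "cell_le h n" "h \<noteq> n"
    and nk: "\<And>y. cell_le h y \<Longrightarrow> y \<noteq> h \<Longrightarrow> cell_le n y \<or> cell_le k y"
  shows "holed (S(h := S n, n := 0)) n"
proof -
  let ?S = "S(h := S n, n := 0)"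
  have old: "S y \<noteq> 0 \<and> ?S y = S y" if "?S y \<noteq> 0" "y \<noteq> h" for y
    using that by (auto split: if_splits)
  have nn: "y \<noteq> n" if "?S y \<noteq> 0" for y using that by auto
  have Sh: "?S h = S n" using n(4) by simp
  have above_h: "S n < S y" if y: "?S y \<noteq> 0" "y \<noteq> h" "cell_le h y" for y
    using nk[OF y(3,2)]
  proof
    assume "cell_le n y"
    then show ?thesis using increasingD[OF h(2) n(1), of y] old[OF y(1,2)] nn[OF y(1)] by auto
  next
    assume ky: "cell_le k y"
    then have "S k \<noteq> 0" using h(4) old[OF y(1,2)] unfolding clear_above_def by auto
    then show ?thesis using increasingD[OF h(2), of k y] old[OF y(1,2)] n(2) ky by (cases "k = y") auto
  qed
  have below_h: "S y < S n" if y: "?S y \<noteq> 0" "y \<noteq> h" "cell_le y h" for y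
    using increasingD[OF h(2) _ n(1), of y] old[OF y(1,2)] nn[OF y(1)] cell_le_trans[OF y(3) n(3)] by auto
  have inc: "increasing ?S" unfolding increasing_def
  proof (intro allI impI)
    fix x y assume xy: "?S x \<noteq> 0" "?S y \<noteq> 0" "cell_le x y" "x \<noteq> y"
    consider "x = h" | "y = h" | "x \<noteq> h" "y \<noteq> h" by blast
    then show "?S x < ?S y"
    proof cases
      case 1 then show ?thesis using above_h[of y] old[of y] xy Sh by metis
    next
      case 2 then show ?thesis using below_h[of x] old[of x] xy Sh by metis
    next
      case 3 then show ?thesis using increasingD[OF h(2), of x y] old[of x] old[of y] xy by metis
    qed
  qed
  have con: "convex_off {n} ?S" unfolding convex_off_def
  proof (intro allI impI)
    fix x y z assume xy: "?S x \<noteq> 0" "?S y \<noteq> 0" "cell_le x z" "cell_le z y" "z \<notin> {n}"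
    show "?S z \<noteq> 0"
    proof (cases "z = h")
      case True then show ?thesis using Sh n(1) by simp
    next
      case zh: False
      have "S z \<noteq> 0"
      proof (cases "x = h")
        case True
        have yh: "y \<noteq> h" using cell_le_antisym[of h z] xy True zh by auto
        have "cell_le n z \<or> cell_le k z" using nk[of z] xy True zh by auto
        moreover have "S z \<noteq> 0" if "cell_le k z"
        proof -
          have "S k \<noteq> 0" using h(4) cell_le_trans[OF that xy(4)] old[OF xy(2) yh] unfolding clear_above_def by auto
          then show ?thesis using convex_offD[OF h(3), of k y z] that xy old[OF xy(2) yh] zh by auto
        qed
        moreover have "S z \<noteq> 0" if "cell_le n z"
          using convex_offD[OF h(3) n(1), of y z] that xy old[OF xy(2) yh] zh by auto
        ultimately show ?thesis by blast
      next
        case xh: False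
        have "\<exists>y'. S y' \<noteq> 0 \<and> cell_le z y'"
          using xy(2,4) old[of y] n(1,3) cell_le_trans by (cases "y = h") metis+
        then show ?thesis using convex_offD[OF h(3), of x _ z] xy(3) old[OF xy(1) xh] zh by auto
      qed
      then show ?thesis using zh xy(5) by simp
    qed
  qed
  \<comment> \<open>The cell \<open>n\<close> was occupied, so by convexity of the old shape an
    occupied cell beyond \<open>m\<close> would force \<open>m\<close> to be occupied too.\<close>
  have clr: "clear_above ?S m" if m: "cell_le n m" "m \<noteq> n" for m
    unfolding clear_above_def
  proof (intro impI allI)
    fix y assume y: "?S m = 0" "cell_le m y"
    have mh: "m \<noteq> h" using m n(3,4) cell_le_antisym by blast
    then have Sm: "S m = 0" using y(1) m(2) by simp
    have "S y = 0" using convex_offD[OF h(3) n(1), of y m] m y Sm mh by auto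
    moreover have "y \<noteq> h" using cell_le_trans[OF m(1) y(2)] n(3,4) cell_le_antisym by blast
    ultimately show "?S y = 0" by simp
  qed
  have "clear_above ?S (fst n, Suc (snd n))" "clear_above ?S (Suc (fst n), snd n)"
    by (rule clr; auto simp: cell_le_def prod_eq_iff)+
  then show ?thesis unfolding holed_def using inc con by simp
qed

lemma holed_step_right:
  assumes "holed S (r, c)" "S (r, Suc c) \<noteq> 0" "S (Suc r, c) = 0 \<or> S (r, Suc c) < S (Suc r, c)"
  shows "holed (S((r, c) := S (r, Suc c), (r, Suc c) := 0)) (r, Suc c)"
proof (rule holed_step[of S "(r, c)" "(Suc r, c)"])
  fix y assume "cell_le (r, c) y" "y \<noteq> (r, c)"
  then show "cell_le (r, Suc c) y \<or> cell_le (Suc r, c) y" by (cases y) (auto simp: cell_le_def)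
qed (use assms in \<open>auto simp: holed_def cell_le_def\<close>)

lemma holed_step_up:
  assumes "holed S (r, c)" "S (Suc r, c) \<noteq> 0" "S (r, Suc c) = 0 \<or> S (Suc r, c) < S (r, Suc c)"
  shows "holed (S((r, c) := S (Suc r, c), (Suc r, c) := 0)) (Suc r, c)"
proof (rule holed_step[of S "(r, c)" "(r, Suc c)"])
  fix y assume "cell_le (r, c) y" "y \<noteq> (r, c)"
  then show "cell_le (Suc r, c) y \<or> cell_le (r, Suc c) y" by (cases y) (auto simp: cell_le_def)
qed (use assms in \<open>auto simp: holed_def cell_le_def\<close>)

section \<open>Reading words during a slide, row by row\<close>

definition row_seg :: "filling \<Rightarrow> nat \<Rightarrow> nat \<Rightarrow> nat \<Rightarrow> nat list" where
  "row_seg S r a b = filter (\<lambda>v. v \<noteq> 0) (map (\<lambda>c. S (r, c)) [a..<b])"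

lemma filter_concat_rows: "filter P (map T (concat (map (\<lambda>r. map (Pair r) cs) rs))) =
    concat (map (\<lambda>r. filter P (map (\<lambda>c. T (r, c)) cs)) rs)"
  by (induction rs) (auto simp: o_def)

lemma reading_rows: "reading M S = concat (map (\<lambda>r. row_seg S r 0 M) (rev [0..<M]))"
  unfolding reading_def grid_def filter_concat_rows row_seg_def ..

lemma row_seg_split: "a \<le> b \<Longrightarrow> b \<le> c \<Longrightarrow> row_seg S r a c = row_seg S r a b @ row_seg S r b c"
  unfolding row_seg_def by (metis filter_append map_append upt_add_eq_append le_add_diff_inverse)

lemma row_seg_Cons: "a < b \<Longrightarrow> row_seg S r a b = (if S (r, a) = 0 then [] else [S (r, a)]) @ row_seg S r (Suc a) b"
  by (simp add: row_seg_def upt_conv_Cons)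

lemma sorted_row_seg: "increasing S \<Longrightarrow> sorted_wrt (<) (row_seg S r a b)"
proof (induction b)
  case (Suc b)
  have "x < S (r, b)" if "x \<in> set (row_seg S r a b)" "S (r, b) \<noteq> 0" for x
    using that increasingD[OF Suc.prems, of "(r, k)" "(r, b)" for k] by (auto simp: row_seg_def cell_le_def)
  then show ?case using Suc by (cases "a \<le> b") (auto simp: row_seg_def sorted_wrt_append)
qed (simp add: row_seg_def)

lemma row_seg_cong: "(\<And>k. a \<le> k \<Longrightarrow> k < b \<Longrightarrow> S (r, k) = S' (r', k)) \<Longrightarrow> row_seg S r a b = row_seg S' r' a b"
  unfolding row_seg_def by (rule arg_cong[where f = "filter _"]) (rule map_cong, auto)

text \<open>\<open>D\<close> lies above \<open>B\<close>, and under each cell of \<open>D\<close>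
  there is a smaller entry of \<open>B\<close>. Columns occupied only in \<open>B\<close> shift the
  letters of \<open>D\<close> to the left when zeros are dropped; they then face earlier entries of
  \<open>B\<close>, which are smaller still.\<close>

lemma dominated_filter:
  assumes "list_all2 (\<lambda>b d. d \<noteq> 0 \<longrightarrow> b \<noteq> 0 \<and> b < d) B D" "sorted_wrt (<) (filter (\<lambda>v. v \<noteq> (0::nat)) B)"
  shows "length (filter (\<lambda>v. v \<noteq> 0) D) \<le> length (filter (\<lambda>v. v \<noteq> 0) B) \<and>
    (\<forall>k<length (filter (\<lambda>v. v \<noteq> (0::nat)) D). filter (\<lambda>v. v \<noteq> 0) B ! k < filter (\<lambda>v. v \<noteq> 0) D ! k)"
  using assms
proof (induction rule: list_all2_induct)
  case (Cons b B d D)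
  let ?B = "filter (\<lambda>v. v \<noteq> 0) B" and ?D = "filter (\<lambda>v. v \<noteq> 0) D"
  have s: "sorted_wrt (<) ?B" using Cons.prems by (auto split: if_splits)
  note IH = Cons.IH[OF s]
  show ?case
  proof (cases "d = 0 \<and> b \<noteq> 0")
    case True
    have "(b # ?B) ! k < ?D ! k" if k: "k < length ?D" for k
    proof -
      have "sorted_wrt (<) (b # ?B)" using Cons.prems True by simp
      moreover have "Suc k < length (b # ?B)" using k IH by simp
      ultimately have "(b # ?B) ! k < (b # ?B) ! Suc k" by (metis lessI sorted_wrt_nth_less)
      then show ?thesis using IH k by fastforce
    qed
    then show ?thesis using True IH by auto
  next
    case False
    then show ?thesis using Cons.hyps IH
      by (auto simp: nth_Cons split: nat.split)
  qed
qed simp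

lemma reading_split_rows:
  assumes "Suc r < M"
  shows "reading M S = concat (map (\<lambda>r. row_seg S r 0 M) (rev [Suc (Suc r)..<M])) @ row_seg S (Suc r) 0 M @ row_seg S r 0 M
     @ concat (map (\<lambda>r. row_seg S r 0 M) (rev [0..<r]))"
proof -
  have "[0..<M] = [0..<r] @ r # Suc r # [Suc (Suc r)..<M]"
    using assms by (metis Suc_lessD le0 less_imp_le upt_add_eq_append upt_conv_Cons le_add_diff_inverse)
  then show ?thesis unfolding reading_rows by simp
qed

lemma keq_up:
  assumes ho: "holed S (r, c)" and x: "S (Suc r, c) \<noteq> 0" and lt: "S (r, Suc c) = 0 \<or> S (Suc r, c) < S (r, Suc c)"
    and M: "\<And>x. S x \<noteq> 0 \<Longrightarrow> x \<in> box M"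
  shows "keq (reading M S) (reading M (S((r, c) := S (Suc r, c), (Suc r, c) := 0)))"
proof -
  let ?S = "S((r, c) := S (Suc r, c), (Suc r, c) := 0)"
  let ?x = "S (Suc r, c)"
  have z: "S (r, c) = 0" and inc: "increasing S" and con: "convex_off {(r, c)} S"
    and clr: "clear_above S (r, Suc c)"
    using ho unfolding holed_def fst_conv snd_conv by auto
  have ho': "holed ?S (Suc r, c)" by (rule holed_step_up[OF ho x lt])
  have rM: "Suc r < M" "c < M" using M[OF x] by (auto simp: box_def)
  \<comment> \<open>\<open>C\<close> and \<open>D\<close> are the parts of the upper row left and
    right of the moving entry, \<open>A\<close> and \<open>B\<close> those of the lower row left and
    right of the hole.\<close>
  define C D A B where "C = row_seg S (Suc r) 0 c" and "D = row_seg S (Suc r) (Suc c) M"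
    and "A = row_seg S r 0 c" and "B = row_seg S r (Suc c) M"
  have up1: "row_seg S (Suc r) 0 M = C @ ?x # D"
    using row_seg_split[of 0 c M S "Suc r"] row_seg_Cons[of c M S "Suc r"] rM x by (simp add: C_def D_def)
  have lo1: "row_seg S r 0 M = A @ B"
    using row_seg_split[of 0 c M S r] row_seg_Cons[of c M S r] rM z by (simp add: A_def B_def)
  have "row_seg ?S (Suc r) 0 c = C" "row_seg ?S (Suc r) (Suc c) M = D" "row_seg ?S r 0 c = A" "row_seg ?S r (Suc c) M = B"
    unfolding A_def B_def C_def D_def by (rule row_seg_cong; simp)+
  then have up2: "row_seg ?S (Suc r) 0 M = C @ D" and lo2: "row_seg ?S r 0 M = A @ ?x # B"
    using row_seg_split[of 0 c M ?S "Suc r"] row_seg_Cons[of c M ?S "Suc r"] row_seg_split[of 0 c M ?S r] row_seg_Cons[of c M ?S r] rM x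
    by auto
  have sCD: "sorted_wrt (<) (C @ ?x # D)" using sorted_row_seg[OF inc, of "Suc r" 0 M] up1 by simp
  \<comment> \<open>That the moved entry fits into the lower row is read off from the invariant
    after the step.\<close>
  have sAB: "sorted_wrt (<) (A @ ?x # B)" using sorted_row_seg[of ?S r 0 M] ho' lo2 unfolding holed_def by metis
  \<comment> \<open>Left of the hole, a cell above an occupied cell of the lower row lies between
    that cell and the moving entry, so by convexity it is occupied.\<close>
  have AC: "list_all2 (\<lambda>a c. a \<noteq> 0 \<longrightarrow> a < c) (map (\<lambda>k. S (r, k)) [0..<c]) (map (\<lambda>k. S (Suc r, k)) [0..<c])"
  proof (rule list_all2I, clarsimp simp: set_zip)
    fix k assume k: "k < c" "0 < S (r, k)"
    have "S (Suc r, k) \<noteq> 0"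
      using convex_offD[of "{(r, c)}" S "(r, k)" "(Suc r, c)" "(Suc r, k)"] con k x by (auto simp: cell_le_def)
    then show "S (r, k) < S (Suc r, k)"
      using increasingD[OF inc, of "(r, k)" "(Suc r, k)"] k by (simp add: cell_le_def)
  qed simp
  \<comment> \<open>Right of the hole the situation is reversed: an occupied upper cell forces the
    right neighbour of the hole to be occupied, and by convexity the cell below itself.\<close>
  have BD: "list_all2 (\<lambda>b d. d \<noteq> 0 \<longrightarrow> b \<noteq> 0 \<and> b < d) (map (\<lambda>k. S (r, k)) [Suc c..<M]) (map (\<lambda>k. S (Suc r, k)) [Suc c..<M])"
  proof -
    have "S (r, k) \<noteq> 0 \<and> S (r, k) < S (Suc r, k)" if k: "Suc c \<le> k" "S (Suc r, k) \<noteq> 0" for k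
    proof -
      have "cell_le (r, Suc c) (Suc r, k)" using k by (simp add: cell_le_def)
      then have "S (r, Suc c) \<noteq> 0" using clr k(2) unfolding clear_above_def by metis
      then have "S (r, k) \<noteq> 0"
        using convex_offD[of "{(r, c)}" S "(r, Suc c)" "(Suc r, k)" "(r, k)"] con k by (simp add: cell_le_def)
      then show ?thesis using increasingD[OF inc, of "(r, k)" "(Suc r, k)"] k by (simp add: cell_le_def)
    qed
    then show ?thesis by (auto simp: list_all2_conv_all_nth)
  qed
  have "keq (C @ ?x # D @ A @ B) (C @ D @ A @ ?x # B)"
    unfolding C_def A_def row_seg_def
  proof (rule keq_slide_row[OF AC])
    show "sorted_wrt (<) (filter (\<lambda>x. x \<noteq> 0) (map (\<lambda>c. S (Suc r, c)) [0..<c]) @ ?x # D)"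
      using sCD by (simp add: C_def row_seg_def)
    show "sorted_wrt (<) (filter (\<lambda>x. x \<noteq> 0) (map (\<lambda>c. S (r, c)) [0..<c]) @ ?x # B)"
      using sAB by (simp add: A_def row_seg_def)
    have sB: "sorted_wrt (<) (filter (\<lambda>v. v \<noteq> 0) (map (\<lambda>k. S (r, k)) [Suc c..<M]))"
      using sorted_row_seg[OF inc, of r "Suc c" M] by (simp add: row_seg_def)
    show "length D \<le> length B" "\<forall>k<length D. B ! k < D ! k"
      using dominated_filter[OF BD sB] by (simp_all add: D_def B_def row_seg_def)
  qed
  then have k: "keq (row_seg S (Suc r) 0 M @ row_seg S r 0 M) (row_seg ?S (Suc r) 0 M @ row_seg ?S r 0 M)"
    unfolding up1 up2 lo1 lo2 by simp
  have e: "map (\<lambda>q. row_seg ?S q 0 M) (rev [Suc (Suc r)..<M]) = map (\<lambda>q. row_seg S q 0 M) (rev [Suc (Suc r)..<M])"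
    "map (\<lambda>q. row_seg ?S q 0 M) (rev [0..<r]) = map (\<lambda>q. row_seg S q 0 M) (rev [0..<r])"
    by (rule map_cong[OF refl], rule row_seg_cong, force)+
  show ?thesis
    unfolding reading_split_rows[OF rM(1), of S] reading_split_rows[OF rM(1), of ?S] e
    using keq_append[OF k] by (simp only: append_assoc)
qed

lemma reading_right:
  assumes "S (r, c) = 0" "r < M" "Suc c < M"
  shows "reading M (S((r, c) := S (r, Suc c), (r, Suc c) := 0)) = reading M S"
proof -
  let ?S = "S((r, c) := S (r, Suc c), (r, Suc c) := 0)"
  have "row_seg ?S k 0 M = row_seg S k 0 M" for k
  proof (cases "k = r")
    case False then show ?thesis by (intro row_seg_cong) auto
  next
    case True
    have "row_seg ?S r 0 c = row_seg S r 0 c" "row_seg ?S r (Suc (Suc c)) M = row_seg S r (Suc (Suc c)) M"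
      by (rule row_seg_cong; simp)+
    then show ?thesis
      using True assms row_seg_split[of 0 c M _ r] row_seg_Cons[of c M _ r] row_seg_Cons[of "Suc c" M _ r] by simp
  qed
  then show ?thesis unfolding reading_rows by simp
qed

definition skew :: "filling \<Rightarrow> bool" where
  "skew S \<longleftrightarrow> increasing S \<and> convex_off {} S"

lemma hole_move_keq:
  assumes "hole_move S h S'" "holed S h" "\<And>x. S x \<noteq> 0 \<Longrightarrow> x \<in> box M"
  shows "keq (reading M S) (reading M S') \<and> skew S' \<and> (\<forall>x. S' x \<noteq> 0 \<longrightarrow> x \<in> box M)"
  using assms
proof (induction rule: hole_move.induct)
  case (stop S r c)
  \<comment> \<open>The final hole causes no gap: both neighbours are empty, so no occupied cell
    lies above or to the right of it.\<close>
  have "convex_off {} S" unfolding convex_off_def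
  proof (intro allI impI)
    fix x y z assume xy: "S x \<noteq> 0" "S y \<noteq> 0" "cell_le x z" "cell_le z y"
    show "S z \<noteq> 0"
    proof (cases "z = (r, c)")
      case True
      then have "y \<noteq> (r, c)" using stop.prems(1) xy unfolding holed_def by auto
      then have "cell_le (r, Suc c) y \<or> cell_le (Suc r, c) y" using True xy(4) by (cases y) (auto simp: cell_le_def)
      then show ?thesis using stop(1,2) stop.prems(1) xy(2) unfolding holed_def clear_above_def by fastforce
    next
      case False
      then show ?thesis using stop.prems(1) convex_offD[of "{(r, c)}" S x y z] xy unfolding holed_def by auto
    qed
  qed
  then show ?case using stop.prems unfolding holed_def skew_def by auto
next
  case (right S r c S')
  let ?S = "S((r, c) := S (r, Suc c), (r, Suc c) := 0)"
  have b: "(r, Suc c) \<in> box M" using right by auto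
  then have b': "(r, c) \<in> box M" by (auto simp: box_def)
  have "keq (reading M ?S) (reading M S') \<and> skew S' \<and> (\<forall>x. S' x \<noteq> 0 \<longrightarrow> x \<in> box M)"
  proof (rule right.IH)
    show "holed ?S (r, Suc c)" using right by (intro holed_step_right)
    show "\<And>x. ?S x \<noteq> 0 \<Longrightarrow> x \<in> box M" using right.prems(2) b' by (auto split: if_splits)
  qed
  moreover have "reading M ?S = reading M S" using b right.prems(1) by (intro reading_right) (auto simp: box_def holed_def)
  ultimately show ?case by metis
next
  case (up S r c S')
  let ?S = "S((r, c) := S (Suc r, c), (Suc r, c) := 0)"
  have b: "(Suc r, c) \<in> box M" using up by auto
  then have b': "(r, c) \<in> box M" by (auto simp: box_def)
  have "keq (reading M ?S) (reading M S') \<and> skew S' \<and> (\<forall>x. S' x \<noteq> 0 \<longrightarrow> x \<in> box M)"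
  proof (rule up.IH)
    show "holed ?S (Suc r, c)" using up by (intro holed_step_up)
    show "\<And>x. ?S x \<noteq> 0 \<Longrightarrow> x \<in> box M" using up.prems(2) b' by (auto split: if_splits)
  qed
  moreover have "keq (reading M S) (reading M ?S)" using up by (intro keq_up) auto
  ultimately show ?case by (meson rtranclp_trans)
qed

lemma clear_aboveI: "n \<notin> inner_cells S \<Longrightarrow> clear_above S n"
  unfolding clear_above_def inner_cells_def cell_le_def by blast

lemma jdt_slides_keq:
  assumes "jdt_slide\<^sup>*\<^sup>* S R" "skew S" "\<forall>x. S x \<noteq> 0 \<longrightarrow> x \<in> box M"
  shows "keq (reading M S) (reading M R) \<and> skew R \<and> (\<forall>x. R x \<noteq> 0 \<longrightarrow> x \<in> box M)"
  using assms
proof (induction rule: rtranclp_induct)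
  case (step S1 S2)
  then have 1: "keq (reading M S) (reading M S1)" "skew S1" "\<And>x. S1 x \<noteq> 0 \<Longrightarrow> x \<in> box M" by auto
  obtain h where h: "inner_corner S1 h" "S1 h = 0" "hole_move S1 h S2"
    using step(2) unfolding jdt_slide_def by blast
  \<comment> \<open>The neighbours of an inner corner are not inner cells; for an empty neighbour
    this means that nothing lies beyond it.\<close>
  have "holed S1 h"
    using h(1,2) 1(2) clear_aboveI[of _ S1] unfolding holed_def skew_def inner_corner_def convex_off_def by blast
  then show ?case using hole_move_keq[OF h(3) _ 1(3)] 1(1) by (meson rtranclp_trans)
qed simp

section \<open>Two-row words\<close>

text \<open>The number of unmatched high letters (those \<open>\<ge> A\<close>), starting from \<open>c\<close> of them; truncated subtraction accounts
  for low letters with nothing to match.\<close>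

fun unmatched :: "nat \<Rightarrow> nat \<Rightarrow> nat list \<Rightarrow> nat" where
  "unmatched A c [] = c"
| "unmatched A c (x # v) = unmatched A (if x < A then c - 1 else Suc c) v"

text \<open>A shuffle of the increasing runs \<open>l\<close>, ..., \<open>A - 1\<close> and
  \<open>A\<close>, ..., \<open>h - 1\<close>. Its insertion tableau has at most two rows.\<close>

definition two_row :: "nat \<Rightarrow> nat \<Rightarrow> nat \<Rightarrow> nat list \<Rightarrow> bool" where
  "two_row l A h v \<longleftrightarrow> filter (\<lambda>x. x < A) v = [l..<A] \<and> filter (\<lambda>x. \<not> x < A) v = [A..<h]"

lemma unmatched_append: "unmatched A c (v @ w) = unmatched A (unmatched A c v) w"
  by (induction v arbitrary: c) auto

lemma unmatched_window:
  assumes "sorted_wrt (<) (filter (\<lambda>x. x < A) (u @ p @ v))" "sorted_wrt (<) (filter (\<lambda>x. \<not> x < A) (u @ p @ v))"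
    and "\<And>d. sorted_wrt (<) (filter (\<lambda>x. x < A) p) \<Longrightarrow> sorted_wrt (<) (filter (\<lambda>x. \<not> x < A) p) \<Longrightarrow>
      filter (\<lambda>x. x < A) q = filter (\<lambda>x. x < A) p \<and> filter (\<lambda>x. \<not> x < A) q = filter (\<lambda>x. \<not> x < A) p
      \<and> unmatched A d q = unmatched A d p"
  shows "filter (\<lambda>x. x < A) (u @ q @ v) = filter (\<lambda>x. x < A) (u @ p @ v) \<and>
    filter (\<lambda>x. \<not> x < A) (u @ q @ v) = filter (\<lambda>x. \<not> x < A) (u @ p @ v) \<and> unmatched A c (u @ q @ v) = unmatched A c (u @ p @ v)"
proof -
  have "sorted_wrt (<) (filter (\<lambda>x. x < A) p)" "sorted_wrt (<) (filter (\<lambda>x. \<not> x < A) p)"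
    using assms(1,2) unfolding filter_append sorted_wrt_append by blast+
  from assms(3)[OF this] show ?thesis unfolding unmatched_append filter_append by simp
qed

text \<open>A Knuth move can only exchange a low and a high letter, as two letters of one run are in
  increasing order. With high letters as opening brackets, the move exchanges \<open>)()\<close>
  with \<open>())\<close>, or \<open>()(\<close> with \<open>(()\<close>; neither changes the number
  left open.\<close>

lemma kstep_unmatched:
  assumes "kstep v w" "sorted_wrt (<) (filter (\<lambda>x. x < A) v)" "sorted_wrt (<) (filter (\<lambda>x. \<not> x < A) v)"
  shows "filter (\<lambda>x. x < A) w = filter (\<lambda>x. x < A) v \<and> filter (\<lambda>x. \<not> x < A) w = filter (\<lambda>x. \<not> x < A) v
    \<and> unmatched A c w = unmatched A c v"
  using assms
proof (induction rule: kstep.induct)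
  case (xzy x y z u v)
  show ?case by (rule unmatched_window[OF xzy(3,4)]) (use xzy(1,2) in \<open>simp split: if_splits\<close>)
next
  case (zxy x y z u v)
  show ?case by (rule unmatched_window[OF zxy(3,4)]) (use zxy(1,2) in \<open>simp split: if_splits\<close>)
next
  case (yxz x y z u v)
  show ?case by (rule unmatched_window[OF yxz(3,4)]) (use yxz(1,2) in \<open>simp split: if_splits\<close>)
next
  case (yzx x y z u v)
  show ?case by (rule unmatched_window[OF yzx(3,4)]) (use yzx(1,2) in \<open>simp split: if_splits\<close>)
qed

lemma keq_two_row:
  "keq v w \<Longrightarrow> two_row l A h v \<Longrightarrow> two_row l A h w \<and> unmatched A c w = unmatched A c v"
proof (induction rule: rtranclp_induct)
  case (step w w')
  then show ?case using kstep_unmatched[OF step(2), of A c] unfolding two_row_def by simp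
qed simp

lemma row_insert_end: "\<forall>y\<in>set r. y \<le> x \<Longrightarrow> row_insert x (r # rs) = (r @ [x]) # rs"
  by (simp add: takeWhile_eq_all_conv[THEN iffD2])

lemma row_insert_bump:
  assumes "\<forall>y\<in>set u. y \<le> x" "x < y"
  shows "row_insert x ((u @ y # v) # rs) = (u @ x # v) # row_insert y rs"
proof -
  have "takeWhile (\<lambda>y. y \<le> x) (u @ y # v) = u" using assms by (auto simp: takeWhile_append2)
  then show ?thesis by simp
qed

declare row_insert.simps(2) [simp del]

lemma append_eq_upt: "v @ [x] = [l..<b] \<Longrightarrow> l \<le> x \<and> b = Suc x \<and> v = [l..<x]"
proof (cases b)
  case (Suc b')
  assume "v @ [x] = [l..<b]"
  then show ?thesis using Suc by (cases "l \<le> b'") auto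
qed simp

text \<open>During insertion the bottom row consists of all low letters so far and the last
  \<open>unmatched\<close> high ones. A high letter is appended to it; a low letter bumps the
  smallest high letter there, if any, into the top row, which is the matching of brackets. The
  filter is there because insertion creates no empty rows.\<close>

lemma rsk_P_two_row:
  assumes "filter (\<lambda>x. x < A) v = [l..<a]" "filter (\<lambda>x. \<not> x < A) v = [A..<b]" "l \<le> a" "a \<le> A" "A \<le> b"
  shows "unmatched A 0 v \<le> b - A \<and> b - unmatched A 0 v - A \<le> a - l \<and>
    rsk_P v = filter (\<lambda>r. r \<noteq> []) [[l..<a] @ [b - unmatched A 0 v..<b], [A..<b - unmatched A 0 v]]"
  using assms
proof (induction v arbitrary: a b rule: rev_induct)
  case Nil
  then have "a = l" "b = A" using upt_eq_Nil_conv[of l a] upt_eq_Nil_conv[of A b] by auto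
  then show ?case by (simp add: rsk_P_def)
next
  case (snoc x v)
  define k where "k = unmatched A 0 v"
  have P: "rsk_P (v @ [x]) = row_insert x (rsk_P v)" by (simp add: rsk_P_def)
  show ?case
  proof (cases "x < A")
    case True
    have ax: "l \<le> x" "a = Suc x" "filter (\<lambda>x. x < A) v = [l..<x]"
      using append_eq_upt[of "filter (\<lambda>x. x < A) v" x l a] snoc.prems(1) True by auto
    have IH: "k \<le> b - A \<and> b - k - A \<le> x - l \<and>
        rsk_P v = filter (\<lambda>r. r \<noteq> []) [[l..<x] @ [b - k..<b], [A..<b - k]]"
      unfolding k_def using snoc.IH[of x b] snoc.prems ax True by auto
    have unmatched: "unmatched A 0 (v @ [x]) = k - 1" using True by (simp add: unmatched_append k_def)
    show ?thesis
    proof (cases "k = 0")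
      case k0: True
      have top: "b - A \<le> x - l" using IH k0 by simp
      show ?thesis
      proof (cases "x = l")
        case True
        then have "b = A" using top snoc.prems by auto
        then show ?thesis using IH k0 unmatched P True ax by simp
      next
        case False
        then have "rsk_P v = [l..<x] # filter (\<lambda>r. r \<noteq> []) [[A..<b]]" using IH k0 ax by simp
        then have "rsk_P (v @ [x]) = ([l..<x] @ [x]) # filter (\<lambda>r. r \<noteq> []) [[A..<b]]"
          unfolding P using row_insert_end[of "[l..<x]" x] by simp
        then show ?thesis using unmatched k0 ax top by auto
      qed
    next
      case False
      \<comment> \<open>The smallest high letter still in the bottom row, which \<open>x\<close>
        bumps.\<close>
      define t where "t = b - k"
      have t: "A \<le> t" "t < b" "t = b - k" using IH False snoc.prems unfolding t_def by auto
      have bot: "[t..<b] = t # [Suc t..<b]" using t by (simp add: upt_conv_Cons)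
      have "rsk_P v = ([l..<x] @ t # [Suc t..<b]) # filter (\<lambda>r. r \<noteq> []) [[A..<t]]"
        using IH bot t by simp
      then have r: "rsk_P (v @ [x]) = ([l..<x] @ x # [Suc t..<b]) # row_insert t (filter (\<lambda>r. r \<noteq> []) [[A..<t]])"
        unfolding P using row_insert_bump[of "[l..<x]" x t] True t by simp
      have "row_insert t (filter (\<lambda>r. r \<noteq> []) [[A..<t]]) = [[A..<Suc t]]"
        using row_insert_end[of "[A..<t]" t "[]"] t by (cases "A = t") auto
      then have "rsk_P (v @ [x]) = filter (\<lambda>r. r \<noteq> []) [[l..<a] @ [Suc t..<b], [A..<Suc t]]"
        using r ax t by simp
      moreover have "b - (k - 1) = Suc t" "k - 1 \<le> b - A" "Suc t - A \<le> a - l"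
        using False t(1,2) IH ax unfolding t(3) by linarith+
      ultimately show ?thesis unfolding unmatched by simp
    qed
  next
    case False
    have bx: "b = Suc x" "filter (\<lambda>x. \<not> x < A) v = [A..<x]"
      using append_eq_upt[of "filter (\<lambda>x. \<not> x < A) v" x A b] snoc.prems(2) False by auto
    have IH: "k \<le> x - A \<and> x - k - A \<le> a - l \<and>
        rsk_P v = filter (\<lambda>r. r \<noteq> []) [[l..<a] @ [x - k..<x], [A..<x - k]]"
      unfolding k_def using snoc.IH[of a x] snoc.prems bx False by auto
    have unmatched: "unmatched A 0 (v @ [x]) = Suc k" using False by (simp add: unmatched_append k_def)
    have e: "[x - k..<Suc x] = [x - k..<x] @ [x]" by simp
    show ?thesis
    proof (cases "[l..<a] @ [x - k..<x] = []")
      case True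
      then have "x - k = A" using IH snoc.prems False by auto
      then show ?thesis using IH True unmatched bx P e by auto
    next
      case ne: False
      then have "rsk_P v = ([l..<a] @ [x - k..<x]) # filter (\<lambda>r. r \<noteq> []) [[A..<x - k]]" using IH by simp
      moreover have "\<forall>y\<in>set ([l..<a] @ [x - k..<x]). y \<le> x" using snoc.prems False by auto
      ultimately have "rsk_P (v @ [x]) = (([l..<a] @ [x - k..<x]) @ [x]) # filter (\<lambda>r. r \<noteq> []) [[A..<x - k]]"
        unfolding P using row_insert_end by metis
      moreover have "Suc k \<le> Suc x - A" using IH False by linarith
      ultimately show ?thesis using unmatched bx IH e by auto
    qed
  qed
qed

lemma two_row_distinct: "two_row l A h v \<Longrightarrow> distinct v"
proof -
  assume t: "two_row l A h v"
  have "distinct v" if "distinct (filter P v)" "distinct (filter (\<lambda>x. \<not> P x) v)" for P and v :: "nat list"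
    using that by (induction v) (auto split: if_splits)
  then show ?thesis using t unfolding two_row_def by (metis distinct_upt)
qed

text \<open>For given runs the insertion tableau depends on the word only through
  \<open>unmatched\<close>.\<close>

lemma two_row_keqI:
  assumes "two_row l A h v" "two_row l A h w" "unmatched A 0 v = unmatched A 0 w" "l \<le> A" "A \<le> h"
  shows "keq v w"
proof -
  have "rsk_P v = rsk_P w"
    using rsk_P_two_row[of A v l A h] rsk_P_two_row[of A w l A h] assms unfolding two_row_def by simp
  then show ?thesis
    using keq_rsk_P[OF two_row_distinct[OF assms(1)]] keq_rsk_P[OF two_row_distinct[OF assms(2)]] keq_sym
    by (metis rtranclp_trans)
qed

text \<open>The Dyck pattern condition in terms of brackets: each of the \<open>m\<close> high
  letters is matched with a later low one. This leaves one of the \<open>m + 1\<close> low letters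
  free, the one that the crystal operator changes.\<close>

definition ballot :: "nat \<Rightarrow> nat \<Rightarrow> nat list \<Rightarrow> bool" where
  "ballot i m v \<longleftrightarrow> two_row i (i + m + 1) (i + 2 * m + 1) v \<and> unmatched (i + m + 1) 0 v = 0"

lemma unmatched_high: "\<forall>x\<in>set v. \<not> x < A \<Longrightarrow> unmatched A c v = c + length v"
  by (induction v arbitrary: c) auto

lemma unmatched_low: "\<forall>x\<in>set v. x < A \<Longrightarrow> unmatched A c v = c - length v"
  by (induction v arbitrary: c) auto

lemma ballot_canonical: "ballot i m ([i + m + 1..<i + 2 * m + 1] @ [i..<i + m + 1])"
proof -
  have "filter (\<lambda>x. x < A) ([A..<h] @ [l..<A]) = [l..<A]" "filter (\<lambda>x. \<not> x < A) ([A..<h] @ [l..<A]) = [A..<h]" for A h l :: nat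
    by (auto simp: filter_empty_conv filter_id_conv)
  then show ?thesis unfolding ballot_def two_row_def unmatched_append
    by (simp add: unmatched_high unmatched_low del: upt_Suc)
qed

lemma ballot_keq: "keq v w \<Longrightarrow> ballot i m v \<Longrightarrow> ballot i m w"
  unfolding ballot_def using keq_two_row by metis

text \<open>From right to left: the word is Knuth equivalent to the reading word of its insertion
  tableau, which is ballot, and Knuth moves preserve this.\<close>

lemma ballot_iff_rsk:
  assumes "distinct v" "1 \<le> m"
  shows "ballot i m v \<longleftrightarrow> rsk_P v = [[i..<i + m + 1], [i + m + 1..<i + 2 * m + 1]]"
proof
  assume b: "ballot i m v"
  then show "rsk_P v = [[i..<i + m + 1], [i + m + 1..<i + 2 * m + 1]]"
    using rsk_P_two_row[of "i + m + 1" v i "i + m + 1" "i + 2 * m + 1"] assms(2)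
    unfolding ballot_def two_row_def by (simp del: upt_Suc)
next
  assume "rsk_P v = [[i..<i + m + 1], [i + m + 1..<i + 2 * m + 1]]"
  then have "keq v ([i + m + 1..<i + 2 * m + 1] @ [i..<i + m + 1])"
    using keq_rsk_P[OF assms(1)] by (simp del: upt_Suc)
  then show "ballot i m v" using ballot_canonical ballot_keq keq_sym by blast
qed

section \<open>The bracketing in a Dyck pattern interval and the effect of an edge\<close>

definition two_letter :: "nat \<Rightarrow> nat \<Rightarrow> nat \<Rightarrow> nat" where
  "two_letter i m x = (if i \<le> x \<and> x \<le> i + m then i else if i + m + 1 \<le> x \<and> x \<le> i + 2 * m then Suc i else x)"

text \<open>The effect of an edge on the entries, where \<open>u\<close> is the free low letter. It
  turns into a high letter preceded by u - i others; as the high letters now start at i + m, it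
  becomes u + m. The low letters after it and the high letters before it go down by one.\<close>

definition edge_cycle :: "nat \<Rightarrow> nat \<Rightarrow> nat \<Rightarrow> nat" where
  "edge_cycle u m x = (if x = u then u + m else if u < x \<and> x \<le> u + m then x - 1 else x)"

abbreviation in_ivl :: "nat \<Rightarrow> nat \<Rightarrow> nat list \<Rightarrow> nat list" where
  "in_ivl i m \<equiv> filter (\<lambda>x. i \<le> x \<and> x \<le> i + 2 * m)"

abbreviation lows :: "nat \<Rightarrow> nat \<Rightarrow> nat list \<Rightarrow> nat list" where
  "lows i m v \<equiv> filter (\<lambda>x. x < i + m + 1) (in_ivl i m v)"

abbreviation highs :: "nat \<Rightarrow> nat \<Rightarrow> nat list \<Rightarrow> nat list" where
  "highs i m v \<equiv> filter (\<lambda>x. \<not> x < i + m + 1) (in_ivl i m v)"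

abbreviation free_lows :: "nat \<Rightarrow> nat \<Rightarrow> nat \<Rightarrow> nat \<Rightarrow> nat list \<Rightarrow> nat list" where
  "free_lows i m k c v \<equiv> unbracketed i k c (map (two_letter i m) v)"

lemma two_letter_cases:
  assumes "1 \<le> m"
  obtains "i \<le> x" "x \<le> i + m" "two_letter i m x = i" | "i + m + 1 \<le> x" "x \<le> i + 2 * m" "two_letter i m x = Suc i"
   | "x < i \<or> i + 2 * m < x" "two_letter i m x = x" "x \<noteq> i" "x \<noteq> Suc i"
proof -
  have "x < i \<or> i \<le> x \<and> x \<le> i + m \<or> i + m + 1 \<le> x \<and> x \<le> i + 2 * m \<or> i + 2 * m < x" by linarith
  then show thesis using that assms unfolding two_letter_def by (elim disjE) auto
qed

lemma free_lows_append: "1 \<le> m \<Longrightarrow> free_lows i m k c (xs @ ys) =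
    free_lows i m k c xs @ free_lows i m (k + length xs) (unmatched (i + m + 1) c (in_ivl i m xs)) ys"
proof (induction xs arbitrary: k c)
  case (Cons x xs)
  show ?case
    by (rule two_letter_cases[OF Cons.prems, of i x]) (use Cons in auto)
qed simp

text \<open>Low letters that are not free and high letters that are no longer pending are equally
  many, being matched in pairs; \<open>c\<close> counts the high letters pending at the
  start.\<close>

lemma free_lows_count: "1 \<le> m \<Longrightarrow> length (free_lows i m k c v) + c + length (highs i m v) =
    length (lows i m v) + unmatched (i + m + 1) c (in_ivl i m v)"
proof (induction v arbitrary: k c)
  case (Cons x v)
  show ?case
  proof (rule two_letter_cases[OF Cons.prems, of i x])
    assume "i \<le> x" "x \<le> i + m" "two_letter i m x = i"
    then show ?thesis using Cons.IH[OF Cons.prems, of "Suc k" "c - 1"] Cons.IH[OF Cons.prems, of "Suc k" c]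
      by (cases "c = 0") auto
  next
    assume "i + m + 1 \<le> x" "x \<le> i + 2 * m" "two_letter i m x = Suc i"
    then show ?thesis using Cons.IH[OF Cons.prems, of "Suc k" "Suc c"] by auto
  next
    assume "x < i \<or> i + 2 * m < x" "two_letter i m x = x" "x \<noteq> i" "x \<noteq> Suc i"
    then show ?thesis using Cons.IH[OF Cons.prems, of "Suc k" c] by auto
  qed
qed simp

text \<open>At a free low letter no high letter is pending, so the scan of the rest starts afresh
  with count 0.\<close>

lemma free_lows_Cons_split:
  assumes m: "1 \<le> m" and "free_lows i m k c v = p # ps"
  shows "\<exists>xs u ys. v = xs @ u # ys \<and> p = k + length xs \<and> free_lows i m k c xs = [] \<and> unmatched (i + m + 1) c (in_ivl i m xs) = 0 \<and>
     i \<le> u \<and> u \<le> i + m \<and> ps = free_lows i m (Suc p) 0 ys"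
  using assms(2)
proof (induction v arbitrary: k c)
  case (Cons x v)
  have step: ?case if h: "free_lows i m k c (x # v) = free_lows i m (Suc k) c' v"
    "\<And>xs. free_lows i m k c (x # xs) = free_lows i m (Suc k) c' xs"
    "\<And>xs. unmatched (i + m + 1) c (in_ivl i m (x # xs)) = unmatched (i + m + 1) c' (in_ivl i m xs)" for c'
  proof -
    have "free_lows i m (Suc k) c' v = p # ps" using Cons.prems h(1) by simp
    then obtain xs u ys where "v = xs @ u # ys" "p = Suc k + length xs" "free_lows i m (Suc k) c' xs = []"
      "unmatched (i + m + 1) c' (in_ivl i m xs) = 0" "i \<le> u" "u \<le> i + m" "ps = free_lows i m (Suc p) 0 ys"
      using Cons.IH by blast
    then show ?thesis by (intro exI[of _ "x # xs"] exI[of _ u] exI[of _ ys]) (use h(2,3)[of xs] in simp)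
  qed
  show ?case
  proof (rule two_letter_cases[OF m, of i x])
    assume x: "i \<le> x" "x \<le> i + m" "two_letter i m x = i"
    show ?thesis
    proof (cases "c = 0")
      case True
      then show ?thesis using x Cons.prems by (intro exI[of _ "[]"] exI[of _ x] exI[of _ v]) auto
    next
      case False
      then show ?thesis using x by (intro step[of "c - 1"]) auto
    qed
  next
    assume x: "i + m + 1 \<le> x" "x \<le> i + 2 * m" "two_letter i m x = Suc i"
    then show ?thesis by (intro step[of "Suc c"]) auto
  next
    assume x: "x < i \<or> i + 2 * m < x" "two_letter i m x = x" "x \<noteq> i" "x \<noteq> Suc i"
    then show ?thesis by (intro step[of c]) auto
  qed
qed simp

text \<open>If no low letter is free, the truncated subtraction never truncates, and one more
  pending high letter stays pending to the end.\<close>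

lemma unmatched_Suc: "1 \<le> m \<Longrightarrow> free_lows i m k c v = [] \<Longrightarrow> unmatched (i + m + 1) (Suc c) (in_ivl i m v) = Suc (unmatched (i + m + 1) c (in_ivl i m v))"
proof (induction v arbitrary: k c)
  case (Cons x v)
  show ?case
    by (rule two_letter_cases[OF Cons.prems(1), of i x])
      (use Cons.IH[OF Cons.prems(1), of "Suc k"] Cons.prems(2) in \<open>cases c; auto split: if_splits\<close>)+
qed simp

lemma upt_split: "a \<le> b \<Longrightarrow> b \<le> c \<Longrightarrow> [a..<b] @ [b..<c] = [a..<c]"
  by (metis upt_add_eq_append le_add_diff_inverse)

lemma upt_ConsD: "x # xs = [i..<j] \<Longrightarrow> x = i \<and> xs = [Suc i..<j]"
  by (cases "i < j") (simp_all add: upt_conv_Cons)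

lemma upt_append_eq:
  assumes "us @ vs = [l..<h]"
  shows "us = [l..<l + length us] \<and> vs = [l + length us..<h]"
proof -
  have l: "length us \<le> h - l" using arg_cong[OF assms, of length] by simp
  show ?thesis
  proof (cases "us = []")
    case False
    then have "l + length us \<le> h" using l by (cases "length us") auto
    then have "take (length us) [l..<h] = [l..<l + length us]" "drop (length us) [l..<h] = [l + length us..<h]"
      by (simp_all add: take_upt)
    then show ?thesis using assms by (metis append_eq_conv_conj)
  qed (use assms in simp)
qed

text \<open>Before the free letter \<open>u\<close> no low letter is free and no high one pending,
  so both kinds occur equally often, u - i times each. This determines the runs on either side of
  \<open>u\<close>.\<close>

lemma ballot_split:
  assumes m: "1 \<le> m" and b: "ballot i m (in_ivl i m w)"
  obtains xs u ys where "w = xs @ u # ys" "i \<le> u" "u \<le> i + m" "free_lows i m 0 0 w = [length xs]"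
    "free_lows i m 0 0 xs = []" "free_lows i m (Suc (length xs)) 0 ys = []"
    "lows i m xs = [i..<u]" "lows i m ys = [Suc u..<i + m + 1]"
    "highs i m xs = [i + m + 1..<u + m + 1]" "highs i m ys = [u + m + 1..<i + 2 * m + 1]"
    "unmatched (i + m + 1) 0 (in_ivl i m xs) = 0" "unmatched (i + m + 1) 0 (in_ivl i m ys) = 0"
proof -
  have L: "lows i m w = [i..<i + m + 1]" and H: "highs i m w = [i + m + 1..<i + 2 * m + 1]"
    and U: "unmatched (i + m + 1) 0 (in_ivl i m w) = 0"
    using b unfolding ballot_def two_row_def by auto
  have "length (lows i m w) = m + 1" "length (highs i m w) = m" unfolding L H by simp_all
  then have "length (free_lows i m 0 0 w) = 1" using free_lows_count[OF m, of i 0 0 w] U by simp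
  then obtain p where p: "free_lows i m 0 0 w = [p]" by (metis One_nat_def length_0_conv length_Suc_conv)
  then obtain xs u ys where w: "w = xs @ u # ys" "p = length xs" "free_lows i m 0 0 xs = []"
     "unmatched (i + m + 1) 0 (in_ivl i m xs) = 0" "i \<le> u" "u \<le> i + m" "free_lows i m (Suc p) 0 ys = []"
    using free_lows_Cons_split[OF m p] by auto
  have "lows i m xs @ (u # lows i m ys) = [i..<i + m + 1]" using L w by simp
  note ll = upt_append_eq[OF this]
  note lx = ll[THEN conjunct1] and ly = ll[THEN conjunct2]
  have iu: "u = i + length (lows i m xs)" using upt_ConsD[OF ly] by (rule conjunct1)
  have "lows i m ys = [Suc (i + length (lows i m xs))..<i + m + 1]" using upt_ConsD[OF ly] by (rule conjunct2)
  then have ly': "lows i m ys = [Suc u..<i + m + 1]" using iu by metis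
  have lh: "length (highs i m xs) = length (lows i m xs)"
    using free_lows_count[OF m, of i 0 0 xs] w by simp
  have "highs i m xs @ highs i m ys = [i + m + 1..<i + 2 * m + 1]" using H w by simp
  note hh = upt_append_eq[OF this]
  have "i + m + 1 + length (highs i m xs) = u + m + 1" using lh iu by linarith
  then have hx: "highs i m xs = [i + m + 1..<u + m + 1]" "highs i m ys = [u + m + 1..<i + 2 * m + 1]"
    using hh by metis+
  have "unmatched (i + m + 1) 0 (in_ivl i m ys) = 0" using U w by (simp add: unmatched_append)
  moreover have "lows i m xs = [i..<u]" using lx iu by metis
  moreover have "free_lows i m 0 0 w = [length xs]" "free_lows i m (Suc (length xs)) 0 ys = []" using p w(2,7) by simp_all
  ultimately show thesis using that[OF w(1,5,6) _ w(3) _ _ ly' hx w(4)] by blast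
qed

lemma inj_edge_cycle: "inj (edge_cycle u m)"
proof (rule injI)
  fix x y assume "edge_cycle u m x = edge_cycle u m y"
  then show "x = y" unfolding edge_cycle_def by (auto split: if_splits)
qed

lemma edge_cycle_in_ivl: "i \<le> u \<Longrightarrow> u \<le> i + m \<Longrightarrow> (i \<le> edge_cycle u m x \<and> edge_cycle u m x \<le> i + 2 * m) \<longleftrightarrow> (i \<le> x \<and> x \<le> i + 2 * m)"
  unfolding edge_cycle_def by (simp split: if_split) linarith

lemma edge_cycle_low: "i \<le> u \<Longrightarrow> u \<le> i + m \<Longrightarrow> x \<noteq> u \<Longrightarrow> edge_cycle u m x < i + m \<longleftrightarrow> x < i + m + 1"
  unfolding edge_cycle_def by (simp split: if_split) linarith

lemma in_ivl_edge_cycle: "i \<le> u \<Longrightarrow> u \<le> i + m \<Longrightarrow> in_ivl i m (map (edge_cycle u m) v) = map (edge_cycle u m) (in_ivl i m v)"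
  by (simp add: filter_map o_def edge_cycle_in_ivl)

lemma unmatched_edge_cycle: "i \<le> u \<Longrightarrow> u \<le> i + m \<Longrightarrow> u \<notin> set v \<Longrightarrow> unmatched (i + m) c (map (edge_cycle u m) v) = unmatched (i + m + 1) c v"
  by (induction v arbitrary: c) (auto simp: edge_cycle_low)

lemma map_edge_cycle_upt:
  "b \<le> u \<Longrightarrow> map (edge_cycle u m) [a..<b] = [a..<b]"
  "u < a \<Longrightarrow> b \<le> u + m + 1 \<Longrightarrow> map (edge_cycle u m) [a..<b] = [a - 1..<b - 1]"
  "u + m < a \<Longrightarrow> map (edge_cycle u m) [a..<b] = [a..<b]"
proof -
  show "b \<le> u \<Longrightarrow> map (edge_cycle u m) [a..<b] = [a..<b]" "u + m < a \<Longrightarrow> map (edge_cycle u m) [a..<b] = [a..<b]"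
    by (auto intro!: map_idI simp: edge_cycle_def)
  assume "u < a" "b \<le> u + m + 1"
  then show "map (edge_cycle u m) [a..<b] = [a - 1..<b - 1]"
    by (intro nth_equalityI) (auto simp: edge_cycle_def)
qed

text \<open>After the edge there are \<open>m\<close> low and \<open>m + 1\<close> high letters, so
  the threshold is \<open>i + m\<close>, one less than before.\<close>

lemma ballot_edge:
  assumes m: "1 \<le> m" and w: "w = xs @ u # ys" "i \<le> u" "u \<le> i + m"
    and "free_lows i m (Suc (length xs)) 0 ys = []"
    "lows i m xs = [i..<u]" "lows i m ys = [Suc u..<i + m + 1]"
    "highs i m xs = [i + m + 1..<u + m + 1]" "highs i m ys = [u + m + 1..<i + 2 * m + 1]"
    "unmatched (i + m + 1) 0 (in_ivl i m xs) = 0" "unmatched (i + m + 1) 0 (in_ivl i m ys) = 0"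
  shows "two_row i (i + m) (i + 2 * m + 1) (in_ivl i m (map (edge_cycle u m) w)) \<and> unmatched (i + m) 0 (in_ivl i m (map (edge_cycle u m) w)) = 1"
proof -
  have cu: "edge_cycle u m u = u + m" by (simp add: edge_cycle_def)
  have ui: "u \<in> set (in_ivl i m [u])" using w by simp
  have nx: "u \<notin> set (in_ivl i m xs)"
  proof
    assume "u \<in> set (in_ivl i m xs)"
    then have "u \<in> set (lows i m xs)" using w by auto
    then show False unfolding assms(6) by simp
  qed
  have ny: "u \<notin> set (in_ivl i m ys)"
  proof
    assume "u \<in> set (in_ivl i m ys)"
    then have "u \<in> set (lows i m ys)" using w by auto
    then show False unfolding assms(7) by (simp del: upt_Suc)
  qed
  have f: "in_ivl i m (map (edge_cycle u m) w) = map (edge_cycle u m) (in_ivl i m xs) @ (u + m) # map (edge_cycle u m) (in_ivl i m ys)"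
    unfolding in_ivl_edge_cycle[OF w(2,3)] using w by (simp add: cu)
  have fl: "filter (\<lambda>x. x < i + m) (map (edge_cycle u m) v) = map (edge_cycle u m) (filter (\<lambda>x. x < i + m + 1) v)"
    "filter (\<lambda>x. \<not> x < i + m) (map (edge_cycle u m) v) = map (edge_cycle u m) (filter (\<lambda>x. \<not> x < i + m + 1) v)"
    if uv: "u \<notin> set v" for v
  proof -
    have c: "edge_cycle u m x < i + m \<longleftrightarrow> x < i + m + 1" if "x \<in> set v" for x
      using edge_cycle_low[OF w(2,3), of x] that uv by blast
    have "filter (\<lambda>x. edge_cycle u m x < i + m) v = filter (\<lambda>x. x < i + m + 1) v"
      "filter (\<lambda>x. \<not> edge_cycle u m x < i + m) v = filter (\<lambda>x. \<not> x < i + m + 1) v"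
      by (rule filter_cong; simp add: c)+
    then show "filter (\<lambda>x. x < i + m) (map (edge_cycle u m) v) = map (edge_cycle u m) (filter (\<lambda>x. x < i + m + 1) v)"
    "filter (\<lambda>x. \<not> x < i + m) (map (edge_cycle u m) v) = map (edge_cycle u m) (filter (\<lambda>x. \<not> x < i + m + 1) v)"
      by (simp_all add: filter_map o_def)
  qed
  have "filter (\<lambda>x. x < i + m) (in_ivl i m (map (edge_cycle u m) w)) = map (edge_cycle u m) [i..<u] @ map (edge_cycle u m) [Suc u..<i + m + 1]"
    unfolding f filter_append using fl[OF nx] fl[OF ny] assms(6,7) w by simp
  also have "\<dots> = [i..<u] @ [u..<i + m]"
    using map_edge_cycle_upt(1)[of u u m i] map_edge_cycle_upt(2)[of u "Suc u" "i + m + 1" m] w by (simp del: upt_Suc)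
  also have "\<dots> = [i..<i + m]" using w by (metis upt_add_eq_append le_add_diff_inverse)
  finally have l: "filter (\<lambda>x. x < i + m) (in_ivl i m (map (edge_cycle u m) w)) = [i..<i + m]" .
  have "filter (\<lambda>x. \<not> x < i + m) (in_ivl i m (map (edge_cycle u m) w)) =
      map (edge_cycle u m) [i + m + 1..<u + m + 1] @ (u + m) # map (edge_cycle u m) [u + m + 1..<i + 2 * m + 1]"
    unfolding f filter_append using fl[OF nx] fl[OF ny] assms(8,9) w by simp
  also have "\<dots> = [i + m..<u + m] @ (u + m) # [u + m + 1..<i + 2 * m + 1]"
    using map_edge_cycle_upt(2)[of u "i + m + 1" "u + m + 1" m] map_edge_cycle_upt(3)[of u m "u + m + 1" "i + 2 * m + 1"] w
    by (simp del: upt_Suc)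
  also have "\<dots> = [i + m..<u + m] @ [u + m..<i + 2 * m + 1]" using w by (simp add: upt_conv_Cons)
  also have "\<dots> = [i + m..<i + 2 * m + 1]"
    using w by (intro upt_split) auto
  finally have h: "filter (\<lambda>x. \<not> x < i + m) (in_ivl i m (map (edge_cycle u m) w)) = [i + m..<i + 2 * m + 1]" .
  \<comment> \<open>The new high letter u + m is pending when the scan enters \<open>ys\<close>, and
    without a free low letter in \<open>ys\<close> it is never matched.\<close>
  have "unmatched (i + m) 0 (in_ivl i m (map (edge_cycle u m) w)) = unmatched (i + m + 1) 1 (in_ivl i m ys)"
    unfolding f unmatched_append unmatched_edge_cycle[OF w(2,3) nx] using assms(10) w unmatched_edge_cycle[OF w(2,3) ny] by simp
  also have "\<dots> = 1" using unmatched_Suc[OF m assms(5)] assms(11) by simp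
  finally show ?thesis using l h unfolding two_row_def by simp
qed

section \<open>Edges of the crystal skeleton\<close>

text \<open>Positions start at 1, because 0 marks the empty cells in the lemma on slides of two rows.\<close>

definition position :: "nat list \<Rightarrow> nat \<Rightarrow> nat" where
  "position w x = Suc (length (takeWhile (\<lambda>y. y \<noteq> x) w))"

lemma position_append: "x \<notin> set xs \<Longrightarrow> position (xs @ x # ys) x = Suc (length xs)"
  by (induction xs) (auto simp: position_def)

lemma position_le: "x \<in> set w \<Longrightarrow> position w x \<le> length w"
  by (induction w) (auto simp: position_def)

lemma position_less: "x \<in> set xs \<Longrightarrow> y \<notin> set xs \<Longrightarrow> position (xs @ ys) x < position (xs @ ys) y"
proof -
  assume x: "x \<in> set xs" and y: "y \<notin> set xs"
  have "length xs < position (xs @ ys) y" using y by (induction xs) (auto simp: position_def)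
  moreover have "position (xs @ ys) x = position xs x" using x by (induction xs) (auto simp: position_def)
  ultimately show ?thesis using position_le[OF x] by simp
qed

lemma nth_position: "x \<in> set w \<Longrightarrow> w ! (position w x - 1) = x"
  by (induction w) (auto simp: position_def)

lemma position_inj: "x \<in> set w \<Longrightarrow> y \<in> set w \<Longrightarrow> position w x = position w y \<Longrightarrow> x = y"
  by (metis nth_position)

lemma sorted_position: "distinct w \<Longrightarrow> sorted_wrt (\<lambda>x y. position w x < position w y) w"
proof (induction w)
  case (Cons a w)
  have p: "position (a # w) x = Suc (position w x)" if "x \<in> set w" for x
    using that Cons.prems by (auto simp: position_def)
  have "sorted_wrt (\<lambda>x y. position (a # w) x < position (a # w) y) w"
    using Cons by (auto intro: sorted_wrt_mono_rel[rotated] simp: p)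
  moreover have "position (a # w) a = 1" by (simp add: position_def)
  ultimately show ?case using Cons.prems by (auto simp: p position_def)
qed simp

lemma sorted_position_filter: "distinct w \<Longrightarrow> sorted_wrt (<) (map (position w) (filter P w))"
  using sorted_wrt_filter[OF sorted_position] by (simp add: sorted_wrt_map)

lemma position_map: "inj f \<Longrightarrow> position (map f w) (f x) = position w x"
  by (simp add: position_def takeWhile_map o_def inj_eq)

lemma eq_by_position:
  assumes "distinct v" "distinct w" "set v = set w" "\<And>x. x \<in> set v \<Longrightarrow> position v x = position w x"
  shows "v = w"
proof (rule nth_equalityI)
  show l: "length v = length w" using assms(1-3) distinct_card by metis
  fix k assume k: "k < length v"
  have n: "position v (v ! k) = Suc k"
  proof -
    have "v = take k v @ v ! k # drop (Suc k) v" using k by (rule id_take_nth_drop)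
    moreover have "v ! k \<notin> set (take k v)" using assms(1) k calculation
      by (metis distinct_append disjoint_iff list.set_intros(1))
    ultimately show ?thesis using position_append[of "v ! k" "take k v" "drop (Suc k) v"] k by simp
  qed
  then have "position w (v ! k) = Suc k" using assms(4)[of "v ! k"] k by simp
  then show "v ! k = w ! k" using nth_position[of "v ! k" w] assms(3) k by (metis diff_Suc_1 nth_mem)
qed

section \<open>Dual equivalences as Knuth moves on positions\<close>

lemma adj_swap_invol: "adj_swap k (adj_swap k x) = x"
  by (auto simp: adj_swap_def)

lemma dual_perm_invol: "dual_perm j w (dual_perm j w x) = x"
  by (cases rule: dual_perm_cases[of j w]) (auto simp: adj_swap_invol)

lemma position_dual_word: "position (dual_word j w) x = position w (dual_perm j w x)"
  using position_map[OF inj_dual_perm[of j w], of w "dual_perm j w x"] by (simp add: dual_word_def dual_perm_invol)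

lemma dual_perm_id: "x < j \<or> j + 2 < x \<Longrightarrow> dual_perm j w x = x"
  by (simp add: dual_perm_def dual_select_id)

lemma set_dual_word: "set (dual_word j w) = set w"
proof -
  have "dual_perm j w ` set w \<subseteq> set w"
    by (cases rule: dual_perm_cases[of j w]) (auto simp: adj_swap_def)
  moreover have "set w \<subseteq> dual_perm j w ` set w"
  proof
    fix x assume "x \<in> set w"
    then have "dual_perm j w x \<in> set w" using calculation by blast
    then show "x \<in> dual_perm j w ` set w" by (metis dual_perm_invol imageI)
  qed
  ultimately show ?thesis by (simp add: dual_word_def)
qed

text \<open>The bridge between both actions. Which value of the window stands between the others in
  the word is decided by the order of the three positions, and this is what the Knuth rule asks
  about the list of positions.\<close>

lemma position_knuth3:
  assumes w: "distinct w" and s: "{j, j + 1, j + 2} \<subseteq> set w"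
  shows "knuth3 (position w j) (position w (j + 1)) (position w (j + 2)) =
    map (\<lambda>x. position w (dual_perm j w x)) [j, j + 1, j + 2]"
proof -
  let ?f = "filter (\<lambda>x. j \<le> x \<and> x \<le> j + 2) w"
  have f: "?f = L" if L: "sorted_wrt (<) (map (position w) L)" "set L = {j, j + 1, j + 2}" for L
  proof -
    have "{j, j + 1, j + 2} = {x. j \<le> x \<and> x \<le> j + 2}" by auto
    then have st: "set ?f = set L" using s unfolding L(2) set_filter by blast
    have "map (position w) ?f = map (position w) L"
      by (rule strict_sorted_equal[OF L(1) sorted_position_filter[OF w]]) (simp only: set_map st)
    moreover have "inj_on (position w) (set ?f \<union> set L)"
      using st position_inj[of _ w] by (intro inj_onI) auto
    ultimately show ?thesis using inj_on_map_eq_map[of "position w" ?f L] by blast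
  qed
  have ne: "position w j \<noteq> position w (j + 1)" "position w j \<noteq> position w (j + 2)" "position w (j + 1) \<noteq> position w (j + 2)"
    using position_inj[of j w "j + 1"] position_inj[of j w "j + 2"] position_inj[of "j + 1" w "j + 2"] s by auto
  define a b c where "a = position w j" and "b = position w (j + 1)" and "c = position w (j + 2)"
  consider "a < b" "b < c" | "a < c" "c < b" | "b < a" "a < c" | "b < c" "c < a" | "c < a" "a < b" | "c < b" "b < a"
    using ne unfolding a_def b_def c_def by linarith
  then show ?thesis
  proof cases
    case 1
    then have "?f = [j, j + 1, j + 2]" by (intro f) (auto simp: a_def b_def c_def)
    then have "dual_perm j w = id" by (simp add: dual_perm_def dual_select_def)
    then show ?thesis using 1 by (simp add: knuth3.simps a_def b_def c_def)
  next
    case 2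
    then have "?f = [j, j + 2, j + 1]" by (intro f) (auto simp: a_def b_def c_def)
    then have "dual_perm j w = adj_swap j" by (simp add: dual_perm_def dual_select_def)
    then show ?thesis using 2 by (simp add: knuth3.simps a_def b_def c_def adj_swap_def)
  next
    case 3
    then have "?f = [j + 1, j, j + 2]" by (intro f) (auto simp: a_def b_def c_def)
    then have "dual_perm j w = adj_swap (j + 1)" by (simp add: dual_perm_def dual_select_def)
    then show ?thesis using 3 by (simp add: knuth3.simps a_def b_def c_def adj_swap_def)
  next
    case 4
    then have "?f = [j + 1, j + 2, j]" by (intro f) (auto simp: a_def b_def c_def)
    then have "dual_perm j w = adj_swap j" by (simp add: dual_perm_def dual_select_def)
    then show ?thesis using 4 by (simp add: knuth3.simps a_def b_def c_def adj_swap_def)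
  next
    case 5
    then have "?f = [j + 2, j, j + 1]" by (intro f) (auto simp: a_def b_def c_def)
    then have "dual_perm j w = adj_swap (j + 1)" by (simp add: dual_perm_def dual_select_def)
    then show ?thesis using 5 by (simp add: knuth3.simps a_def b_def c_def adj_swap_def)
  next
    case 6
    then have "?f = [j + 2, j + 1, j]" by (intro f) (auto simp: a_def b_def c_def)
    then have "dual_perm j w = id" by (simp add: dual_perm_def dual_select_def)
    then show ?thesis using 6 by (simp add: knuth3.simps a_def b_def c_def)
  qed
qed

lemma knuth_at_position:
  assumes "distinct w" "{i..<h} \<subseteq> set w" "i + p + 2 < h"
  shows "knuth_at p (map (position w) [i..<h]) = map (position (dual_word (i + p) w)) [i..<h]"
proof -
  define j where "j = i + p"
  have u: "[i..<h] = [i..<j] @ j # (j + 1) # (j + 2) # [j + 3..<h]"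
  proof -
    have "[i..<h] = [i..<j] @ [j..<h]" using assms(3) by (intro upt_split[symmetric]) (auto simp: j_def)
    moreover have "[j..<h] = j # (j + 1) # (j + 2) # [j + 3..<h]"
      using assms(3) by (simp add: j_def upt_conv_Cons numeral_3_eq_3)
    ultimately show ?thesis by simp
  qed
  have s: "{j, j + 1, j + 2} \<subseteq> set w" using assms(2,3) by (auto simp: j_def)
  have "knuth_at p (map (position w) [i..<h]) = map (position w) [i..<j] @ knuth3 (position w j) (position w (j + 1)) (position w (j + 2)) @ map (position w) [j + 3..<h]"
    unfolding u using knuth_at_append[of "map (position w) [i..<j]"] by (simp add: j_def)
  also have "\<dots> = map (\<lambda>x. position w (dual_perm j w x)) [i..<h]"
    unfolding u position_knuth3[OF assms(1) s] by (simp add: dual_perm_id)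
  finally show ?thesis by (simp add: position_dual_word j_def)
qed

text \<open>A Knuth chain on the positions of \<open>i\<close>, ..., \<open>h - 1\<close> becomes a
  dual chain with windows among these values; moves past the end of the list are the identity and
  are dropped.\<close>

lemma knuths_position:
  assumes "distinct w" "{i..<h} \<subseteq> set w"
  shows "\<exists>js. (\<forall>j\<in>set js. i \<le> j \<and> j + 2 < h) \<and> fold knuth_at ps (map (position w) [i..<h]) = map (position (dual_words js w)) [i..<h]"
  using assms
proof (induction ps arbitrary: w)
  case Nil
  show ?case by (intro exI[of _ "[]"]) simp
next
  case (Cons p ps)
  show ?case
  proof (cases "i + p + 2 < h")
    case True
    have "distinct (dual_word (i + p) w)" "{i..<h} \<subseteq> set (dual_word (i + p) w)" using Cons.prems by (simp_all add: distinct_dual_word set_dual_word)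
    then obtain js where "\<forall>j\<in>set js. i \<le> j \<and> j + 2 < h"
      "fold knuth_at ps (map (position (dual_word (i + p) w)) [i..<h]) = map (position (dual_words js (dual_word (i + p) w))) [i..<h]"
      using Cons.IH by blast
    then show ?thesis using True knuth_at_position[OF Cons.prems True] by (intro exI[of _ "(i + p) # js"]) simp
  next
    case False
    then have "knuth_at p (map (position w) [i..<h]) = map (position w) [i..<h]" by (intro knuth_at_short) auto
    then show ?thesis using Cons.IH[OF Cons.prems] by simp
  qed
qed

lemma position_dual_words_outside: "\<forall>j\<in>set js. i \<le> j \<and> j + 2 < h \<Longrightarrow> x < i \<or> h \<le> x \<Longrightarrow> position (dual_words js w) x = position w x"
proof (induction js arbitrary: w)
  case (Cons j js)
  then have "position (dual_words js (dual_word j w)) x = position (dual_word j w) x" by auto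
  also have "\<dots> = position w x" using Cons.prems by (auto simp: position_dual_word dual_perm_id)
  finally show ?case by simp
qed simp

lemma set_dual_words: "set (dual_words js w) = set w"
  by (induction js arbitrary: w) (auto simp: set_dual_word)

text \<open>As no low letter is free, a low letter of rank \<open>a - l\<close> (from 0) is reached
  with a pending high letter after \<open>a - l\<close> matched ones. Hence the high letter of the
  same rank precedes it.\<close>

lemma matched_before:
  assumes m: "1 \<le> m" and "free_lows i m k 0 zs = []" "lows i m zs = [l..<l']" "highs i m zs = [H..<H']"
    "l \<le> a" "a < l'"
  shows "\<exists>p s. zs = p @ a # s \<and> H + (a - l) \<in> set p"
proof -
  have al: "a \<in> set (lows i m zs)" using assms(3,5,6) by simp
  then have a: "a \<in> set zs" "i \<le> a" "a \<le> i + m" by auto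
  then obtain p s where z: "zs = p @ a # s" by (meson split_list)
  have "lows i m p @ (a # lows i m s) = [l..<l']" using assms(3) z a by simp
  from upt_append_eq[OF this] have n: "length (lows i m p) = a - l"
    using upt_ConsD[of a "lows i m s" "l + length (lows i m p)" l'] by simp
  have up: "free_lows i m k 0 p = []" "free_lows i m (k + length p) (unmatched (i + m + 1) 0 (in_ivl i m p)) (a # s) = []"
    using assms(2) unfolding z free_lows_append[OF m] by simp_all
  have "unmatched (i + m + 1) 0 (in_ivl i m p) \<noteq> 0"
    using up(2) a by (auto simp: two_letter_def split: if_splits)
  then have len: "a - l < length (highs i m p)" using free_lows_count[OF m, of i k 0 p] up(1) n by simp
  have "highs i m p @ highs i m (a # s) = [H..<H']" using assms(4) z by simp
  note hp = upt_append_eq[OF this, THEN conjunct1]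
  define n where "n = length (highs i m p)"
  have "set (highs i m p) = set [H..<H + n]" using arg_cong[OF hp, of set] unfolding n_def .
  then have "H + (a - l) \<in> set (highs i m p)" using len n_def by simp
  then show ?thesis using z by auto
qed

text \<open>The positions of the letters \<open>i, \<dots>, i + 2 * m\<close> form a skew tableau with rows of lengths \<open>m\<close> (below) and
  \<open>m + 1\<close> (above) whose lower left cell is missing; the edge slides into that cell. The position \<open>u\<close> of the
  unbracketed letter is the entry that moves down.\<close>

lemma edge_dual:
  assumes m: "1 \<le> m" and d: "distinct w" and w: "w = xs @ u # ys" "i \<le> u" "u \<le> i + m"
    and ub: "free_lows i m 0 0 xs = []" "free_lows i m (Suc (length xs)) 0 ys = []"
    and lx: "lows i m xs = [i..<u]" and ly: "lows i m ys = [Suc u..<i + m + 1]"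
    and hx: "highs i m xs = [i + m + 1..<u + m + 1]" and hy: "highs i m ys = [u + m + 1..<i + 2 * m + 1]"
  shows "\<exists>js. (\<forall>j\<in>set js. i \<le> j \<and> j + 2 < i + 2 * m + 1) \<and> map (edge_cycle u m) w = dual_words js w"
proof -
  define h where "h = i + 2 * m + 1"
  \<comment> \<open>The moment when the hole stands below the position of \<open>u\<close>: the
    upper row holds the positions of the low letters, the lower row those of the high letters, with
    \<open>A\<close> below \<open>C\<close> and \<open>B\<close> to the right of the hole.\<close>
  define C D A B where "C = map (position w) [i..<u]" and "D = map (position w) [Suc u..<i + m + 1]"
    and "A = map (position w) [i + m + 1..<u + m + 1]" and "B = map (position w) [u + m + 1..<h]"
  have pp: "position w x \<noteq> 0" for x by (simp add: position_def)
  have nz: "filter (\<lambda>x. x \<noteq> 0) (map (position w) L) = map (position w) L" for L using pp by (simp add: filter_id_conv)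
  have low: "lows i m w = [i..<u] @ u # [Suc u..<i + m + 1]" using w lx ly by simp
  have hi: "filter (\<lambda>x. i \<le> x \<and> x \<le> i + 2 * m \<and> (x = u \<or> \<not> x < i + m + 1)) w =
     [i + m + 1..<u + m + 1] @ u # [u + m + 1..<h]"
  proof -
    have "filter (\<lambda>x. i \<le> x \<and> x \<le> i + 2 * m \<and> (x = u \<or> \<not> x < i + m + 1)) v = highs i m v" if "u \<notin> set v" for v
      using that by (auto intro!: filter_cong)
    then show ?thesis using w d hx hy by (simp add: h_def del: upt_Suc)
  qed
  have s1: "sorted_wrt (<) (C @ position w u # D)"
    using sorted_position_filter[OF d, of "\<lambda>x. (i \<le> x \<and> x \<le> i + 2 * m) \<and> x < i + m + 1"] low
    by (simp add: C_def D_def filter_filter del: upt_Suc)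
  have s2: "sorted_wrt (<) (A @ position w u # B)"
    using sorted_position_filter[OF d, of "\<lambda>x. i \<le> x \<and> x \<le> i + 2 * m \<and> (x = u \<or> \<not> x < i + m + 1)"] hi
    by (simp add: A_def B_def del: upt_Suc)
  have AC: "list_all2 (\<lambda>a c. a \<noteq> 0 \<longrightarrow> a < c) A C"
  proof (rule list_all2_all_nthI)
    show "length A = length C" using w by (simp add: A_def C_def del: upt_Suc)
    fix k assume "k < length A"
    then have k: "k < u - i" by (simp add: A_def del: upt_Suc)
    have "i + k < u" using k by simp
    then obtain p s where ps: "xs = p @ (i + k) # s" "i + m + 1 + k \<in> set p"
      using matched_before[OF m ub(1) lx hx, of "i + k"] by auto
    have "i + k \<notin> set p" using d unfolding w ps(1) by auto
    then have "position w (i + m + 1 + k) < position w (i + k)"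
      using position_less[OF ps(2), of "i + k" "(i + k) # s @ u # ys"] by (simp add: w ps)
    then show "A ! k \<noteq> 0 \<longrightarrow> A ! k < C ! k" using k by (simp add: A_def C_def del: upt_Suc)
  qed
  have BD: "B ! k < D ! k" if "k < length D" for k
  proof -
    have k: "k < i + m - u" using that by (simp add: D_def del: upt_Suc)
    then have "Suc u + k < i + m + 1" by simp
    then obtain p s where ps: "ys = p @ (Suc u + k) # s" "u + m + 1 + k \<in> set p"
      using matched_before[OF m ub(2) ly hy, of "Suc u + k"] by auto
    have "Suc u + k \<notin> set (xs @ u # p)" using d unfolding w ps(1) by auto
    then have "position w (u + m + 1 + k) < position w (Suc u + k)"
      using position_less[of "u + m + 1 + k" "xs @ u # p" "Suc u + k" "(Suc u + k) # s"] ps(2) by (simp add: w ps(1))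
    then show ?thesis using k w by (simp add: B_def D_def h_def del: upt_Suc)
  qed
  have "keq (C @ position w u # D @ A @ B) (C @ D @ A @ position w u # B)"
    using keq_slide_row[OF AC, of "position w u" D B] s1 s2 BD w nz
    by (simp add: A_def B_def C_def D_def h_def del: upt_Suc)
  moreover have "map (position w) [i..<h] = C @ position w u # D @ A @ B"
  proof -
    have "[i..<h] = [i..<u] @ [u..<i + m + 1] @ [i + m + 1..<u + m + 1] @ [u + m + 1..<h]"
      using w by (simp add: upt_split h_def del: upt_Suc)
    moreover have "[u..<i + m + 1] = u # [Suc u..<i + m + 1]" using w by (intro upt_conv_Cons) simp
    ultimately show ?thesis by (simp add: A_def B_def C_def D_def del: upt_Suc)
  qed
  \<comment> \<open>Relabelling moves no letter, so the list of positions is only rearranged: the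
    new low values come from the old ones without \<open>u\<close>, and \<open>u\<close> joins the
    high values behind the \<open>A\<close> part.\<close>
  moreover have "map (position (map (edge_cycle u m) w)) [i..<h] = C @ D @ A @ position w u # B"
  proof -
    have 0: "[i..<h] = [i..<u] @ [u..<i + m] @ [i + m..<u + m] @ [u + m..<h]"
      using w by (simp add: upt_split h_def del: upt_Suc)
    have 1: "map (edge_cycle u m) [i..<u] = [i..<u]" using map_edge_cycle_upt(1)[of u u m i] by simp
    have 2: "map (edge_cycle u m) [Suc u..<i + m + 1] = [u..<i + m]"
      using map_edge_cycle_upt(2)[of u "Suc u" "i + m + 1" m] w by (simp del: upt_Suc)
    have 3: "map (edge_cycle u m) [i + m + 1..<u + m + 1] = [i + m..<u + m]"
      using map_edge_cycle_upt(2)[of u "i + m + 1" "u + m + 1" m] w by (simp del: upt_Suc)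
    have 4: "edge_cycle u m u # map (edge_cycle u m) [u + m + 1..<h] = [u + m..<h]"
      using map_edge_cycle_upt(3)[of u m "u + m + 1" h] w by (simp add: edge_cycle_def upt_conv_Cons h_def del: upt_Suc)
    have "[i..<h] = map (edge_cycle u m) ([i..<u] @ [Suc u..<i + m + 1] @ [i + m + 1..<u + m + 1] @ u # [u + m + 1..<h])"
      unfolding map_append list.map 1 2 3 4 by (rule 0)
    then show ?thesis by (simp add: A_def B_def C_def D_def position_map[OF inj_edge_cycle] del: upt_Suc)
  qed
  ultimately obtain ps where ps: "map (position (map (edge_cycle u m) w)) [i..<h] = fold knuth_at ps (map (position w) [i..<h])"
    using keq_knuth_at by metis
  have sub: "{i..<h} \<subseteq> set w"
  proof
    fix x assume "x \<in> {i..<h}"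
    then have "x \<in> set (lows i m w) \<or> x \<in> set (highs i m w)"
      using low w hx hy by (auto simp: h_def simp del: upt_Suc)
    then show "x \<in> set w" by auto
  qed
  obtain js where js: "\<forall>j\<in>set js. i \<le> j \<and> j + 2 < h"
    "fold knuth_at ps (map (position w) [i..<h]) = map (position (dual_words js w)) [i..<h]"
    using knuths_position[OF d sub] by blast
  have out: "edge_cycle u m x = x" if "x \<notin> {i..<h}" for x using that w by (auto simp: edge_cycle_def h_def)
  have "map (edge_cycle u m) w = dual_words js w"
  proof (rule eq_by_position)
    show "distinct (map (edge_cycle u m) w)" using d inj_on_subset[OF inj_edge_cycle, of "set w"] by (simp add: distinct_map)
    show "distinct (dual_words js w)" using d by (simp add: distinct_dual_words)
    have "edge_cycle u m ` set w = set w"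
    proof (rule card_subset_eq[symmetric, THEN sym])
      show "edge_cycle u m ` set w \<subseteq> set w"
      proof
        fix y assume "y \<in> edge_cycle u m ` set w"
        then obtain x where x: "x \<in> set w" "y = edge_cycle u m x" by auto
        show "y \<in> set w"
        proof (cases "x \<in> {i..<h}")
          case True
          then have "y \<in> {i..<h}" using edge_cycle_in_ivl[OF w(2,3), of x] x(2) by (auto simp: h_def)
          then show ?thesis using sub by blast
        next
          case False then show ?thesis using out x by simp
        qed
      qed
      show "card (edge_cycle u m ` set w) = card (set w)" by (intro card_image inj_on_subset[OF inj_edge_cycle]) simp
    qed simp
    then show "set (map (edge_cycle u m) w) = set (dual_words js w)" by (simp add: set_dual_words)
    fix x
    show "position (map (edge_cycle u m) w) x = position (dual_words js w) x"
    proof (cases "x \<in> {i..<h}")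
      case True
      then have "x \<in> set [i..<h]" by simp
      then show ?thesis using ps js(2) by (metis map_eq_conv)
    next
      case False
      then have "position (map (edge_cycle u m) w) x = position w x" using position_map[OF inj_edge_cycle, of u m w x] out by simp
      then show ?thesis using position_dual_words_outside[OF js(1)] False by auto
    qed
  qed
  then show ?thesis using js(1) unfolding h_def by blast
qed

section \<open>Standardization and the target of an edge\<close>

definition fits :: "nat \<Rightarrow> nat list \<Rightarrow> bool" where
  "fits M la \<longleftrightarrow> length la \<le> M \<and> (\<forall>x\<in>set la. x \<le> M)"

lemma cells_box: "fits M la \<Longrightarrow> cells la \<subseteq> box M"
  unfolding fits_def cells_def box_def by (auto dest: nth_mem order_trans intro: less_le_trans)

lemma rcells_grid:
  assumes "fits M la"
  shows "rcells la = filter (\<lambda>x. x \<in> cells la) (grid M)"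
proof -
  have fc: "filter P (concat (map f rs)) = concat (map (\<lambda>r. filter P (f r)) rs)" for P and f :: "nat \<Rightarrow> cell list" and rs
    by (induction rs) auto
  have row: "filter (\<lambda>x. x \<in> cells la) (map (Pair r) [0..<M]) = (if r < length la then map (Pair r) [0..<la ! r] else [])" for r
  proof (cases "r < length la")
    case True
    then have "la ! r \<le> M" using assms unfolding fits_def by auto
    then have "[0..<M] = [0..<la ! r] @ [la ! r..<M]" by (intro upt_split[symmetric]) auto
    then show ?thesis using True by (auto simp: filter_map o_def cells_def filter_empty_conv filter_id_conv)
  qed (auto simp: cells_def filter_empty_conv)
  have "[0..<M] = [0..<length la] @ [length la..<M]"
    using assms unfolding fits_def by (intro upt_split[symmetric]) auto
  then have "filter (\<lambda>x. x \<in> cells la) (grid M) = concat (map (\<lambda>r. if r < length la then map (Pair r) [0..<la ! r] else []) (rev [length la..<M])) @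
     concat (map (\<lambda>r. if r < length la then map (Pair r) [0..<la ! r] else []) (rev [0..<length la]))"
    unfolding grid_def fc row by simp
  also have "concat (map (\<lambda>r. if r < length la then map (Pair r) [0..<la ! r] else []) (rev [length la..<M])) = []"
    by auto
  also have "map (\<lambda>r. if r < length la then map (Pair r) [0..<la ! r] else []) (rev [0..<length la]) =
    map (\<lambda>r. map (Pair r) [0..<la ! r]) (rev [0..<length la])" by (rule map_cong) auto
  finally show ?thesis unfolding rcells_def by simp
qed

lemma fits_ex: "\<exists>M0. \<forall>M\<ge>M0. fits M la"
proof -
  have "fits M la" if "length la + sum_list la \<le> M" for M
    using that member_le_sum_list[of _ la] unfolding fits_def by fastforce
  then show ?thesis by blast
qed

lemma set_rcells: "set (rcells la) = cells la"
proof -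
  obtain M where M: "fits M la" using fits_ex by blast
  then show ?thesis using rcells_grid[OF M] cells_box[OF M] by (auto simp: set_grid)
qed

lemma distinct_rcells: "distinct (rcells la)"
proof -
  obtain M where M: "fits M la" using fits_ex by blast
  then show ?thesis using rcells_grid[OF M] sorted_before_distinct[OF sorted_grid] by simp
qed

lemma row_word_reading:
  assumes "fits M la" "\<And>x. T x \<noteq> 0 \<longleftrightarrow> x \<in> cells la"
  shows "row_word la T = reading M T"
  using assms(2) unfolding row_word_def reading_eq_filter rcells_grid[OF assms(1)] by simp

lemma fill_row_word: "(\<And>x. x \<notin> cells la \<Longrightarrow> T x = 0) \<Longrightarrow> fill la (map T (rcells la)) = T"
  unfolding fill_def by (intro ext) (auto simp: map_of_zip_map set_rcells split: option.splits)

lemma row_word_fill: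
  assumes "length w = length (rcells la)"
  shows "row_word la (fill la w) = w"
proof (rule nth_equalityI)
  fix k assume "k < length (row_word la (fill la w))"
  then have k: "k < length (rcells la)" by (simp add: row_word_def)
  then show "row_word la (fill la w) ! k = w ! k"
    using map_of_zip_nth[OF assms[symmetric] distinct_rcells, of k] assms by (simp add: row_word_def fill_def)
qed (simp add: row_word_def assms)

text \<open>Standardization recovers \<open>w\<close> from its image when \<open>g\<close> is weakly
  increasing on the letters and the letters with the same image occur in increasing order.\<close>

lemma std_word_eq:
  assumes d: "distinct w" and st: "set w = {1..length w}"
    and mono: "\<And>x y. x \<in> set w \<Longrightarrow> y \<in> set w \<Longrightarrow> g x < g y \<Longrightarrow> x < y"
    and fib: "\<And>p q. p < q \<Longrightarrow> q < length w \<Longrightarrow> g (w ! p) = g (w ! q) \<Longrightarrow> w ! p < w ! q"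
  shows "std_word (map g w) = w"
proof (rule nth_equalityI)
  fix k assume "k < length (std_word (map g w))"
  then have k: "k < length w" by (simp add: std_word_def)
  have iff: "(g (w ! j) < g (w ! k) \<or> g (w ! j) = g (w ! k) \<and> j < k) \<longleftrightarrow> w ! j < w ! k" if j: "j < length w" for j
  proof
    assume "g (w ! j) < g (w ! k) \<or> g (w ! j) = g (w ! k) \<and> j < k"
    then show "w ! j < w ! k" using mono[of "w ! j" "w ! k"] fib[of j k] j k by auto
  next
    assume lt: "w ! j < w ! k"
    have "\<not> g (w ! k) < g (w ! j)" using mono[of "w ! k" "w ! j"] lt j k by auto
    moreover have "j < k" if "g (w ! j) = g (w ! k)"
      using fib[of k j] that lt j by (metis less_asym linorder_neqE_nat)
    ultimately show "g (w ! j) < g (w ! k) \<or> g (w ! j) = g (w ! k) \<and> j < k" by linarith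
  qed
  define S where "S = {j. j < length w \<and> w ! j < w ! k}"
  have "std_word (map g w) ! k = Suc (card {j. j < length w \<and> (g (w ! j) < g (w ! k) \<or> g (w ! j) = g (w ! k) \<and> j < k)})"
    using k by (simp add: std_word_def cong: conj_cong)
  also have "{j. j < length w \<and> (g (w ! j) < g (w ! k) \<or> g (w ! j) = g (w ! k) \<and> j < k)} = S"
    unfolding S_def using iff by blast
  also have "card S = card ((\<lambda>j. w ! j) ` S)"
    by (rule card_image[symmetric]) (use d in \<open>auto simp: inj_on_def S_def nth_eq_iff_index_eq\<close>)
  also have "(\<lambda>j. w ! j) ` S = {x \<in> set w. x < w ! k}"
    unfolding S_def by (auto simp: in_set_conv_nth)
  also have "\<dots> = {1..<w ! k}"
  proof -
    have "w ! k \<in> {1..length w}" using st nth_mem[OF k] by blast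
    then show ?thesis unfolding st by auto
  qed
  finally have "std_word (map g w) ! k = Suc (w ! k - 1)" by simp
  moreover have "1 \<le> w ! k" using st nth_mem[OF k] by auto
  ultimately show "std_word (map g w) ! k = w ! k" by simp
qed (simp add: std_word_def)

lemma sorted_filter_nth:
  assumes "sorted_wrt R (filter P w)" "p < q" "q < length w" "P (w ! p)" "P (w ! q)"
  shows "R (w ! p) (w ! q)"
proof -
  have w: "w = take q w @ w ! q # drop (Suc q) w" using assms(3) by (rule id_take_nth_drop)
  have "w ! p \<in> set (take q w)" using assms(2,3) by (metis in_set_conv_nth length_take min_less_iff_conj nth_take order.strict_trans)
  moreover have "sorted_wrt R (filter P (take q w) @ w ! q # filter P (drop (Suc q) w))"
    using assms(1,5) by (subst (asm) w) simp
  ultimately show ?thesis using assms(4) by (auto simp: sorted_wrt_append)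
qed

lemma std_word_edge:
  assumes m: "1 \<le> m" and w: "distinct w" "set w = {1..length w}"
    and t: "two_row i (i + m) (i + 2 * m + 1) (in_ivl i m w)"
  shows "std_word (map (\<lambda>x. if i \<le> x \<and> x < i + m then i else if i + m \<le> x \<and> x \<le> i + 2 * m then Suc i else x) w) = w"
proof (rule std_word_eq[OF w])
  let ?g = "\<lambda>x. if i \<le> x \<and> x < i + m then i else if i + m \<le> x \<and> x \<le> i + 2 * m then Suc i else x"
  show "x < y" if "?g x < ?g y" for x y using that m by (auto split: if_splits)
  fix p q assume pq: "p < q" "q < length w" "?g (w ! p) = ?g (w ! q)"
  have ne: "w ! p \<noteq> w ! q" using pq w(1) by (simp add: nth_eq_iff_index_eq)
  have lo: "sorted_wrt (<) (filter (\<lambda>x. (i \<le> x \<and> x \<le> i + 2 * m) \<and> x < i + m) w)"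
    and hi: "sorted_wrt (<) (filter (\<lambda>x. (i \<le> x \<and> x \<le> i + 2 * m) \<and> \<not> x < i + m) w)"
    using t sorted_wrt_upt[of i "i + m"] sorted_wrt_upt[of "i + m" "i + 2 * m + 1"]
    unfolding two_row_def filter_filter by (simp_all only:)
  have "(i \<le> w ! p \<and> w ! p < i + m \<and> i \<le> w ! q \<and> w ! q < i + m) \<or>
      (i + m \<le> w ! p \<and> w ! p \<le> i + 2 * m \<and> i + m \<le> w ! q \<and> w ! q \<le> i + 2 * m)"
    using pq(3) ne m by (auto split: if_splits)
  then show "w ! p < w ! q"
    using sorted_filter_nth[OF lo pq(1,2)] sorted_filter_nth[OF hi pq(1,2)] by auto
qed

text \<open>Besides the dual chain of the edge, the two-row shape of the target and its
  \<open>unmatched\<close> count are recorded: they determine the Knuth class of the result on the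
  interval, as needed to compare chains.\<close>

lemma edge_target:
  assumes la: "fits M la" and T: "std_tab 0 (cells la) T" and card: "card (cells la) = sum_list la"
    and i: "1 \<le> i" "1 \<le> m" and b: "ballot i m (in_ivl i m (reading M T))"
  shows "\<exists>c js. f_tab la i (collapse T i m) = Some c \<and> std la c = dual_tabs M js T \<and>
     (\<forall>j\<in>set js. i \<le> j \<and> j + 2 \<le> i + 2 * m) \<and>
     two_row i (i + m) (i + 2 * m + 1) (in_ivl i m (dual_words js (reading M T))) \<and> unmatched (i + m) 0 (in_ivl i m (dual_words js (reading M T))) = 1"
proof -
  define w where "w = reading M T"
  have nzT: "T x \<noteq> 0 \<longleftrightarrow> x \<in> cells la" for x using std_tab_nonzero[OF T] .
  have row_seg: "row_word la T = w" unfolding w_def by (rule row_word_reading[OF la nzT])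
  have dual_word: "distinct w" unfolding w_def by (rule std_tab_distinct_reading[OF T])
  have sw: "set w = {1..sum_list la}" using std_tab_set_reading[OF T cells_box[OF la]] card unfolding w_def by simp
  then have lw: "length w = sum_list la" using distinct_card[OF dual_word] by simp
  obtain xs u ys where X: "w = xs @ u # ys" "i \<le> u" "u \<le> i + m" "free_lows i m 0 0 w = [length xs]"
    "free_lows i m 0 0 xs = []" "free_lows i m (Suc (length xs)) 0 ys = []"
    "lows i m xs = [i..<u]" "lows i m ys = [Suc u..<i + m + 1]"
    "highs i m xs = [i + m + 1..<u + m + 1]" "highs i m ys = [u + m + 1..<i + 2 * m + 1]"
    "unmatched (i + m + 1) 0 (in_ivl i m xs) = 0" "unmatched (i + m + 1) 0 (in_ivl i m ys) = 0"
    by (rule ballot_split[OF i(2) b[folded w_def]], rule that) assumption+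
  define w' where "w' = map (edge_cycle u m) w"
  have tr: "two_row i (i + m) (i + 2 * m + 1) (in_ivl i m w')" "unmatched (i + m) 0 (in_ivl i m w') = 1"
    using ballot_edge[OF i(2) X(1-3,6-12)] unfolding w'_def by auto
  obtain js where js: "\<forall>j\<in>set js. i \<le> j \<and> j + 2 < i + 2 * m + 1" "w' = dual_words js w"
    using edge_dual[OF i(2) dual_word X(1-3,5-10)] unfolding w'_def by blast
  define g where "g = (\<lambda>x. if i \<le> x \<and> x < i + m then i else if i + m \<le> x \<and> x \<le> i + 2 * m then Suc i else x)"
  define b' where "b' = (map (two_letter i m) w)[length xs := Suc i]"
  \<comment> \<open>Collapsing the source and collapsing the target, whose threshold is lower by
    one, agree except at \<open>u\<close>. There the difference is the change from i to i + 1 made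
    by the crystal operator.\<close>
  have cg: "two_letter i m x = g (edge_cycle u m x)" if "x \<noteq> u" for x
    using that X(2,3) unfolding g_def two_letter_def edge_cycle_def by (simp split: if_split) linarith
  have nx: "u \<notin> set xs" "u \<notin> set ys" using dual_word X(1) by auto
  have "b' = map (two_letter i m) xs @ Suc i # map (two_letter i m) ys" unfolding b'_def X(1) by (simp add: list_update_append)
  also have "map (two_letter i m) xs = map (\<lambda>x. g (edge_cycle u m x)) xs"
    by (rule map_cong[OF refl], rule cg) (use nx in metis)
  also have "map (two_letter i m) ys = map (\<lambda>x. g (edge_cycle u m x)) ys"
    by (rule map_cong[OF refl], rule cg) (use nx in metis)
  also have "Suc i = g (edge_cycle u m u)" using X(2,3) i(2) by (simp add: edge_cycle_def g_def)
  finally have b': "b' = map g w'" unfolding w'_def X(1) by simp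
  have w'p: "distinct w'" "set w' = {1..length w'}"
    using dual_word sw lw js(2) by (simp_all add: distinct_dual_words set_dual_words) (simp add: w'_def js(2)[symmetric])
  have std: "std_word b' = w'" unfolding b' g_def by (rule std_word_edge[OF i(2) w'p tr(1)])
  have two_letter: "row_word la (collapse T i m) = map (two_letter i m) w"
    unfolding row_seg[symmetric] row_word_def by (simp add: collapse_def two_letter_def o_def)
  have f: "f_tab la i (collapse T i m) = Some (fill la b')"
    unfolding f_tab_def f_word_def two_letter X(4) b'_def by simp
  have len: "length b' = length (rcells la)" unfolding b'_def row_seg[symmetric] by (simp add: row_word_def)
  have "row_word la (dual_tabs M js T) = w'"
  proof -
    have "dual_tabs M js T x \<noteq> 0 \<longleftrightarrow> x \<in> cells la" for x
      using std_tab_nonzero[OF std_tab_dual_tabs[OF T cells_box[OF la]]] .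
    from row_word_reading[OF la this] show ?thesis unfolding reading_dual_tabs js(2) w_def by simp
  qed
  then have "std la (fill la b') = dual_tabs M js T"
    unfolding std_def row_word_fill[OF len] std unfolding row_word_def
    using fill_row_word[of la "dual_tabs M js T"] stabD(5)[OF std_tab_dual_tabs[OF T cells_box[OF la]]] by metis
  then show ?thesis using f js(1) tr unfolding js(2) w_def by (intro exI[of _ "fill la b'"] exI[of _ js]) auto
qed

section \<open>Standard tableaux of partition shape\<close>

lemma partition_downset:
  assumes "is_partition la"
  shows "downset (cells la)"
  unfolding downset_def
proof (intro ballI allI impI)
  fix y x assume y: "y \<in> cells la" and le: "cell_le x y"
  obtain r c r' c' where xy: "x = (r, c)" "y = (r', c')" by (cases x; cases y)
  have h: "r \<le> r'" "c \<le> c'" "r' < length la" "c' < la ! r'" using y le unfolding xy by (auto simp: cell_le_def cells_def)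
  have "la ! r' \<le> la ! r" using assms h(1,3) unfolding is_partition_def by (metis sorted_rev_nth_mono)
  then show "x \<in> cells la" using h unfolding xy cells_def by auto
qed

lemma SYT_std_tab:
  assumes p: "is_partition la" and T: "T \<in> SYT la"
  shows "std_tab 0 (cells la) T" "card (cells la) = sum_list la"
proof -
  have bij: "bij_betw T (cells la) {1..sum_list la}" and out: "\<forall>x. x \<notin> cells la \<longrightarrow> T x = 0"
    and row: "\<And>r c. (r, Suc c) \<in> cells la \<Longrightarrow> T (r, c) < T (r, Suc c)"
    and colm: "\<And>r c. (Suc r, c) \<in> cells la \<Longrightarrow> T (r, c) < T (Suc r, c)"
    using T unfolding SYT_def by auto
  show card: "card (cells la) = sum_list la" using bij_betw_same_card[OF bij] by simp
  have fin: "finite (cells la)" using bij_betw_finite[OF bij] by simp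
  note dn = partition_downset[OF p]
  have rows: "(r, c + k) \<in> cells la \<Longrightarrow> T (r, c) \<le> T (r, c + k) \<and> (0 < k \<longrightarrow> T (r, c) < T (r, c + k))" for r c k
  proof (induction k)
    case (Suc k)
    then have "(r, c + k) \<in> cells la" using downsetD[OF dn, of "(r, c + Suc k)"] by (auto simp: cell_le_def)
    then show ?case using Suc row[of r "c + k"] by auto
  qed simp
  have cols: "(r + k, c) \<in> cells la \<Longrightarrow> T (r, c) \<le> T (r + k, c) \<and> (0 < k \<longrightarrow> T (r, c) < T (r + k, c))" for r c k
  proof (induction k)
    case (Suc k)
    then have "(r + k, c) \<in> cells la" using downsetD[OF dn, of "(r + Suc k, c)"] by (auto simp: cell_le_def)
    then show ?case using Suc colm[of "r + k" c] by auto
  qed simp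
  have "T x < T y" if xy: "x \<in> cells la" "y \<in> cells la" "cell_le x y" "x \<noteq> y" for x y
  proof -
    obtain r c r' c' where e: "x = (r, c)" "y = (r', c')" by (cases x; cases y)
    define k l where "k = r' - r" and "l = c' - c"
    have kl: "r' = r + k" "c' = c + l" "0 < k \<or> 0 < l" using xy(3,4) unfolding e k_def l_def cell_le_def by auto
    have "(r, c + l) \<in> cells la" using downsetD[OF dn xy(2), of "(r, c + l)"] kl by (auto simp: e cell_le_def)
    then have "T (r, c) \<le> T (r, c + l) \<and> (0 < l \<longrightarrow> T (r, c) < T (r, c + l))" by (rule rows)
    moreover have "T (r, c + l) \<le> T (r + k, c + l) \<and> (0 < k \<longrightarrow> T (r, c + l) < T (r + k, c + l))"
      using cols[of r k "c + l"] xy(2) kl e by simp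
    ultimately show ?thesis using kl unfolding e by auto
  qed
  then show "std_tab 0 (cells la) T" using bij out fin dn card unfolding std_tab_def by auto
qed

lemma std_tab_SYT: "std_tab 0 (cells la) T \<Longrightarrow> card (cells la) = sum_list la \<Longrightarrow> T \<in> SYT la"
proof -
  assume s: "std_tab 0 (cells la) T" and c: "card (cells la) = sum_list la"
  note S = stabD[OF s]
  have "T (r, c) < T (r, Suc c)" if "(r, Suc c) \<in> cells la" for r c
    using S(6)[of "(r, c)" "(r, Suc c)"] downsetD[OF S(2) that, of "(r, c)"] that by (auto simp: cell_le_def)
  moreover have "T (r, c) < T (Suc r, c)" if "(Suc r, c) \<in> cells la" for r c
    using S(6)[of "(r, c)" "(Suc r, c)"] downsetD[OF S(2) that, of "(r, c)"] that by (auto simp: cell_le_def)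
  ultimately show ?thesis using s c unfolding SYT_def std_tab_def by auto
qed

lemma dyck_ballot: "distinct w \<Longrightarrow> dyck_interval w i m \<longleftrightarrow> 1 \<le> m \<and> 1 \<le> i \<and> i + 2 * m \<le> length w \<and> ballot i m (in_ivl i m w)"
  unfolding dyck_interval_def using ballot_iff_rsk[of "in_ivl i m w" m i] by auto

section \<open>Restriction to an interval of values\<close>

lemma dual_perm_in_ivl: "a \<le> j \<Longrightarrow> j + 2 \<le> b \<Longrightarrow> (a \<le> dual_perm j w x \<and> dual_perm j w x \<le> b) \<longleftrightarrow> (a \<le> x \<and> x \<le> b)"
  by (cases rule: dual_perm_cases[of j w]) (auto simp: adj_swap_def)

lemma dual_perm_filter:
  assumes "a \<le> j" "j + 2 \<le> b"
  shows "dual_perm j (filter (\<lambda>x. a \<le> x \<and> x \<le> b) w) = dual_perm j w"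
proof -
  have "(\<lambda>x. (a \<le> x \<and> x \<le> b) \<and> j \<le> x \<and> x \<le> j + 2) = (\<lambda>x. j \<le> x \<and> x \<le> j + 2)" using assms by auto
  then show ?thesis unfolding dual_perm_def filter_filter by simp
qed

lemma dual_word_filter:
  assumes "a \<le> j" "j + 2 \<le> b"
  shows "filter (\<lambda>x. a \<le> x \<and> x \<le> b) (dual_word j w) = dual_word j (filter (\<lambda>x. a \<le> x \<and> x \<le> b) w)"
  unfolding dual_word_def dual_perm_filter[OF assms] by (simp add: filter_map o_def dual_perm_in_ivl[OF assms])

lemma dual_words_filter:
  "\<forall>j\<in>set js. a \<le> j \<and> j + 2 \<le> b \<Longrightarrow>
    filter (\<lambda>x. a \<le> x \<and> x \<le> b) (dual_words js w) = dual_words js (filter (\<lambda>x. a \<le> x \<and> x \<le> b) w)"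
  by (induction js arbitrary: w) (auto simp: dual_word_filter)

lemma dual_tabs_outside:
  assumes "\<forall>j\<in>set js. a \<le> j \<and> j + 2 \<le> b"
  shows "((a \<le> dual_tabs M js T x \<and> dual_tabs M js T x \<le> b) \<longleftrightarrow> (a \<le> T x \<and> T x \<le> b)) \<and>
    (\<not> (a \<le> T x \<and> T x \<le> b) \<longrightarrow> dual_tabs M js T x = T x)"
  using assms
proof (induction js arbitrary: T)
  case (Cons j js)
  have j: "a \<le> j" "j + 2 \<le> b" using Cons.prems by auto
  have "(a \<le> dual_tab M j T x \<and> dual_tab M j T x \<le> b) \<longleftrightarrow> (a \<le> T x \<and> T x \<le> b)"
    unfolding dual_tab_def by (rule dual_perm_in_ivl[OF j])
  moreover have "dual_tab M j T x = T x" if "\<not> (a \<le> T x \<and> T x \<le> b)"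
    unfolding dual_tab_def by (rule dual_perm_id) (use that j in linarith)
  moreover have "((a \<le> dual_tabs M js (dual_tab M j T) x \<and> dual_tabs M js (dual_tab M j T) x \<le> b) \<longleftrightarrow> (a \<le> dual_tab M j T x \<and> dual_tab M j T x \<le> b)) \<and>
    (\<not> (a \<le> dual_tab M j T x \<and> dual_tab M j T x \<le> b) \<longrightarrow> dual_tabs M js (dual_tab M j T) x = dual_tab M j T x)"
    using Cons.prems by (intro Cons.IH) simp
  ultimately show ?case by simp
qed simp

text \<open>The subword sees all cells with entries in [a, b], and both chains fix the other
  cells.\<close>

lemma dual_tabs_eq_by_words:
  assumes a: "1 \<le> a" and js: "\<forall>j\<in>set js. a \<le> j \<and> j + 2 \<le> b" "\<forall>j\<in>set js'. a \<le> j \<and> j + 2 \<le> b"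
    and T: "\<And>x. T x \<noteq> 0 \<Longrightarrow> x \<in> box M"
    and eq: "dual_words js (filter (\<lambda>x. a \<le> x \<and> x \<le> b) (reading M T)) = dual_words js' (filter (\<lambda>x. a \<le> x \<and> x \<le> b) (reading M T))"
  shows "dual_tabs M js T = dual_tabs M js' T"
proof
  fix x
  let ?P = "\<lambda>x. a \<le> x \<and> x \<le> b"
  have w: "dual_words ks (filter ?P (reading M T)) = map (dual_tabs M ks T) (filter (\<lambda>x. ?P (T x)) (grid M))"
    if ks: "\<forall>j\<in>set ks. a \<le> j \<and> j + 2 \<le> b" for ks
  proof -
    have "dual_words ks (filter ?P (reading M T)) = filter ?P (reading M (dual_tabs M ks T))" by (simp add: dual_words_filter[OF ks] reading_dual_tabs)
    also have "\<dots> = map (dual_tabs M ks T) (filter (\<lambda>x. ?P (dual_tabs M ks T x)) (grid M))" using a by (intro filter_reading) simp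
    finally show ?thesis using dual_tabs_outside[OF ks] by simp
  qed
  show "dual_tabs M js T x = dual_tabs M js' T x"
  proof (cases "?P (T x)")
    case False
    then show ?thesis using dual_tabs_outside[OF js(1), of M T x] dual_tabs_outside[OF js(2), of M T x] by simp
  next
    case True
    then have "x \<in> set (filter (\<lambda>x. ?P (T x)) (grid M))" using T[of x] a by (simp add: set_grid)
    moreover have "map (dual_tabs M js T) (filter (\<lambda>x. ?P (T x)) (grid M)) = map (dual_tabs M js' T) (filter (\<lambda>x. ?P (T x)) (grid M))"
      using eq unfolding w[OF js(1)] w[OF js(2)] .
    ultimately show ?thesis unfolding map_eq_conv by blast
  qed
qed

section \<open>Shifting all entries\<close>

definition shift :: "nat \<Rightarrow> filling \<Rightarrow> filling" where
  "shift s U = (\<lambda>x. if U x = 0 then 0 else U x + s)"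

lemma shift_nonzero: "shift s U x \<noteq> 0 \<longleftrightarrow> U x \<noteq> 0"
  by (simp add: shift_def)

lemma reading_shift: "reading M (shift s U) = map (\<lambda>x. x + s) (reading M U)"
  unfolding reading_eq_filter[of M "shift s U"] shift_nonzero unfolding reading_eq_filter[of M U] map_map
  by (rule map_cong) (auto simp: shift_def)

lemma std_tab_shift:
  assumes "std_tab 0 D U"
  shows "std_tab s D (shift s U)"
proof -
  note S = stabD[OF assms]
  have e: "shift s U x = U x + s" if "x \<in> D" for x
    using std_tab_nonzero[OF assms, of x] that unfolding shift_def by metis
  have "bij_betw ((\<lambda>x. x + s) \<circ> U) D {s + 1..s + card D}"
  proof (rule bij_betw_trans)
    show "bij_betw U D {1..card D}" using assms unfolding std_tab_def by simp
    show "bij_betw (\<lambda>x. x + s) {1..card D} {s + 1..s + card D}"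
      by (rule bij_betw_byWitness[where f' = "\<lambda>x. x - s"]) auto
  qed
  then have "bij_betw (shift s U) D {s + 1..s + card D}" using bij_betw_cong[of D "shift s U" "(\<lambda>x. x + s) \<circ> U"] e by simp
  then show ?thesis using S e unfolding std_tab_def by (auto simp: shift_def)
qed

lemma inj_shift: "inj (shift s)"
proof (rule injI)
  fix U V assume h: "shift s U = shift s V"
  show "U = V"
  proof
    fix x
    show "U x = V x" using fun_cong[OF h, of x] by (auto simp: shift_def split: if_splits)
  qed
qed

lemma dual_select_shift: "dual_select (j + s) (map (\<lambda>x. x + s) f) (x + s) = dual_select j f x + s"
proof -
  have e: "map (\<lambda>x. x + s) f = [p + s, q + s, r + s] \<longleftrightarrow> f = [p, q, r]" for p q r
    by (auto simp: map_eq_Cons_conv)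
  have "(map (\<lambda>x. x + s) f = [j + s + 1, j + s, j + s + 2]) = (f = [j + 1, j, j + 2])"
    "(map (\<lambda>x. x + s) f = [j + s + 2, j + s, j + s + 1]) = (f = [j + 2, j, j + 1])"
    "(map (\<lambda>x. x + s) f = [j + s, j + s + 2, j + s + 1]) = (f = [j, j + 2, j + 1])"
    "(map (\<lambda>x. x + s) f = [j + s + 1, j + s + 2, j + s]) = (f = [j + 1, j + 2, j])"
    using e[of "j + 1" j "j + 2"] e[of "j + 2" j "j + 1"] e[of j "j + 2" "j + 1"] e[of "j + 1" "j + 2" j]
    by (simp_all add: add_ac)
  then show ?thesis unfolding dual_select_def by (simp add: adj_swap_def)
qed

lemma filter_shift: "filter (\<lambda>x. a + s \<le> x \<and> x \<le> b + s) (map (\<lambda>x. x + s) w) = map (\<lambda>x. x + s) (filter (\<lambda>x. a \<le> x \<and> x \<le> b) w)"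
  for a b s :: nat
  by (simp add: filter_map o_def)

lemma dual_perm_shift: "dual_perm (j + s) (map (\<lambda>x. x + s) w) (x + s) = dual_perm j w x + s"
proof -
  have "j + s + 2 = j + 2 + s" by simp
  then show ?thesis unfolding dual_perm_def by (simp only: filter_shift dual_select_shift)
qed

lemma dual_word_shift: "dual_word (j + s) (map (\<lambda>x. x + s) w) = map (\<lambda>x. x + s) (dual_word j w)"
  by (simp add: dual_word_def dual_perm_shift)

lemma dual_words_shift: "dual_words (map (\<lambda>j. j + s) js) (map (\<lambda>x. x + s) w) = map (\<lambda>x. x + s) (dual_words js w)"
  by (induction js arbitrary: w) (auto simp: dual_word_shift)

lemma dual_tab_shift: "shift s (dual_tab M j U) = dual_tab M (j + s) (shift s U)"
proof
  fix x
  show "shift s (dual_tab M j U) x = dual_tab M (j + s) (shift s U) x"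
  proof (cases "U x = 0")
    case True
    then have "dual_tab M j U x = 0" "dual_tab M (j + s) (shift s U) x = 0" using dual_tab_nonzero shift_nonzero by blast+
    then show ?thesis by (simp add: shift_def)
  next
    case False
    then show ?thesis using dual_perm_shift[of j s "reading M U" "U x"] dual_perm_zero[of j M U "U x"]
      by (simp add: shift_def dual_tab_def reading_shift[unfolded shift_def])
  qed
qed

lemma dual_tabs_shift: "shift s (dual_tabs M js U) = dual_tabs M (map (\<lambda>j. j + s) js) (shift s U)"
  by (induction js arbitrary: U) (auto simp: dual_tab_shift)

lemma unmatched_shift: "unmatched (A + s) c (map (\<lambda>x. x + s) v) = unmatched A c v"
  by (induction v arbitrary: c) auto

lemma two_row_shift: "two_row l A h v \<Longrightarrow> two_row (l + s) (A + s) (h + s) (map (\<lambda>x. x + s) v)"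
proof -
  have u: "map (\<lambda>x. x + s) [l..<h] = [l + s..<h + s]" for l h :: nat
    by (rule nth_equalityI) auto
  assume "two_row l A h v"
  then show ?thesis unfolding two_row_def by (simp add: filter_map o_def u)
qed

lemma ballot_shift: "ballot i m v \<Longrightarrow> ballot (i + s) m (map (\<lambda>x. x + s) v)"
  using two_row_shift[of i "i + m + 1" "i + 2 * m + 1" v s] unmatched_shift[of "i + m + 1" s 0 v]
  unfolding ballot_def by (simp add: add_ac)

text \<open>The insertion tableau of a Dyck pattern. It is the straight tableau that
  \<open>dual_words_eqI\<close> needs for the words in a Dyck pattern interval.\<close>

definition two_row_tab :: "nat \<Rightarrow> nat \<Rightarrow> filling" where
  "two_row_tab i m = (\<lambda>(r, c). if r = 0 \<and> c \<le> m then i + c else if r = 1 \<and> c < m then i + m + 1 + c else 0)"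

lemma std_tab_two_row_tab:
  assumes "1 \<le> i"
  shows "std_tab (i - 1) ({0} \<times> {..m} \<union> {1} \<times> {..<m}) (two_row_tab i m)"
proof -
  let ?D = "{0} \<times> {..m} \<union> {1} \<times> {..<m} :: cell set"
  let ?V = "two_row_tab i m"
  have c: "card ?D = 2 * m + 1"
    by (subst card_Un_disjoint) auto
  have "inj_on ?V ?D" by (auto simp: inj_on_def two_row_tab_def)
  moreover have "?V ` ?D = {i..i + 2 * m}"
  proof
    show "?V ` ?D \<subseteq> {i..i + 2 * m}" by (auto simp: two_row_tab_def)
    show "{i..i + 2 * m} \<subseteq> ?V ` ?D"
    proof
      fix x assume x: "x \<in> {i..i + 2 * m}"
      show "x \<in> ?V ` ?D"
      proof (cases "x \<le> i + m")
        case True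
        then show ?thesis using x by (intro image_eqI[of _ _ "(0, x - i)"]) (auto simp: two_row_tab_def)
      next
        case False
        then show ?thesis using x by (intro image_eqI[of _ _ "(1, x - (i + m + 1))"]) (auto simp: two_row_tab_def)
      qed
    qed
  qed
  moreover have "{i - 1 + 1..i - 1 + card ?D} = {i..i + 2 * m}" using assms c by auto
  ultimately have "bij_betw ?V ?D {i - 1 + 1..i - 1 + card ?D}" unfolding bij_betw_def by simp
  moreover have "downset ?D" by (auto simp: downset_def cell_le_def)
  moreover have "?V x = 0" if "x \<notin> ?D" for x using that by (cases x) (auto simp: two_row_tab_def)
  moreover have "?V x < ?V y" if "x \<in> ?D" "y \<in> ?D" "cell_le x y" "x \<noteq> y" for x y
    using that by (auto simp: two_row_tab_def cell_le_def)
  ultimately show ?thesis unfolding std_tab_def by auto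
qed

lemma reading_two_row_tab:
  assumes "1 \<le> i" "m < M" "2 \<le> M"
  shows "reading M (two_row_tab i m) = [i + m + 1..<i + 2 * m + 1] @ [i..<i + m + 1]"
proof -
  let ?V = "two_row_tab i m"
  have "row_seg ?V r 0 M = []" if "1 < r" for r using that by (auto simp: row_seg_def two_row_tab_def filter_empty_conv)
  then have z: "concat (map (\<lambda>r. row_seg ?V r 0 M) (rev [Suc (Suc 0)..<M])) = []" by auto
  have "row_seg ?V 0 0 M = row_seg ?V 0 0 (Suc m) @ row_seg ?V 0 (Suc m) M" using assms by (intro row_seg_split) auto
  also have "row_seg ?V 0 (Suc m) M = []" by (auto simp: row_seg_def two_row_tab_def filter_empty_conv)
  also have "row_seg ?V 0 0 (Suc m) = map (\<lambda>c. ?V (0, c)) [0..<Suc m]"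
    unfolding row_seg_def using assms by (auto simp: filter_id_conv two_row_tab_def simp del: upt_Suc)
  also have "\<dots> = [i..<i + m + 1]" by (rule nth_equalityI) (auto simp: two_row_tab_def simp del: upt_Suc)
  finally have r0: "row_seg ?V 0 0 M = [i..<i + m + 1]" by simp
  have "row_seg ?V 1 0 M = row_seg ?V 1 0 m @ row_seg ?V 1 m M" using assms by (intro row_seg_split) auto
  also have "row_seg ?V 1 m M = []" by (auto simp: row_seg_def two_row_tab_def filter_empty_conv)
  also have "row_seg ?V 1 0 m = map (\<lambda>c. ?V (1, c)) [0..<m]"
    unfolding row_seg_def using assms by (auto simp: filter_id_conv two_row_tab_def)
  also have "\<dots> = [i + m + 1..<i + 2 * m + 1]" by (rule nth_equalityI) (auto simp: two_row_tab_def simp del: upt_Suc)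
  finally have r1: "row_seg ?V 1 0 M = [i + m + 1..<i + 2 * m + 1]" by simp
  have "reading M ?V = row_seg ?V 1 0 M @ row_seg ?V 0 0 M" using reading_split_rows[of 0 M ?V] z assms(3) by simp
  then show ?thesis unfolding r0 r1 .
qed

text \<open>The dual equivalences realising an edge are forced by the two-row tableaux before and after it, so
  Knuth equivalent words may use the same ones.\<close>

lemma edge_uniform:
  assumes i: "1 \<le> i" "1 \<le> m" and M: "m < M" "2 \<le> M"
    and b: "ballot i m v" "ballot i m w"
    and v: "two_row i (i + m) (i + 2 * m + 1) (dual_words js v)" "unmatched (i + m) 0 (dual_words js v) = 1"
    and w: "two_row i (i + m) (i + 2 * m + 1) (dual_words js' w)" "unmatched (i + m) 0 (dual_words js' w) = 1"
  shows "dual_words js w = dual_words js' w"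
proof (rule dual_words_eqI[OF std_tab_two_row_tab[OF i(1)]])
  show "{0} \<times> {..m} \<union> {1} \<times> {..<m} \<subseteq> box M" using M by (auto simp: box_def)
  have bk: "keq x y" if "ballot i m x" "ballot i m y" for x y
    using that unfolding ballot_def by (intro two_row_keqI[of i "i + m + 1" "i + 2 * m + 1"]) auto
  show "keq (reading M (two_row_tab i m)) w"
    unfolding reading_two_row_tab[OF i(1) M] by (rule bk[OF ballot_canonical b(2)])
  have "keq (dual_words js w) (dual_words js v)"
    using b(2) unfolding ballot_def by (intro keq_dual_words bk b two_row_distinct) auto
  also have "keq (dual_words js v) (dual_words js' w)"
    using v w by (intro two_row_keqI[of i "i + m" "i + 2 * m + 1"]) auto
  finally show "keq (dual_words js w) (dual_words js' w)" .
qed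

section \<open>The embedding of crystal skeletons\<close>

lemma skew_restrict:
  assumes "std_tab 0 D T" "1 \<le> a"
  shows "skew (restrict_tab T a b)"
proof -
  note S = stabD[OF assms(1)]
  have nz: "restrict_tab T a b x \<noteq> 0 \<longleftrightarrow> a \<le> T x \<and> T x \<le> b" for x using assms(2) by (auto simp: restrict_tab_def)
  have D: "x \<in> D" if "a \<le> T x" for x using S(5)[of x] that assms(2) by force
  have "increasing (restrict_tab T a b)"
    unfolding increasing_def nz using S(6) D by (auto simp: restrict_tab_def)
  moreover have "convex_off {} (restrict_tab T a b)"
    unfolding convex_off_def nz
  proof (intro allI impI)
    fix x y z assume x: "a \<le> T x \<and> T x \<le> b" and y: "a \<le> T y \<and> T y \<le> b" and le: "cell_le x z" "cell_le z y"
    have z: "z \<in> D" using downsetD[OF S(2) _ le(2)] D y by blast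
    have "T x \<le> T z" "T z \<le> T y"
      using S(6)[of x z] S(6)[of z y] D[of x] D[of y] x y z le by (metis less_imp_le order_refl)+
    then show "a \<le> T z \<and> T z \<le> b" using x y by auto
  qed
  ultimately show ?thesis unfolding skew_def by simp
qed

lemma reading_restrict: "1 \<le> a \<Longrightarrow> reading M (restrict_tab T a b) = filter (\<lambda>x. a \<le> x \<and> x \<le> b) (reading M T)"
proof -
  assume a: "1 \<le> a"
  have nz: "restrict_tab T a b x \<noteq> 0 \<longleftrightarrow> a \<le> T x \<and> T x \<le> b" for x using a by (auto simp: restrict_tab_def)
  have "reading M (restrict_tab T a b) = map T (filter (\<lambda>x. a \<le> T x \<and> T x \<le> b) (grid M))"
    unfolding reading_eq_filter[of M "restrict_tab T a b"] nz by (rule map_cong) (auto simp: restrict_tab_def)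
  also have "\<dots> = filter (\<lambda>x. a \<le> x \<and> x \<le> b) (reading M T)" using a by (intro filter_reading[symmetric]) simp
  finally show ?thesis .
qed

theorem theorem4p7:
  fixes la mu :: "nat list" and T R :: filling and a b N :: nat
  assumes "is_partition la" and "N = sum_list la" and "T \<in> SYT la"
    and "1 \<le> a" and "a \<le> b" and "b \<le> N"
    and "rectification (restrict_tab T a b) R"
    and "is_partition mu" and "cells mu = {x. R x \<noteq> 0}"
  shows "\<exists>\<phi>. inj_on \<phi> (SYT mu) \<and> \<phi> ` SYT mu \<subseteq> SYT la \<and>
     (\<forall>U I U'. cs_edge mu U I U' \<longrightarrow>
        cs_edge la (\<phi> U) ((\<lambda>x. x + (a - 1)) ` I) (\<phi> U'))"
proof -
  let ?P = "\<lambda>x. a \<le> x \<and> x \<le> b"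
  let ?F = "filter ?P"
  obtain M1 M2 where M12: "\<forall>M\<ge>M1. fits M la" "\<forall>M\<ge>M2. fits M mu" using fits_ex by meson
  \<comment> \<open>The square holds both shapes; the summand N + 2 also makes room for the two-row
    tableau of any Dyck pattern interval.\<close>
  define M where "M = M1 + M2 + N + 2"
  have fl: "fits M la" and fm: "fits M mu" using M12 by (auto simp: M_def)
  define s where "s = a - 1"
  define D where "D = cells mu"
  have as: "s + 1 = a" using assms(4) by (simp add: s_def)
  note T = SYT_std_tab[OF assms(1,3)]
  have bl: "cells la \<subseteq> box M" and bm: "D \<subseteq> box M" using cells_box fl fm D_def by auto
  have wT: "set (reading M T) = {1..N}" "distinct (reading M T)"
    using std_tab_set_reading[OF T(1) bl] std_tab_distinct_reading[OF T(1)] T(2) assms(2) by auto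
  have nzT: "x \<in> box M" if "T x \<noteq> 0" for x using std_tab_nonzero[OF T(1)] bl that by blast
  have R: "keq (?F (reading M T)) (reading M R)" "skew R"
  proof -
    have "\<forall>x. restrict_tab T a b x \<noteq> 0 \<longrightarrow> x \<in> box M" using nzT by (simp add: restrict_tab_def)
    from jdt_slides_keq[OF _ skew_restrict[OF T(1) assms(4)] this] assms(7)
    show "keq (?F (reading M T)) (reading M R)" "skew R"
      unfolding rectification_def reading_restrict[OF assms(4)] by auto
  qed
  have RD: "R x \<noteq> 0 \<longleftrightarrow> x \<in> D" for x using assms(9) D_def by auto
  have dF: "distinct (?F (reading M T))" using wT(2) by simp
  have sF: "set (?F (reading M T)) = {a..b}" using wT(1) assms(4-6) by auto
  have imR: "R ` D = {a..b}"
  proof -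
    have "{x \<in> box M. R x \<noteq> 0} = D" using RD bm by auto
    then show ?thesis using set_reading[of M R] keq_mset[OF R(1)] sF by simp
  qed
  have injR: "inj_on R D"
  proof -
    have "distinct (map R (filter (\<lambda>x. R x \<noteq> 0) (grid M)))"
      using keq_mset[OF R(1)] dF unfolding reading_eq_filter by simp
    moreover have "set (filter (\<lambda>x. R x \<noteq> 0) (grid M)) = D" using RD bm by (auto simp: set_grid)
    ultimately show ?thesis by (simp add: distinct_map)
  qed
  have cD: "card D = b + 1 - a" using card_image[OF injR] imR by simp
  have nab: "s + card D = b" using cD as assms(5) by simp
  \<comment> \<open>Slides keep the filling skew, and Knuth equivalence keeps the letters a, ..., b,
    each once; on the downset \<open>D\<close> this makes \<open>R\<close> standard.\<close>
  have stR: "std_tab s D R"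
  proof -
    have "finite D" using bm by (rule finite_subset) (simp add: box_def)
    moreover have "downset D" unfolding D_def by (rule partition_downset[OF assms(8)])
    moreover have "bij_betw R D {s + 1..s + card D}" unfolding as nab bij_betw_def using injR imR by simp
    ultimately show ?thesis using R(2) RD unfolding std_tab_def skew_def increasing_def by auto
  qed
  define ok where "ok js \<longleftrightarrow> (\<forall>j\<in>set js. a \<le> j \<and> j + 2 \<le> b)" for js
  have sU: "std_tab s D (shift s U)" "std_tab 0 D U" if "U \<in> SYT mu" for U
    using SYT_std_tab[OF assms(8) that] std_tab_shift D_def by auto
  have "\<exists>js. ok js \<and> shift s U = dual_tabs M js R" if "U \<in> SYT mu" for U
    using std_tab_connected[OF stR sU(1)[OF that] bm] as nab unfolding ok_def by fastforce
  then obtain J where J: "\<And>U. U \<in> SYT mu \<Longrightarrow> ok (J U)" "\<And>U. U \<in> SYT mu \<Longrightarrow> shift s U = dual_tabs M (J U) R"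
    by metis
  \<comment> \<open>The chain \<open>J U\<close> is an arbitrary choice; by \<open>uniq\<close>
    below, any admissible chain with a Knuth equivalent result on [a, b] gives the same
    tableau.\<close>
  define \<phi> where "\<phi> U = dual_tabs M (J U) T" for U
  have st: "std_tab 0 (cells la) (dual_tabs M js T)" for js by (rule std_tab_dual_tabs[OF T(1) bl])
  have Fdts: "?F (reading M (dual_tabs M js T)) = dual_words js (?F (reading M T))" if "ok js" for js
    using dual_words_filter[of js a b "reading M T"] that unfolding ok_def reading_dual_tabs by simp
  \<comment> \<open>In terms of words: the part of \<open>\<phi> U\<close> in [a, b] rectifies to
    \<open>U\<close> with its entries shifted.\<close>
  have key: "keq (?F (reading M (\<phi> U))) (reading M (shift s U))" if "U \<in> SYT mu" for U
    unfolding \<phi>_def Fdts[OF J(1)[OF that]] J(2)[OF that] unfolding reading_dual_tabs by (rule keq_dual_words[OF R(1) dF])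
  have uniq: "dual_tabs M js T = dual_tabs M js' T"
    if "ok js" "ok js'" "keq (?F (reading M (dual_tabs M js T))) (?F (reading M (dual_tabs M js' T)))" for js js'
  proof (rule dual_tabs_eq_by_words[OF assms(4)])
    show "dual_words js (?F (reading M T)) = dual_words js' (?F (reading M T))"
      by (rule dual_words_eqI[OF stR bm keq_sym[OF R(1)]]) (use that Fdts in simp)
  qed (use that nzT in \<open>auto simp: ok_def\<close>)
  have inj: "inj_on \<phi> (SYT mu)"
  proof (rule inj_onI)
    fix U V assume UV: "U \<in> SYT mu" "V \<in> SYT mu" "\<phi> U = \<phi> V"
    have "keq (reading M (shift s U)) (reading M (shift s V))"
      using keq_sym[OF key[OF UV(1)]] key[OF UV(2)] UV(3) by (metis rtranclp_trans)
    then have "shift s U = shift s V" using straight_unique[OF sU(1)[OF UV(1)] sU(1)[OF UV(2)] bm bm] by blast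
    then show "U = V" using inj_shift by (metis injD)
  qed
  have im: "\<phi> ` SYT mu \<subseteq> SYT la" using std_tab_SYT[OF st T(2)] unfolding \<phi>_def by blast
  have edge: "cs_edge la (\<phi> U) ((\<lambda>x. x + s) ` I) (\<phi> U')" if e: "cs_edge mu U I U'" for U I U'
  proof -
    obtain i m c where U: "U \<in> SYT mu" and I: "I = {i..i + 2 * m}" and dy: "dyck_interval (row_word mu U) i m"
      and c: "f_tab mu i (collapse U i m) = Some c" "U' = std mu c"
      using e unfolding cs_edge_def by blast
    note stU = sU(2)[OF U]
    have "card (cells mu) = sum_list mu" by (rule SYT_std_tab(2)[OF assms(8) U])
    then have cm: "card D = sum_list mu" using D_def by simp
    have rwU: "row_word mu U = reading M U" using row_word_reading[OF fm] std_tab_nonzero[OF stU] D_def by metis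
    have lenU: "length (reading M U) = card D"
      using distinct_card[OF std_tab_distinct_reading[OF stU, of M]] std_tab_set_reading[OF stU bm] by simp
    have im': "1 \<le> m" "1 \<le> i" "i + 2 * m \<le> card D" and bU: "ballot i m (in_ivl i m (reading M U))"
      using dy unfolding rwU dyck_ballot[OF std_tab_distinct_reading[OF stU]] lenU by auto
    obtain js where js: "U' = dual_tabs M js U" "\<forall>j\<in>set js. i \<le> j \<and> j + 2 \<le> i + 2 * m"
       "two_row i (i + m) (i + 2 * m + 1) (in_ivl i m (dual_words js (reading M U)))" "unmatched (i + m) 0 (in_ivl i m (dual_words js (reading M U))) = 1"
      using edge_target[OF fm stU[unfolded D_def] cm[unfolded D_def] im'(2,1) bU] c by auto
    have U': "U' \<in> SYT mu" using std_tab_SYT[of mu U'] std_tab_dual_tabs[OF stU bm, of js] js(1) cm D_def by auto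
    define k where "k = i + s"
    have ks: "1 \<le> k" "a \<le> k" "k + 2 * m \<le> b" using im' as nab by (auto simp: k_def)
    define v where "v = in_ivl k m (reading M (\<phi> U))"
    define w where "w = in_ivl k m (reading M (shift s U))"
    have vF: "v = in_ivl k m (?F (reading M (\<phi> U)))"
    proof -
      have "(\<lambda>x. ?P x \<and> k \<le> x \<and> x \<le> k + 2 * m) = (\<lambda>x. k \<le> x \<and> x \<le> k + 2 * m)" using ks by auto
      then show ?thesis unfolding v_def filter_filter by simp
    qed
    have vw: "keq v w" unfolding vF w_def by (rule keq_filter[OF key[OF U]])
    have w: "w = map (\<lambda>x. x + s) (in_ivl i m (reading M U))"
      unfolding w_def reading_shift k_def using filter_shift[of i s "i + 2 * m" "reading M U"] by (simp add: add_ac)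
    have bw: "ballot k m w" unfolding w k_def by (rule ballot_shift[OF bU])
    then have bv: "ballot k m v" using ballot_keq[OF keq_sym[OF vw]] by blast
    have st\<phi>: "std_tab 0 (cells la) (\<phi> U)" unfolding \<phi>_def by (rule st)
    have row_seg\<phi>: "row_word la (\<phi> U) = reading M (\<phi> U)" using row_word_reading[OF fl] std_tab_nonzero[OF st\<phi>] by metis
    have len\<phi>: "length (reading M (\<phi> U)) = N"
      using distinct_card[OF std_tab_distinct_reading[OF st\<phi>, of M]] std_tab_set_reading[OF st\<phi> bl] T(2) assms(2) by simp
    have dy\<phi>: "dyck_interval (row_word la (\<phi> U)) k m"
      unfolding row_seg\<phi> dyck_ballot[OF std_tab_distinct_reading[OF st\<phi>]] len\<phi>
      using im'(1) ks(1,3) bv[unfolded v_def] assms(6) by simp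
    obtain c' js' where js': "f_tab la k (collapse (\<phi> U) k m) = Some c'" "std la c' = dual_tabs M js' (\<phi> U)"
       "\<forall>j\<in>set js'. k \<le> j \<and> j + 2 \<le> k + 2 * m"
       "two_row k (k + m) (k + 2 * m + 1) (in_ivl k m (dual_words js' (reading M (\<phi> U))))" "unmatched (k + m) 0 (in_ivl k m (dual_words js' (reading M (\<phi> U)))) = 1"
      by (rule exE[OF edge_target[OF fl st\<phi> T(2) ks(1) im'(1) bv[unfolded v_def]]], elim exE conjE, rule that) assumption+
    have "cs_edge la (\<phi> U) {k..k + 2 * m} (dual_tabs M js' (\<phi> U))"
      unfolding cs_edge_def
      by (intro conjI exI[of _ k] exI[of _ m] exI[of _ c'] std_tab_SYT[OF st\<phi> T(2)] dy\<phi> js'(1) js'(2)[symmetric] refl)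
    moreover have "(\<lambda>x. x + s) ` I = {k..k + 2 * m}" unfolding I k_def by (simp add: add_ac)
    moreover have "dual_tabs M js' (\<phi> U) = \<phi> U'"
    proof -
      \<comment> \<open>The edge at \<open>U\<close> with its values shifted. It and
        \<open>js'\<close>, the edge at \<open>\<phi> U\<close>, are different lists, and
        \<open>edge_uniform\<close> shows that they act alike on \<open>w\<close>.\<close>
      define ls where "ls = map (\<lambda>j. j + s) js"
      have lsr: "\<forall>j\<in>set ls. k \<le> j \<and> j + 2 \<le> k + 2 * m" using js(2) by (auto simp: ls_def k_def)
      have "dual_words ls w = map (\<lambda>x. x + s) (dual_words js (in_ivl i m (reading M U)))" unfolding ls_def w by (rule dual_words_shift)
      then have lw: "dual_words ls w = map (\<lambda>x. x + s) (in_ivl i m (dual_words js (reading M U)))" by (simp add: dual_words_filter[OF js(2)])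
      have "dual_words js' w = dual_words ls w"
      proof (rule edge_uniform[OF ks(1) im'(1) _ _ bv bw])
        have "m < b" using ks im' by linarith
        then show "m < M" "2 \<le> M" using assms(6) unfolding M_def by auto
        show "two_row k (k + m) (k + 2 * m + 1) (dual_words js' v)" "unmatched (k + m) 0 (dual_words js' v) = 1"
          using js'(4,5) unfolding v_def dual_words_filter[OF js'(3)] by auto
        show "two_row k (k + m) (k + 2 * m + 1) (dual_words ls w)"
          using two_row_shift[OF js(3), of s] unfolding lw k_def by (simp add: add_ac)
        show "unmatched (k + m) 0 (dual_words ls w) = 1"
          using unmatched_shift[of "i + m" s 0 "in_ivl i m (dual_words js (reading M U))"] js(4) unfolding lw k_def by (simp add: add_ac)
      qed
      then have "dual_tabs M js' (shift s U) = dual_tabs M ls (shift s U)"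
        using std_tab_nonzero[OF sU(1)[OF U]] bm unfolding w_def by (intro dual_tabs_eq_by_words[OF ks(1) js'(3) lsr]) auto
      then have sh: "dual_tabs M js' (shift s U) = shift s U'" unfolding js(1) dual_tabs_shift ls_def .
      have okj: "ok js'" using js'(3) ks unfolding ok_def by fastforce
      then have okJ: "ok (J U @ js')" using J(1)[OF U] unfolding ok_def by auto
      have \<phi>j: "dual_tabs M js' (\<phi> U) = dual_tabs M (J U @ js') T" by (simp add: \<phi>_def)
      \<comment> \<open>Both chains from \<open>T\<close>, the one along the edge and the chosen one
        for \<open>U'\<close>, have a part in [a, b] that is Knuth equivalent to the shifted
        \<open>U'\<close>; then \<open>uniq\<close> identifies their results.\<close>
      have "keq (?F (reading M (dual_tabs M (J U @ js') T))) (?F (reading M (dual_tabs M (J U') T)))"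
      proof -
        have "?F (reading M (dual_tabs M js' (\<phi> U))) = dual_words js' (?F (reading M (\<phi> U)))"
          using dual_words_filter[of js' a b "reading M (\<phi> U)"] okj unfolding ok_def reading_dual_tabs by simp
        also have "keq \<dots> (dual_words js' (reading M (shift s U)))"
          using std_tab_distinct_reading[OF st\<phi>] by (intro keq_dual_words[OF key[OF U]]) simp
        also have "dual_words js' (reading M (shift s U)) = reading M (shift s U')" unfolding sh[symmetric] reading_dual_tabs ..
        also have "keq (reading M (shift s U')) (?F (reading M (\<phi> U')))" by (rule keq_sym[OF key[OF U']])
        finally show ?thesis unfolding \<phi>j \<phi>_def[of U'] .
      qed
      then show ?thesis unfolding \<phi>j \<phi>_def[of U'] by (rule uniq[OF okJ J(1)[OF U']])
    qed
    ultimately show ?thesis by simp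
  qed
  show ?thesis using inj im edge unfolding s_def by blast
qed

end
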